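(* Let $\Bbbk=\mathbb{R}$ or $\mathbb{C}$ and let $A\in\Bbbk^{m\times n}$ be any matrix, of rank $r$, with positive singular values $\sigma_1\ge\cdots\ge\sigma_r>0$, and set $\sigma_{r+1}=\cdots=\sigma_m=0$. Let $\pi\subset\{1,\ldots,m\}$ and $\pi^c:=\{1,\ldots,m\}\setminus\pi$. Then the condition number of the map $\mathcal{L}_\pi^{\Bbbk}:\mathcal{U}_\pi\to\mathrm{Gr}(k,\Bbbk^m)$, $k=\sharp\pi$, which takes a matrix to its left singular subspace $\mathrm{U}_\pi$, satisfies $$ \kappa_\pi^{\Bbbk}(A):=\begin{cases}\kappa[\mathcal{L}_\pi^{\Bbbk}](A) & \text{if } A\in\mathcal{U}_\pi,\\ \infty & \text{if } A\notin\mathcal{U}_\pi\end{cases} \;=\;\max_{i\in\pi,\; j\in\pi^c}\;\frac{1}{|\sigma_i-\sigma_j|}\cdot\sqrt{\frac{\sigma_i^2+\sigma_j^2}{(\sigma_i+\sigma_j)^2}}, $$ where the condition number is taken with respect to the Euclidean (Frobenius) distance on the domain and any of the chordal, Grassmann, and Procrustes distances on the codomain. If $\pi=\emptyset$ or $\pi^c=\emptyset$, the right-hand side is understood to be zero.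
   Context: Condition number: for a map $f:X\to Y$ between metric spaces $(X,d_X)$, $(Y,d_Y)$ and $x\in X$, $$\kappa[f](x):=\lim_{\epsilon\to0}\ \sup_{x'\in X,\ 0<d_X(x,x')\le\epsilon}\frac{d_Y(f(x),f(x'))}{d_X(x,x')}.$$ Singular subspaces: a full SVD of $A\in\Bbbk^{m\times n}$ of rank $r$ is $A=U\widehat\Sigma V^H$ with $U\in\Bbbk^{m\times m}$, $V\in\Bbbk^{n\times n}$ unitary (orthogonal if $\Bbbk=\mathbb{R}$) and $\widehat\Sigma$ the $m\times n$ matrix whose upper left $r\times r$ block is $\mathrm{diag}(\sigma_1,\ldots,\sigma_r)$, $\sigma_1\ge\cdots\ge\sigma_r>0$, and which is zero elsewhere. For a nonzero singular value $\sigma'$ of $A$, $\mathrm{U}_{\sigma'}\subset\Bbbk^m$ is the span of the columns of $U$ corresponding to $\sigma'$, i.e., the eigenspace of $AA^H$ with eigenvalue $\sigma'^2$; $\mathrm{U}_0$ is the cokernel of $A$ (the kernel of $AA^H$), of dimension $m-r$. A left singular subspace of $A$ is a direct sum $\mathrm{U}_S$ of the spaces $\mathrm{U}_{\sigma'}$ over $\sigma'\in S$, where $S$ is a subset of the set consisting of the distinct nonzero singular values and $0$. For $\pi\subset\{1,\ldots,m\}$ with $\sharp\pi=k$, let $\mathrm{U}_\pi$ be the span of the columns $\mathbf{u}_i$, $i\in\pi$, of $U$ in a full SVD of $A$, and let $\mathcal{U}_\pi=\{A\in\Bbbk^{m\times n}\mid \mathrm{U}_\pi\text{ is a left singular subspace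 of }A\}$; that is, with $\sigma_{r+1}=\cdots=\sigma_m=0$, whenever $i\in\pi$, all indices $j\in\{1,\ldots,m\}$ with $\sigma_j=\sigma_i$ also lie in $\pi$. On $\mathcal{U}_\pi$ the space $\mathrm{U}_\pi$ is well defined (independent of the SVD), and $\mathcal{L}_\pi^{\Bbbk}:\mathcal{U}_\pi\to\mathrm{Gr}(k,\Bbbk^m)$, $A\mapsto\mathrm{U}_\pi$. Distances: $\mathrm{Gr}(d,\Bbbk^p)$ is the Grassmannian of $d$-dimensional linear subspaces of $\Bbbk^p$, identified with the rank-$d$ orthogonal projectors $QQ^H$, $Q\in\Bbbk^{p\times d}$, $Q^HQ=I_d$. The principal angles between $P=QQ^H$ and $P'=Q'Q'^H$ are $\theta_i=\cos^{-1}(\sigma_i(Q^HQ'))$, $i=1,\ldots,d$, with $\sigma_i(\cdot)$ the $i$th largest singular value; $\boldsymbol\theta=(\theta_1,\ldots,\theta_d)$. The chordal distance is $d_{\mathrm{Gr}}^c(P,P')=\|\sin\boldsymbol\theta\|=\frac1{\sqrt2}\|P-P'\|_F$, the Grassmann distance is $d_{\mathrm{Gr}}^G(P,P')=\|\boldsymbol\theta\|$, and the Procrustes distance is $d_{\mathrm{Gr}}^P(P,P')=\|2\sin(\boldsymbol\theta/2)\|$ (functions applied elementwise, $\|\cdot\|$ Euclidean). The domain $\mathcal{U}_\pi$ carries the Euclidean distance $\|A-A'\|_F$ (Frobenius norm). In the displayed maximum, a term with $\sigma_i=\sigma_j$ (including $\sigma_i=\sigma_j=0$) is understood to equal $\infty$.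 *)

theory Defs
  imports
    "HOL-Analysis.Analysis"
    "Jordan_Normal_Form.DL_Rank"
    "Jordan_Normal_Form.Schur_Decomposition"
begin

text \<open>
  Matrices and vectors are those of Jordan-Normal-Form, so indices start at 0: the index set
  \<open>{1,...,m}\<close> of the singular values becomes \<open>{..<m}\<close>.  Definitions are polymorphic in the
  field of scalars and are meant for its instances \<^typ>\<open>real\<close> and \<^typ>\<open>complex\<close>
  (over \<^typ>\<open>real\<close>, \<^const>\<open>mat_adjoint\<close> is the transpose).
\<close>

text \<open>
  Values are in \<^typ>\<open>ennreal\<close>, so that the supremum over the empty set (\<open>x\<close> isolated in \<open>X\<close>)
  is 0.  The limit always exists, because the supremum is monotone in \<open>\<epsilon>\<close>.
\<close>

definition condition_number ::
  "'a set \<Rightarrow> ('a \<Rightarrow> 'a \<Rightarrow> real) \<Rightarrow> ('b \<Rightarrow> 'b \<Rightarrow> real) \<Rightarrow> ('a \<Rightarrow> 'b) \<Rightarrow> 'a \<Rightarrow> ennreal" where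
  "condition_number X dX dY f x =
     Lim (at_right (0::real))
       (\<lambda>\<epsilon>. SUP x' \<in> {x' \<in> X. 0 < dX x x' \<and> dX x x' \<le> \<epsilon>}. ennreal (dY (f x) (f x') / dX x x'))"

definition unitary_mat :: "nat \<Rightarrow> 'a::conjugatable_field mat \<Rightarrow> bool" where
  "unitary_mat m U \<longleftrightarrow> U \<in> carrier_mat m m \<and> mat_adjoint U * U = 1\<^sub>m m \<and> U * mat_adjoint U = 1\<^sub>m m"

text \<open>
  The sequence \<open>\<sigma>\<close> of singular values is padded by zeros from the rank of \<open>A\<close> onwards.
\<close>

definition full_svd ::
  "'a::{conjugatable_field, real_normed_field} mat \<Rightarrow> 'a mat \<Rightarrow> (nat \<Rightarrow> real) \<Rightarrow> 'a mat \<Rightarrow> bool" where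
  "full_svd A U \<sigma> V \<longleftrightarrow>
     (let m = dim_row A; n = dim_col A; r = vec_space.rank m A in
        unitary_mat m U \<and> unitary_mat n V \<and>
        (\<forall>i<r. 0 < \<sigma> i) \<and> (\<forall>i j. i \<le> j \<longrightarrow> j < r \<longrightarrow> \<sigma> j \<le> \<sigma> i) \<and> (\<forall>i\<ge>r. \<sigma> i = 0) \<and>
        A = U * mat m n (\<lambda>(i, j). if i = j then of_real (\<sigma> i) else 0) * mat_adjoint V)"

definition singular_value :: "'a::{conjugatable_field, real_normed_field} mat \<Rightarrow> nat \<Rightarrow> real" where
  "singular_value A = (THE \<sigma>. \<exists>U V. full_svd A U \<sigma> V)"

abbreviation vec_span :: "nat \<Rightarrow> 'a::field vec set \<Rightarrow> 'a vec set" where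
  "vec_span m \<equiv> LinearCombinations.module.span class_ring (module_vec TYPE('a) m)"

text \<open>
  The eigenspace of \<open>A A\<^sup>H\<close> for the eigenvalue \<open>s\<^sup>2\<close>; for \<open>s = 0\<close> it is the cokernel of \<open>A\<close>.
\<close>

definition left_singular_space ::
  "'a::{conjugatable_field, real_normed_field} mat \<Rightarrow> real \<Rightarrow> 'a vec set" where
  "left_singular_space A s =
     {x \<in> carrier_vec (dim_row A). (A * mat_adjoint A) *\<^sub>v x = of_real (s\<^sup>2) \<cdot>\<^sub>v x}"

definition is_left_singular_subspace ::
  "'a::{conjugatable_field, real_normed_field} mat \<Rightarrow> 'a vec set \<Rightarrow> bool" where
  "is_left_singular_subspace A W \<longleftrightarrow>
     (\<exists>S \<subseteq> insert 0 (singular_value A ` {..<vec_space.rank (dim_row A) A}).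
        W = vec_span (dim_row A) (\<Union>s\<in>S. left_singular_space A s))"

definition cols_span :: "'a::field mat \<Rightarrow> nat set \<Rightarrow> 'a vec set" where
  "cols_span U \<pi> = vec_span (dim_row U) (col U ` \<pi>)"

definition left_singular_domain ::
  "nat \<Rightarrow> nat \<Rightarrow> nat set \<Rightarrow> 'a::{conjugatable_field, real_normed_field} mat set" where
  "left_singular_domain m n \<pi> =
     {A \<in> carrier_mat m n.
        \<exists>U \<sigma> V. full_svd A U \<sigma> V \<and> is_left_singular_subspace A (cols_span U \<pi>)}"

text \<open>
  This is well defined on \<^const>\<open>left_singular_domain\<close> only, as the columns of \<open>U\<close> depend on
  the choice of the decomposition.
\<close>

definition left_singular_map ::
  "nat set \<Rightarrow> 'a::{conjugatable_field, real_normed_field} mat \<Rightarrow> 'a vec set" where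
  "left_singular_map \<pi> A = (THE W. \<exists>U \<sigma> V. full_svd A U \<sigma> V \<and> W = cols_span U \<pi>)"

definition frobenius_norm :: "'a::real_normed_vector mat \<Rightarrow> real" where
  "frobenius_norm A = sqrt (\<Sum>i<dim_row A. \<Sum>j<dim_col A. (norm (A $$ (i, j)))\<^sup>2)"

definition frobenius_dist :: "'a::real_normed_vector mat \<Rightarrow> 'a mat \<Rightarrow> real" where
  "frobenius_dist A B = frobenius_norm (A - B)"

text \<open>
  A point of the Grassmannian of \<open>d\<close>-dimensional subspaces of a \<open>p\<close>-dimensional space is a subspace
  \<open>W\<close>, the range of the orthogonal projector \<open>Q Q\<^sup>H\<close> for any orthonormal frame \<open>Q\<close> of \<open>W\<close>.  The
  principal angles do not depend on the chosen frames.
\<close>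

definition orthonormal_frame ::
  "nat \<Rightarrow> nat \<Rightarrow> 'a::conjugatable_field vec set \<Rightarrow> 'a mat \<Rightarrow> bool" where
  "orthonormal_frame p d W Q \<longleftrightarrow>
     Q \<in> carrier_mat p d \<and> mat_adjoint Q * Q = 1\<^sub>m d \<and> vec_space.col_space p Q = W"

definition principal_angle ::
  "nat \<Rightarrow> nat \<Rightarrow> 'a::{conjugatable_field, real_normed_field} vec set \<Rightarrow> 'a vec set \<Rightarrow> nat \<Rightarrow> real" where
  "principal_angle p d W W' i =
     (let Q = (SOME Q. orthonormal_frame p d W Q); Q' = (SOME Q'. orthonormal_frame p d W' Q')
      in arccos (singular_value (mat_adjoint Q * Q') i))"

definition chordal_dist ::
  "nat \<Rightarrow> nat \<Rightarrow> 'a::{conjugatable_field, real_normed_field} vec set \<Rightarrow> 'a vec set \<Rightarrow> real" where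
  "chordal_dist p d W W' = sqrt (\<Sum>i<d. (sin (principal_angle p d W W' i))\<^sup>2)"

definition grassmann_dist ::
  "nat \<Rightarrow> nat \<Rightarrow> 'a::{conjugatable_field, real_normed_field} vec set \<Rightarrow> 'a vec set \<Rightarrow> real" where
  "grassmann_dist p d W W' = sqrt (\<Sum>i<d. (principal_angle p d W W' i)\<^sup>2)"

definition procrustes_dist ::
  "nat \<Rightarrow> nat \<Rightarrow> 'a::{conjugatable_field, real_normed_field} vec set \<Rightarrow> 'a vec set \<Rightarrow> real" where
  "procrustes_dist p d W W' = sqrt (\<Sum>i<d. (2 * sin (principal_angle p d W W' i / 2))\<^sup>2)"

definition kappa_left ::
  "(nat \<Rightarrow> nat \<Rightarrow> 'a vec set \<Rightarrow> 'a vec set \<Rightarrow> real) \<Rightarrow> nat \<Rightarrow> nat \<Rightarrow> nat set \<Rightarrow>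
    'a::{conjugatable_field, real_normed_field} mat \<Rightarrow> ennreal" where
  "kappa_left dGr m n \<pi> A =
     (if A \<in> left_singular_domain m n \<pi>
      then condition_number (left_singular_domain m n \<pi>) frobenius_dist (dGr m (card \<pi>))
             (left_singular_map \<pi>) A
      else \<infinity>)"

definition gap_term :: "real \<Rightarrow> real \<Rightarrow> ennreal" where
  "gap_term s t =
     (if s = t then \<infinity>
      else ennreal (1 / \<bar>s - t\<bar> * sqrt ((s\<^sup>2 + t\<^sup>2) / (s + t)\<^sup>2)))"

definition max_gap_term :: "nat \<Rightarrow> nat set \<Rightarrow> (nat \<Rightarrow> real) \<Rightarrow> ennreal" where
  "max_gap_term m \<pi> \<sigma> =
     (if \<pi> = {} \<or> {..<m} - \<pi> = {} then 0
      else Max ((\<lambda>(i, j). gap_term (\<sigma> i) (\<sigma> j)) ` (\<pi> \<times> ({..<m} - \<pi>))))"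

end

theory Submission
  imports Defs
begin

text \<open>
  Write \<open>A = U \<Sigma> V\<^sup>H\<close> and let \<open>B = U' \<Sigma>' V'\<^sup>H\<close>, with singular values \<open>\<tau>\<close>, be a matrix of the domain
  near \<open>A\<close>.  Everything is read off from the unitary matrix \<open>X = U\<^sup>H U'\<close>.  The squared chordal distance
  of the two subspaces is the squared Frobenius norm of the block of \<open>X\<close> with rows outside and
  columns inside \<open>\<pi>\<close> (\<open>chordal_dist_eq\<close>).  The Procrustes and the Grassmann distance lie between the
  chordal distance and \<open>1 + \<delta>\<close> times the chordal distance once the latter is small
  (\<open>chordal_le_procrustes_le_grassmann\<close>, \<open>grassmann_le_chordal\<close>).  An upper bound for the Grassmann
  distance and a lower bound for the chordal distance therefore settle all three.

  Upper bound.  Put \<open>F = U\<^sup>H (A - B) V'\<close> and \<open>G = V\<^sup>H (A - B)\<^sup>H U'\<close>.  Eliminating \<open>V\<^sup>H V'\<close> from the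
  entries of \<open>F\<close> and \<open>G\<close> leaves (\<open>svd_coupling\<close>)
  \<open>(\<sigma>\<^sub>i\<^sup>2 - \<tau>\<^sub>j\<^sup>2) X\<^sub>i\<^sub>j = \<tau>\<^sub>j F\<^sub>i\<^sub>j + \<sigma>\<^sub>i G\<^sub>i\<^sub>j\<close>, so that by Cauchy-Schwarz
  \<open>|X\<^sub>i\<^sub>j|\<^sup>2\<close> is at most \<open>(\<sigma>\<^sub>i\<^sup>2 + \<tau>\<^sub>j\<^sup>2) / (\<sigma>\<^sub>i\<^sup>2 - \<tau>\<^sub>j\<^sup>2)\<^sup>2\<close> times \<open>|F\<^sub>i\<^sub>j|\<^sup>2 + |G\<^sub>i\<^sub>j|\<^sup>2\<close>.  Summing over a
  single off-diagonal block would lose a factor 2, because \<open>F\<close> and \<open>G\<close> both have the Frobenius norm of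
  \<open>A - B\<close>.  But the two off-diagonal blocks of a unitary matrix have the same norm, and the sum over
  both of them gives twice the squared distance on the left against twice the squared norm of \<open>A - B\<close>
  on the right (\<open>chordal_dist_svd_le\<close>).  By Weyl's inequality (\<open>singular_value_perturbation\<close>) \<open>\<tau>\<close> tends
  to \<open>\<sigma>\<close> as \<open>B\<close> tends to \<open>A\<close>, and the constant tends to the asserted maximum.

  Lower bound.  For a pair \<open>(i, j)\<close>, rotate the columns \<open>i\<close> and \<open>j\<close> of \<open>U\<close> by the angle \<open>t\<close> and those of
  \<open>V\<close> by \<open>b t\<close>, and keep the singular values.  The new matrix stays in the domain, its subspace has
  chordal distance \<open>|sin t|\<close> from the old one, and the matrix itself has moved by \<open>t\<close> times
  \<open>sqrt ((\<sigma>\<^sub>j - b \<sigma>\<^sub>i)\<^sup>2 + (b \<sigma>\<^sub>j - \<sigma>\<^sub>i)\<^sup>2)\<close>, up to \<open>o(t)\<close>.  The choice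
  \<open>b = 2 \<sigma>\<^sub>i \<sigma>\<^sub>j / (\<sigma>\<^sub>i\<^sup>2 + \<sigma>\<^sub>j\<^sup>2)\<close> minimises this length, and the quotient of the two distances tends to
  the term of the pair \<open>(i, j)\<close> (\<open>rotated_svd\<close>, \<open>rotation_cost_limit\<close>).

  The domain consists of the matrices whose singular values with index in \<open>\<pi>\<close> differ from all others
  (\<open>left_singular_domain_iff\<close>).  Outside of it the maximum has an infinite term, which agrees with the
  value \<open>\<infinity>\<close> of \<open>kappa_left\<close>.
\<close>

section \<open>Adjoints and the Frobenius norm\<close>

unbundle no vec_syntax
unbundle no inner_syntax

notation mat_adjoint (\<open>(_\<^sup>H)\<close> [1000] 1000)

lemma adjoint_carrier [simp, intro]: "A \<in> carrier_mat m n \<Longrightarrow> A\<^sup>H \<in> carrier_mat n m"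
  by (auto simp: mat_adjoint_def mat_of_rows_def)

lemma dim_adjoint [simp]: "dim_row A\<^sup>H = dim_col A" "dim_col A\<^sup>H = dim_row A"
  by (auto simp: mat_adjoint_def mat_of_rows_def)

lemma adjoint_index [simp]:
  "i < dim_col A \<Longrightarrow> j < dim_row A \<Longrightarrow> A\<^sup>H $$ (i, j) = conjugate (A $$ (j, i))"
  by (simp add: mat_adjoint_def mat_of_rows_def)

lemma mat_adjoint_adjoint [simp]: "(A\<^sup>H)\<^sup>H = A"
  by (rule eq_matI) auto

lemma mult_index:
  "i < dim_row A \<Longrightarrow> j < dim_col B \<Longrightarrow> dim_col A = dim_row B \<Longrightarrow>
     (A * B) $$ (i, j) = (\<Sum>k<dim_row B. A $$ (i, k) * B $$ (k, j))"
  by (simp add: scalar_prod_def atLeast0LessThan)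

lemma mult_index_carrier:
  "A \<in> carrier_mat m k \<Longrightarrow> B \<in> carrier_mat k n \<Longrightarrow> i < m \<Longrightarrow> j < n \<Longrightarrow>
     (A * B) $$ (i, j) = (\<Sum>l<k. A $$ (i, l) * B $$ (l, j))"
  by (subst mult_index) auto

lemma adjoint_mult:
  fixes A B :: "'a::conjugatable_field mat"
  assumes "A \<in> carrier_mat m k" "B \<in> carrier_mat k n"
  shows "(A * B)\<^sup>H = B\<^sup>H * A\<^sup>H"
proof (rule eq_matI)
  fix i j assume ij: "i < dim_row (B\<^sup>H * A\<^sup>H)" "j < dim_col (B\<^sup>H * A\<^sup>H)"
  then have ij': "i < n" "j < m" using assms by auto
  have "(A * B)\<^sup>H $$ (i, j) = conjugate (\<Sum>l<k. A $$ (j, l) * B $$ (l, i))"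
    using assms ij' by (simp add: mult_index_carrier[OF assms] del: index_mult_mat(1))
  also have "\<dots> = (\<Sum>l<k. B\<^sup>H $$ (i, l) * A\<^sup>H $$ (l, j))"
    using assms ij' by (auto simp: sum_conjugate conjugate_dist_mul mult.commute intro!: sum.cong)
  also have "\<dots> = (B\<^sup>H * A\<^sup>H) $$ (i, j)"
    using mult_index_carrier[of "B\<^sup>H" n k "A\<^sup>H" m i j] assms ij' by auto
  finally show "(A * B)\<^sup>H $$ (i, j) = (B\<^sup>H * A\<^sup>H) $$ (i, j)" .
qed (use assms in auto)

lemma adjoint_mult_index:
  fixes A B :: "'a::conjugatable_field mat"
  assumes "A \<in> carrier_mat m k" "B \<in> carrier_mat m n" "i < k" "j < n"
  shows "(A\<^sup>H * B) $$ (i, j) = (\<Sum>l<m. conjugate (A $$ (l, i)) * B $$ (l, j))"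
  using assms by (subst mult_index_carrier[where k=m]) auto

lemma conjugate_one [simp]: "conjugate (1::'a::conjugatable_field) = 1"
proof -
  have "conjugate (1::'a) * conjugate 1 = conjugate 1"
    by (metis conjugate_dist_mul mult_1)
  moreover have "conjugate (1::'a) \<noteq> 0" using conjugate_zero_iff[of "1::'a"] by simp
  ultimately show ?thesis by simp
qed

lemma adjoint_one [simp]: "(1\<^sub>m n :: 'a::conjugatable_field mat)\<^sup>H = 1\<^sub>m n"
  by (rule eq_matI) auto

lemma adjoint_minus:
  fixes A B :: "'a::conjugatable_field mat"
  assumes "A \<in> carrier_mat m n" "B \<in> carrier_mat m n"
  shows "(A - B)\<^sup>H = A\<^sup>H - B\<^sup>H"
proof -
  have c: "conjugate (x - y) = conjugate x - conjugate y" for x y :: 'a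
    using conjugate_dist_add[of x "-y"] by (simp add: conjugate_neg)
  show ?thesis by (rule eq_matI) (use assms in \<open>auto simp: c\<close>)
qed

text \<open>
  The scalars of both halves of the theorem at once: the axiom says that the field sits inside the
  complex numbers, compatibly with real scalars, conjugation and norm. It is stated through an
  embedding because this expresses \<open>z z\<^sup>* = |z|\<^sup>2\<close> as well as the access to
  eigenvalues of Hermitian matrices by one condition on scalars.
\<close>

class rc_field = conjugatable_field + real_normed_field +
  assumes complex_embedding:
    "\<exists>h::'a \<Rightarrow> complex. (\<forall>x y. h (x + y) = h x + h y) \<and> (\<forall>x y. h (x * y) = h x * h y) \<and>
       h 1 = 1 \<and> (\<forall>r x. h (scaleR r x) = scaleR r (h x)) \<and>
       (\<forall>x. h (conjugate x) = cnj (h x)) \<and> (\<forall>x. norm (h x) = norm x)"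

instance real :: rc_field
  by standard (rule exI[of _ complex_of_real], auto simp: scaleR_conv_of_real)

instance complex :: rc_field
  by standard (rule exI[of _ "\<lambda>x. x"], auto)

lemma complex_embeddingE:
  obtains h :: "'a::rc_field \<Rightarrow> complex" where "field_hom h" "\<And>r. h (of_real r) = of_real r"
    "\<And>x. h (conjugate x) = cnj (h x)" "\<And>x. norm (h x) = norm x"
proof -
  obtain h :: "'a \<Rightarrow> complex" where h: "\<And>x y. h (x + y) = h x + h y" "\<And>x y. h (x * y) = h x * h y"
    "h 1 = 1" "\<And>r x. h (scaleR r x) = scaleR r (h x)"
    "\<And>x. h (conjugate x) = cnj (h x)" "\<And>x. norm (h x) = norm x"
    using complex_embedding[where 'a='a] by blast
  have "h 0 = 0" using h(6)[of 0] by simp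
  then have "field_hom h" using h by unfold_locales auto
  moreover have "h (of_real r) = of_real r" for r using h(3,4) by (simp add: of_real_def)
  ultimately show ?thesis using that h by blast
qed

lemma mult_conjugate: "x * conjugate x = (of_real ((norm x)\<^sup>2) :: 'a::rc_field)"
proof -
  obtain h :: "'a \<Rightarrow> complex" where h: "field_hom h" "\<And>r. h (of_real r) = of_real r"
    "\<And>x. h (conjugate x) = cnj (h x)" "\<And>x. norm (h x) = norm x" using complex_embeddingE by blast
  interpret field_hom h by (rule h(1))
  have "h (x * conjugate x) = h (of_real ((norm x)\<^sup>2))"
    unfolding hom_mult h(2,3) h(4)[symmetric]
    by (rule complex_norm_square[symmetric])
  then show ?thesis by simp
qed

lemma conjugate_mult_self: "conjugate x * x = of_real ((norm (x::'a::rc_field))\<^sup>2)"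
  using mult_conjugate[of x] by (simp add: mult.commute)

lemma norm_conjugate [simp]: "norm (conjugate x) = norm (x::'a::rc_field)"
proof -
  have "(of_real ((norm (conjugate x))\<^sup>2) :: 'a) = of_real ((norm x)\<^sup>2)"
    using mult_conjugate[of x] mult_conjugate[of "conjugate x"] by (simp add: mult.commute)
  then show ?thesis by (simp only: of_real_eq_iff power2_eq_iff_nonneg norm_ge_zero)
qed

lemma conjugate_of_real [simp]: "conjugate (of_real r) = (of_real r :: 'a::rc_field)"
proof (cases "r = 0")
  case False
  have "of_real r * conjugate (of_real r :: 'a) = of_real r * of_real r"
    using mult_conjugate[of "of_real r :: 'a"] by (simp add: power2_eq_square)
  then show ?thesis using False by simp
qed auto

lemma frobenius_norm_sq:
  "(frobenius_norm A)\<^sup>2 = (\<Sum>i<dim_row A. \<Sum>j<dim_col A. (norm (A $$ (i, j)))\<^sup>2)"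
  unfolding frobenius_norm_def by (intro real_sqrt_pow2 sum_nonneg) auto

lemma frobenius_norm_nonneg [simp]: "0 \<le> frobenius_norm A"
  unfolding frobenius_norm_def by (intro real_sqrt_ge_zero sum_nonneg) auto

lemma frobenius_norm_sq_carrier:
  "A \<in> carrier_mat m n \<Longrightarrow> (frobenius_norm A)\<^sup>2 = (\<Sum>i<m. \<Sum>j<n. (norm (A $$ (i, j)))\<^sup>2)"
  by (auto simp: frobenius_norm_sq)

lemma frobenius_norm_eq_iff:
  "frobenius_norm A = frobenius_norm B \<longleftrightarrow> (frobenius_norm A)\<^sup>2 = (frobenius_norm B)\<^sup>2"
  by simp

text \<open>
  The Frobenius norm is a function of the Gram matrix \<open>A\<^sup>H A\<close>, and multiplication
  by an isometry from the left does not change that matrix; this is why unitary factors can be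
  dropped from norms below.
\<close>

lemma frobenius_gram:
  assumes "A \<in> carrier_mat m n"
  shows "(of_real ((frobenius_norm A)\<^sup>2) :: 'a::rc_field) = (\<Sum>j<n. (A\<^sup>H * A) $$ (j, j))"
proof -
  have "(\<Sum>j<n. (A\<^sup>H * A) $$ (j, j)) = (\<Sum>j<n. \<Sum>i<m. conjugate (A $$ (i, j)) * A $$ (i, j))"
    using assms by (intro sum.cong refl) (subst mult_index_carrier[where k=m], auto)
  also have "\<dots> = (\<Sum>i<m. \<Sum>j<n. of_real ((norm (A $$ (i, j)))\<^sup>2))"
    by (subst sum.swap) (simp only: conjugate_mult_self)
  finally show ?thesis using assms by (simp add: frobenius_norm_sq_carrier)
qed

lemma frobenius_norm_adjoint [simp]: "frobenius_norm A\<^sup>H = frobenius_norm (A :: 'a::rc_field mat)"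
  unfolding frobenius_norm_eq_iff frobenius_norm_sq by (subst sum.swap) simp

lemma isometry_left_cancel:
  fixes Q :: "'a::rc_field mat"
  assumes "Q \<in> carrier_mat m k" "Q\<^sup>H * Q = 1\<^sub>m k" "B \<in> carrier_mat k n"
  shows "Q\<^sup>H * (Q * B) = B"
  using assms assoc_mult_mat[of "Q\<^sup>H" k m Q k B n] by simp

lemma isometry_gram:
  fixes Q :: "'a::rc_field mat"
  assumes Q: "Q \<in> carrier_mat m k" "Q\<^sup>H * Q = 1\<^sub>m k" and B: "B \<in> carrier_mat k n"
  shows "(Q * B)\<^sup>H * (Q * B) = B\<^sup>H * B"
proof -
  have "(Q * B)\<^sup>H * (Q * B) = B\<^sup>H * Q\<^sup>H * (Q * B)" by (simp add: adjoint_mult[OF Q(1) B])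
  also have "\<dots> = B\<^sup>H * (Q\<^sup>H * (Q * B))" using Q B by (intro assoc_mult_mat) auto
  also have "\<dots> = B\<^sup>H * B" by (simp add: isometry_left_cancel[OF Q B])
  finally show ?thesis .
qed

lemma frobenius_norm_isometry_left:
  fixes A :: "'a::rc_field mat"
  assumes "Q \<in> carrier_mat p m" "Q\<^sup>H * Q = 1\<^sub>m m" "A \<in> carrier_mat m n"
  shows "frobenius_norm (Q * A) = frobenius_norm A"
proof -
  have "(of_real ((frobenius_norm (Q * A))\<^sup>2) :: 'a) = of_real ((frobenius_norm A)\<^sup>2)"
    using frobenius_gram[of "Q * A" p n] frobenius_gram[of A m n] isometry_gram[OF assms] assms by auto
  then show ?thesis by (simp only: of_real_eq_iff frobenius_norm_eq_iff[symmetric])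
qed

lemma frobenius_norm_isometry_right:
  fixes A :: "'a::rc_field mat"
  assumes "Q \<in> carrier_mat p n" "Q\<^sup>H * Q = 1\<^sub>m n" "A \<in> carrier_mat m n"
  shows "frobenius_norm (A * Q\<^sup>H) = frobenius_norm A"
proof -
  have "frobenius_norm (A * Q\<^sup>H) = frobenius_norm ((A * Q\<^sup>H)\<^sup>H)" by simp
  also have "(A * Q\<^sup>H)\<^sup>H = Q * A\<^sup>H"
    using adjoint_mult[of A m n "Q\<^sup>H" p] assms by simp
  also have "frobenius_norm (Q * A\<^sup>H) = frobenius_norm A"
    using frobenius_norm_isometry_left[of Q p n "A\<^sup>H" m] assms by simp
  finally show ?thesis .
qed

lemma frobenius_norm_triangle:
  fixes A B :: "'a::real_normed_vector mat"
  assumes "A \<in> carrier_mat m n" "B \<in> carrier_mat m n"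
  shows "frobenius_norm (A + B) \<le> frobenius_norm A + frobenius_norm B"
proof -
  have L: "frobenius_norm C = L2_set (\<lambda>p. norm (C $$ p)) ({..<m} \<times> {..<n})"
    if "C \<in> carrier_mat m n" for C :: "'a mat"
    using that by (auto simp: frobenius_norm_def L2_set_def sum.cartesian_product case_prod_unfold)
  have "frobenius_norm (A + B) = L2_set (\<lambda>p. norm (A $$ p + B $$ p)) ({..<m} \<times> {..<n})"
    using assms by (subst L) (auto intro!: L2_set_cong)
  also have "\<dots> \<le> L2_set (\<lambda>p. norm (A $$ p) + norm (B $$ p)) ({..<m} \<times> {..<n})"
    by (intro L2_set_mono norm_triangle_ineq) auto
  also have "\<dots> \<le> frobenius_norm A + frobenius_norm B"
    using assms by (simp add: L L2_set_triangle_ineq)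
  finally show ?thesis .
qed

section \<open>Orthonormal columns and their completion\<close>

abbreviation column_mat :: "nat \<Rightarrow> (nat \<Rightarrow> 'a) \<Rightarrow> 'a mat" where
  "column_mat n f \<equiv> mat n 1 (\<lambda>(i, j). f i)"

lemma column_carrier: "column_mat n f \<in> carrier_mat n 1"
  by simp

lemma mult_column_index:
  fixes A :: "'a::rc_field mat"
  assumes "A \<in> carrier_mat m n" "v \<in> carrier_vec n" "i < m"
  shows "(A * column_mat n (\<lambda>i. c * v $ i)) $$ (i, 0) = c * (A *\<^sub>v v) $ i"
proof -
  have "(A * column_mat n (\<lambda>i. c * v $ i)) $$ (i, 0) = (\<Sum>l<n. A $$ (i, l) * (c * v $ l))"
    using mult_index_carrier[OF assms(1) column_carrier assms(3), of 0] by simp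
  then show ?thesis
    using assms by (simp add: scalar_prod_def atLeast0LessThan sum_distrib_left mult.left_commute)
qed

lemma unit_multiple:
  fixes v :: "'a::rc_field vec"
  assumes "v \<in> carrier_vec n" "v \<noteq> 0\<^sub>v n"
  obtains c where "(column_mat n (\<lambda>i. c * v $ i))\<^sup>H * column_mat n (\<lambda>i. c * v $ i) = 1\<^sub>m 1"
proof -
  let ?s = "\<Sum>i<n. (norm (v $ i))\<^sup>2"
  have "?s \<noteq> 0" using assms by (auto simp: sum_nonneg_eq_0_iff)
  then have s: "0 < ?s" by (simp add: sum_nonneg order_less_le)
  define c where "c = (of_real (1 / sqrt ?s) :: 'a)"
  let ?x = "column_mat n (\<lambda>i. c * v $ i)"
  have nc: "(norm c)\<^sup>2 = 1 / ?s"
    using s by (simp add: c_def norm_divide power_divide)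
  have "(frobenius_norm ?x)\<^sup>2 = (\<Sum>i<n. (norm c)\<^sup>2 * (norm (v $ i))\<^sup>2)"
    by (subst frobenius_norm_sq_carrier[OF column_carrier]) (simp add: norm_mult power_mult_distrib)
  also have "\<dots> = 1" using s unfolding nc sum_distrib_left[symmetric] by simp
  finally have "(?x\<^sup>H * ?x) $$ (0, 0) = 1"
    using frobenius_gram[OF column_carrier, of n "\<lambda>i. c * v $ i"] by simp
  then have "?x\<^sup>H * ?x = 1\<^sub>m 1" by (intro eq_matI) auto
  then show ?thesis by (rule that)
qed

text \<open>
  Padding the system by zero rows makes it square with determinant 0, and a kernel vector can be
  normalised. This is the dimension count behind the completion of orthonormal columns and behind
  Weyl's inequality.
\<close>

lemma underdetermined_solution:
  fixes B :: "'a::rc_field mat"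
  assumes B: "B \<in> carrier_mat p q" and pq: "p < q"
  obtains x where "x \<in> carrier_mat q 1" "x\<^sup>H * x = 1\<^sub>m 1" "B * x = 0\<^sub>m p 1"
proof -
  let ?c = "\<lambda>i. if i < p then vec q (\<lambda>j. B $$ (i, j)) else 0\<^sub>v q"
  let ?M = "mat\<^sub>r q q (\<lambda>i. if i = q - 1 then 0\<^sub>v q else ?c i)"
  have "Determinant.det ?M = 0" using pq by (intro det_row_0) auto
  then obtain v where v: "v \<in> carrier_vec q" "v \<noteq> 0\<^sub>v q" "?M *\<^sub>v v = 0\<^sub>v q"
    using det_0_iff_vec_prod_zero_field[of ?M q] by auto
  obtain c where c: "(column_mat q (\<lambda>i. c * v $ i))\<^sup>H * column_mat q (\<lambda>i. c * v $ i) = 1\<^sub>m 1"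
    using unit_multiple[OF v(1,2)] by blast
  have "B * column_mat q (\<lambda>i. c * v $ i) = 0\<^sub>m p 1"
  proof (rule eq_matI)
    fix i j assume "i < dim_row (0\<^sub>m p 1 :: 'a mat)" "j < dim_col (0\<^sub>m p 1 :: 'a mat)"
    then have ij: "i < p" "j = 0" by auto
    have "(?M *\<^sub>v v) $ i = 0" using v(3) ij pq by simp
    moreover have "(?M *\<^sub>v v) $ i = (\<Sum>j<q. B $$ (i, j) * v $ j)"
      using ij pq v(1) by (auto simp: scalar_prod_def atLeast0LessThan)
    moreover have "(B *\<^sub>v v) $ i = (\<Sum>j<q. B $$ (i, j) * v $ j)"
      using ij v(1) B by (simp add: scalar_prod_def atLeast0LessThan)
    ultimately have "(B *\<^sub>v v) $ i = 0" by (simp only:)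
    then show "(B * column_mat q (\<lambda>i. c * v $ i)) $$ (i, j) = 0\<^sub>m p 1 $$ (i, j)"
      unfolding ij(2) mult_column_index[OF B v(1) ij(1)] using ij(1) by simp
  qed (use B in auto)
  then show ?thesis by (rule that[OF column_carrier c])
qed

text \<open>
  Otherwise \<open>Q\<close> would map some unit vector to 0, while \<open>Q\<^sup>H Q\<close> is
  the identity.
\<close>

lemma orthonormal_columns_le:
  fixes Q :: "'a::rc_field mat"
  assumes Q: "Q \<in> carrier_mat m k" "Q\<^sup>H * Q = 1\<^sub>m k"
  shows "k \<le> m"
proof (rule ccontr)
  assume "\<not> k \<le> m"
  then obtain x where x: "x \<in> carrier_mat k 1" "x\<^sup>H * x = 1\<^sub>m 1" "Q * x = 0\<^sub>m m 1"
    using underdetermined_solution[OF Q(1)] by auto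
  have "x = Q\<^sup>H * Q * x" using Q x by simp
  also have "\<dots> = Q\<^sup>H * (Q * x)" using Q x by (intro assoc_mult_mat) auto
  also have "\<dots> = 0\<^sub>m k 1" using Q x by simp
  finally have "x = 0\<^sub>m k 1" .
  then have "x\<^sup>H * x = 0\<^sub>m 1 1" using x(1) by (metis adjoint_carrier right_mult_zero_mat)
  then show False using x(2) by (metis index_one_mat(1) index_zero_mat(1) less_one zero_neq_one)
qed

definition append_column :: "'a mat \<Rightarrow> 'a mat \<Rightarrow> 'a mat" where
  "append_column Q x =
     mat (dim_row Q) (Suc (dim_col Q)) (\<lambda>(i, j). if j < dim_col Q then Q $$ (i, j) else x $$ (i, 0))"

lemma append_column_carrier [simp]:
  "Q \<in> carrier_mat m k \<Longrightarrow> append_column Q x \<in> carrier_mat m (Suc k)"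
  by (auto simp: append_column_def)

lemma append_column_index:
  "Q \<in> carrier_mat m k \<Longrightarrow> i < m \<Longrightarrow> j < Suc k \<Longrightarrow>
     append_column Q x $$ (i, j) = (if j < k then Q $$ (i, j) else x $$ (i, 0))"
  by (auto simp: append_column_def)

lemma append_column_orthonormal:
  fixes Q :: "'a::rc_field mat"
  assumes Q: "Q \<in> carrier_mat m k" "Q\<^sup>H * Q = 1\<^sub>m k"
    and x: "x \<in> carrier_mat m 1" "x\<^sup>H * x = 1\<^sub>m 1" "Q\<^sup>H * x = 0\<^sub>m k 1"
  shows "(append_column Q x)\<^sup>H * append_column Q x = 1\<^sub>m (Suc k)"
proof (rule eq_matI)
  let ?W = "append_column Q x"
  have W: "?W \<in> carrier_mat m (Suc k)" using Q by simp
  fix i j assume "i < dim_row (1\<^sub>m (Suc k) :: 'a mat)" "j < dim_col (1\<^sub>m (Suc k) :: 'a mat)"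
  then have ij: "i < Suc k" "j < Suc k" by auto
  have 1: "(?W\<^sup>H * ?W) $$ (i, j) = (\<Sum>l<m. conjugate (?W $$ (l, i)) * ?W $$ (l, j))"
    using W ij by (subst mult_index_carrier[where k=m]) auto
  have QQ: "(\<Sum>l<m. conjugate (Q $$ (l, a)) * Q $$ (l, b)) = (if a = b then 1 else 0)" if "a < k" "b < k" for a b
  proof -
    have "(Q\<^sup>H * Q) $$ (a, b) = (\<Sum>l<m. conjugate (Q $$ (l, a)) * Q $$ (l, b))"
      using Q(1) that by (subst mult_index_carrier[where k=m]) auto
    then show ?thesis using Q(2) that by simp
  qed
  have Qx: "(\<Sum>l<m. conjugate (Q $$ (l, a)) * x $$ (l, 0)) = 0" if "a < k" for a
  proof -
    have "(Q\<^sup>H * x) $$ (a, 0) = (\<Sum>l<m. conjugate (Q $$ (l, a)) * x $$ (l, 0))"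
      using Q(1) x(1) that by (subst mult_index_carrier[where k=m]) auto
    then show ?thesis using x(3) that by simp
  qed
  have xQ: "(\<Sum>l<m. conjugate (x $$ (l, 0)) * Q $$ (l, a)) = 0" if "a < k" for a
  proof -
    have "conjugate (\<Sum>l<m. conjugate (Q $$ (l, a)) * x $$ (l, 0)) = 0" using Qx[OF that] by simp
    then show ?thesis by (simp add: sum_conjugate conjugate_dist_mul mult.commute)
  qed
  have xx: "(\<Sum>l<m. conjugate (x $$ (l, 0)) * x $$ (l, 0)) = 1"
  proof -
    have "(x\<^sup>H * x) $$ (0, 0) = (\<Sum>l<m. conjugate (x $$ (l, 0)) * x $$ (l, 0))"
      using x(1) by (subst mult_index_carrier[where k=m]) auto
    then show ?thesis using x(2) by simp
  qed
  show "(?W\<^sup>H * ?W) $$ (i, j) = 1\<^sub>m (Suc k) $$ (i, j)"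
    unfolding 1 using ij QQ Qx xQ xx by (auto simp: append_column_index[OF Q(1)] less_Suc_eq)
qed (use Q(1) in \<open>auto simp: append_column_def\<close>)

lemma unitary_mat_iff:
  fixes U :: "'a::conjugatable_field mat"
  shows "unitary_mat m U \<longleftrightarrow> U \<in> carrier_mat m m \<and> U\<^sup>H * U = 1\<^sub>m m"
  unfolding unitary_mat_def using mat_mult_left_right_inverse[of "U\<^sup>H" m U] by auto

lemma unitary_matD:
  "unitary_mat m U \<Longrightarrow> U \<in> carrier_mat m m" "unitary_mat m U \<Longrightarrow> U\<^sup>H * U = 1\<^sub>m m"
  "unitary_mat m U \<Longrightarrow> U * U\<^sup>H = 1\<^sub>m m"
  by (auto simp: unitary_mat_def)

definition select_columns :: "'a mat \<Rightarrow> nat \<Rightarrow> (nat \<Rightarrow> nat) \<Rightarrow> 'a mat" where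
  "select_columns Q k f = mat (dim_row Q) k (\<lambda>(i, j). Q $$ (i, f j))"

lemma select_columns_carrier [simp]:
  "Q \<in> carrier_mat m p \<Longrightarrow> select_columns Q k f \<in> carrier_mat m k"
  by (auto simp: select_columns_def)

lemma select_columns_index:
  "Q \<in> carrier_mat m p \<Longrightarrow> i < m \<Longrightarrow> j < k \<Longrightarrow> select_columns Q k f $$ (i, j) = Q $$ (i, f j)"
  by (auto simp: select_columns_def)

lemma mult_select_columns_index:
  assumes "A \<in> carrier_mat r m" "Q \<in> carrier_mat m p" "i < r" "j < k" "f j < p"
  shows "(A * select_columns Q k f) $$ (i, j) = (A * Q) $$ (i, f j)"
  using mult_index_carrier[OF assms(1) select_columns_carrier[OF assms(2)] assms(3,4)]
    mult_index_carrier[OF assms(1,2,3,5)] assms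
  by (simp add: select_columns_index del: index_mult_mat(1))

lemma adjoint_select_columns_mult_index:
  fixes Q :: "'a::conjugatable_field mat"
  assumes "Q \<in> carrier_mat m p" "C \<in> carrier_mat m r" "i < k" "f i < p" "j < r"
  shows "((select_columns Q k f)\<^sup>H * C) $$ (i, j) = (Q\<^sup>H * C) $$ (f i, j)"
  using adjoint_mult_index[OF select_columns_carrier[OF assms(1)] assms(2,3,5)]
    adjoint_mult_index[OF assms(1,2,4,5)] assms
  by (simp add: select_columns_index del: index_mult_mat(1))

lemma select_columns_orthonormal:
  fixes Q :: "'a::rc_field mat"
  assumes Q: "Q \<in> carrier_mat m p" "Q\<^sup>H * Q = 1\<^sub>m p"
    and f: "inj_on f {..<k}" "\<And>i. i < k \<Longrightarrow> f i < p"
  shows "(select_columns Q k f)\<^sup>H * select_columns Q k f = 1\<^sub>m k"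
proof (rule eq_matI)
  fix i j assume "i < dim_row (1\<^sub>m k :: 'a mat)" "j < dim_col (1\<^sub>m k :: 'a mat)"
  then have ij: "i < k" "j < k" by auto
  have "((select_columns Q k f)\<^sup>H * select_columns Q k f) $$ (i, j) = (Q\<^sup>H * Q) $$ (f i, f j)"
    using adjoint_select_columns_mult_index[of Q m p "select_columns Q k f" k i k f j]
      mult_select_columns_index[of "Q\<^sup>H" p m Q p "f i" j k f] Q(1) f ij by (simp del: index_mult_mat(1))
  then show "((select_columns Q k f)\<^sup>H * select_columns Q k f) $$ (i, j) = 1\<^sub>m k $$ (i, j)"
    unfolding Q(2) using ij f by (auto simp: inj_on_eq_iff)
qed (use Q in \<open>auto simp: select_columns_def\<close>)

text \<open>
  As long as there are fewer than \<open>m\<close> columns, some unit vector is orthogonal to all of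
  them and can be appended.
\<close>

lemma orthonormal_columns_extend:
  fixes Q :: "'a::rc_field mat"
  assumes "Q \<in> carrier_mat m k" "Q\<^sup>H * Q = 1\<^sub>m k"
  obtains U where "unitary_mat m U" "\<And>i j. i < m \<Longrightarrow> j < k \<Longrightarrow> U $$ (i, j) = Q $$ (i, j)"
  using assms
proof (induction "m - k" arbitrary: k Q thesis)
  case 0
  then have "k = m" using orthonormal_columns_le[of Q m k] by simp
  then show ?case using 0 by (metis unitary_mat_iff)
next
  case (Suc d)
  then have "k < m" by simp
  then obtain x where x: "x \<in> carrier_mat m 1" "x\<^sup>H * x = 1\<^sub>m 1" "Q\<^sup>H * x = 0\<^sub>m k 1"
    using underdetermined_solution[of "Q\<^sup>H" k m] Suc.prems by auto
  have d: "d = m - Suc k" using Suc.hyps(2) by simp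
  show ?case
  proof (rule Suc.hyps(1)[OF d _ append_column_carrier[OF Suc.prems(2)]
        append_column_orthonormal[OF Suc.prems(2,3) x]])
    fix U assume U: "unitary_mat m U"
      "\<And>i j. i < m \<Longrightarrow> j < Suc k \<Longrightarrow> U $$ (i, j) = append_column Q x $$ (i, j)"
    then show thesis
      by (intro Suc.prems(1)[of U]) (auto simp: append_column_index[OF Suc.prems(2)])
  qed
qed

section \<open>The spectral theorem\<close>

text \<open>
  Over the complex numbers the characteristic polynomial has a root \<open>z\<close>, and
  \<open>z\<close> is real because the quadratic form \<open>y\<^sup>H C y\<close> of a Hermitian
  matrix is. A real root of the image of the characteristic polynomial is a root of the polynomial
  itself, so the eigenvector exists over the given scalars.
\<close>

lemma hermitian_eigenvector:
  fixes A :: "'a::rc_field mat"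
  assumes A: "A \<in> carrier_mat n n" "A\<^sup>H = A" and n: "0 < n"
  obtains e :: real and x where "x \<in> carrier_mat n 1" "x\<^sup>H * x = 1\<^sub>m 1" "A * x = of_real e \<cdot>\<^sub>m x"
proof -
  obtain h :: "'a \<Rightarrow> complex" where h: "field_hom h" "\<And>r. h (of_real r) = of_real r"
    "\<And>x. h (conjugate x) = cnj (h x)" "\<And>x. norm (h x) = norm x"
    using complex_embeddingE by blast
  interpret h: field_hom h by (rule h(1))
  let ?C = "map_mat h A"
  have C: "?C \<in> carrier_mat n n" using A by simp
  \<comment> \<open>The image of the matrix under the embedding is Hermitian again.\<close>
  have CH: "?C\<^sup>H = ?C"
  proof (rule eq_matI)
    fix i j assume "i < dim_row ?C" "j < dim_col ?C"
    then have ij: "i < n" "j < n" using A by auto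
    have "A\<^sup>H $$ (i, j) = A $$ (i, j)" using A by simp
    then have "conjugate (A $$ (j, i)) = A $$ (i, j)" using A(1) ij by auto
    then show "?C\<^sup>H $$ (i, j) = ?C $$ (i, j)" using A(1) ij h(3)[of "A $$ (j, i)"] by auto
  qed (use A in auto)
  have "degree (char_poly ?C) = n" using degree_monic_char_poly[OF C] by simp
  then have "\<not> constant (poly (char_poly ?C))" using n by (simp add: constant_degree)
  then obtain z where z: "poly (char_poly ?C) z = 0" using fundamental_theorem_of_algebra by blast
  then have "eigenvalue ?C z" using eigenvalue_root_char_poly[OF C] by simp
  then obtain v where v: "v \<in> carrier_vec n" "v \<noteq> 0\<^sub>v n" "?C *\<^sub>v v = z \<cdot>\<^sub>v v"
    using C unfolding eigenvalue_def eigenvector_def by auto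
  define y where "y = mat n 1 (\<lambda>(i, j). v $ i)"
  have y: "y \<in> carrier_mat n 1" by (simp add: y_def)
  have Cy: "?C * y = z \<cdot>\<^sub>m y"
  proof (rule eq_matI)
    fix i j assume "i < dim_row (z \<cdot>\<^sub>m y)" "j < dim_col (z \<cdot>\<^sub>m y)"
    then have ij: "i < n" "j = 0" using y by auto
    have "(?C *\<^sub>v v) $ i = (z \<cdot>\<^sub>v v) $ i" using v by simp
    then have "(\<Sum>j<n. ?C $$ (i, j) * v $ j) = z * v $ i"
      using ij v(1) A(1) by (simp add: scalar_prod_def atLeast0LessThan)
    then show "(?C * y) $$ (i, j) = (z \<cdot>\<^sub>m y) $$ (i, j)"
      using mult_index_carrier[OF C y, of i 0] ij y by (simp add: y_def)
  qed (use A y in auto)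
  have s: "(y\<^sup>H * y) $$ (0, 0) = of_real ((frobenius_norm y)\<^sup>2)"
    using frobenius_gram[OF y] by simp
  have "(frobenius_norm y)\<^sup>2 \<noteq> 0"
    using v(1,2) unfolding frobenius_norm_sq_carrier[OF y] by (auto simp: sum_nonneg_eq_0_iff y_def)
  \<comment> \<open>The number \<open>z |y|\<^sup>2\<close> equals its own conjugate.\<close>
  have e1: "y\<^sup>H * (?C * y) = z \<cdot>\<^sub>m (y\<^sup>H * y)"
    unfolding Cy using y by (intro mult_smult_distrib) auto
  have "(y\<^sup>H * (?C * y))\<^sup>H = (?C * y)\<^sup>H * y"
    using adjoint_mult[of "y\<^sup>H" 1 n "?C * y" 1] C y by auto
  also have "\<dots> = y\<^sup>H * ?C * y" using adjoint_mult[OF C y] CH by simp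
  also have "\<dots> = y\<^sup>H * (?C * y)" using y C by (intro assoc_mult_mat) auto
  finally have "(z \<cdot>\<^sub>m (y\<^sup>H * y))\<^sup>H $$ (0, 0) = (z \<cdot>\<^sub>m (y\<^sup>H * y)) $$ (0, 0)" using e1 by simp
  then have "cnj (z * (y\<^sup>H * y) $$ (0, 0)) = z * (y\<^sup>H * y) $$ (0, 0)" using y by auto
  then have "cnj z = z" unfolding s using \<open>(frobenius_norm y)\<^sup>2 \<noteq> 0\<close> by simp
  then obtain e where e: "z = of_real e" by (metis Reals_cases complex_cnj_cancel_iff Reals_cnj_iff)
  have "map_poly h (char_poly A) = char_poly ?C" using h.char_poly_hom[OF A(1)] by simp
  then have "h (poly (char_poly A) (of_real e)) = 0" using z e h(2) by (metis h.poly_map_poly)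
  then have "poly (char_poly A) (of_real e) = 0" by simp
  then have "eigenvalue A (of_real e)" using eigenvalue_root_char_poly[OF A(1)] by blast
  then obtain w where w: "w \<in> carrier_vec n" "w \<noteq> 0\<^sub>v n" "A *\<^sub>v w = of_real e \<cdot>\<^sub>v w"
    using A unfolding eigenvalue_def eigenvector_def by auto
  obtain c where c: "(column_mat n (\<lambda>i. c * w $ i))\<^sup>H * column_mat n (\<lambda>i. c * w $ i) = 1\<^sub>m 1"
    using unit_multiple[OF w(1,2)] by blast
  have "A * column_mat n (\<lambda>i. c * w $ i) = of_real e \<cdot>\<^sub>m column_mat n (\<lambda>i. c * w $ i)"
  proof (rule eq_matI)
    fix i j assume "i < dim_row (of_real e \<cdot>\<^sub>m column_mat n (\<lambda>i. c * w $ i))"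
      "j < dim_col (of_real e \<cdot>\<^sub>m column_mat n (\<lambda>i. c * w $ i))"
    then have ij: "i < n" "j = 0" by auto
    show "(A * column_mat n (\<lambda>i. c * w $ i)) $$ (i, j) = (of_real e \<cdot>\<^sub>m column_mat n (\<lambda>i. c * w $ i)) $$ (i, j)"
      unfolding ij(2) mult_column_index[OF A(1) w(1) ij(1)] w(3) using ij(1) w(1) by simp
  qed (use A in auto)
  then show ?thesis by (rule that[OF column_carrier c])
qed

text \<open>
  Eigenvectors are found one at a time. Let \<open>B\<close> complete the eigenvectors
  \<open>Q\<close> found so far to a unitary matrix. An eigenvector \<open>x\<close> of the
  compression \<open>B\<^sup>H H B\<close> lifts to \<open>B x\<close>: the vector \<open>H B
  x\<close> has no component along \<open>Q\<close>, because \<open>H\<close> maps each column of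
  \<open>Q\<close> to a multiple of itself and is Hermitian.
\<close>

lemma orthonormal_eigenvectors:
  fixes H :: "'a::rc_field mat"
  assumes H: "H \<in> carrier_mat m m" "H\<^sup>H = H" and "k \<le> m"
  shows "\<exists>Q (e :: nat \<Rightarrow> real). Q \<in> carrier_mat m k \<and> Q\<^sup>H * Q = 1\<^sub>m k \<and>
           (\<forall>i<m. \<forall>j<k. (H * Q) $$ (i, j) = of_real (e j) * Q $$ (i, j))"
  using \<open>k \<le> m\<close>
proof (induction k)
  case 0
  have "(0\<^sub>m m 0 :: 'a mat)\<^sup>H * 0\<^sub>m m 0 = 1\<^sub>m 0" by (rule eq_matI) auto
  then show ?case by (intro exI[of _ "0\<^sub>m m 0"]) auto
next
  case (Suc k)
  then obtain Q and e :: "nat \<Rightarrow> real" where Q: "Q \<in> carrier_mat m k" "Q\<^sup>H * Q = 1\<^sub>m k"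
    and e: "\<And>i j. i < m \<Longrightarrow> j < k \<Longrightarrow> (H * Q) $$ (i, j) = of_real (e j) * Q $$ (i, j)"
    by auto
  obtain W where W: "unitary_mat m W" and WQ: "\<And>i j. i < m \<Longrightarrow> j < k \<Longrightarrow> W $$ (i, j) = Q $$ (i, j)"
    using orthonormal_columns_extend[OF Q] by blast
  note Wc = unitary_matD[OF W]
  define B where "B = select_columns W (m - k) (\<lambda>j. k + j)"
  have B: "B \<in> carrier_mat m (m - k)" using Wc by (simp add: B_def)
  have BB: "B\<^sup>H * B = 1\<^sub>m (m - k)"
    unfolding B_def using Wc by (intro select_columns_orthonormal) auto
  have Wadj: "(W\<^sup>H * t) $$ (i, 0) = (if i < k then (Q\<^sup>H * t) $$ (i, 0) else (B\<^sup>H * t) $$ (i - k, 0))"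
    if t: "t \<in> carrier_mat m 1" and i: "i < m" for t i
  proof (cases "i < k")
    case True
    then show ?thesis using adjoint_mult_index[OF Wc(1) t i, of 0] adjoint_mult_index[OF Q(1) t True, of 0]
      by (simp add: WQ del: index_mult_mat(1))
  next
    case False
    then show ?thesis
      using adjoint_select_columns_mult_index[OF Wc(1) t, of "i - k" "m - k" "\<lambda>j. k + j" 0] i
      by (simp add: B_def del: index_mult_mat(1))
  qed
  have QB: "Q\<^sup>H * B = 0\<^sub>m k (m - k)"
  proof (rule eq_matI)
    fix a b assume "a < dim_row (0\<^sub>m k (m - k) :: 'a mat)" "b < dim_col (0\<^sub>m k (m - k) :: 'a mat)"
    then have ab: "a < k" "b < m - k" by auto
    have "(Q\<^sup>H * B) $$ (a, b) = (Q\<^sup>H * W) $$ (a, k + b)"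
      unfolding B_def using Q Wc ab by (intro mult_select_columns_index) auto
    also have "\<dots> = (W\<^sup>H * W) $$ (a, k + b)"
      using adjoint_mult_index[OF Wc(1,1), of a "k + b"] adjoint_mult_index[OF Q(1) Wc(1), of a "k + b"] ab
      by (simp add: WQ del: index_mult_mat(1))
    finally show "(Q\<^sup>H * B) $$ (a, b) = 0\<^sub>m k (m - k) $$ (a, b)" using Wc ab by simp
  qed (use B Q in auto)
  define N where "N = B\<^sup>H * (H * B)"
  have N: "N \<in> carrier_mat (m - k) (m - k)" unfolding N_def using B H by auto
  have HB: "(H * B)\<^sup>H = B\<^sup>H * H" using adjoint_mult[OF H(1) B] H by simp
  have NH: "N\<^sup>H = N"
    unfolding N_def using adjoint_mult[of "B\<^sup>H" "m - k" m "H * B" "m - k"] HB B H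
    by (auto intro!: assoc_mult_mat)
  have pos: "0 < m - k" using Suc.prems by simp
  obtain f :: real and x where x: "x \<in> carrier_mat (m - k) 1" "x\<^sup>H * x = 1\<^sub>m 1"
    and Nx: "N * x = of_real f \<cdot>\<^sub>m x"
    using hermitian_eigenvector[OF N NH pos] by blast
  define u where "u = B * x"
  have u: "u \<in> carrier_mat m 1" unfolding u_def using B x by auto
  have Bu: "B\<^sup>H * u = x" unfolding u_def using isometry_left_cancel[OF B BB x(1)] .
  have uu: "u\<^sup>H * u = 1\<^sub>m 1"
    unfolding u_def isometry_gram[OF B BB x(1)] by (rule x(2))
  have Qu: "Q\<^sup>H * u = 0\<^sub>m k 1"
  proof -
    have "Q\<^sup>H * u = Q\<^sup>H * B * x" unfolding u_def using Q B x by (intro assoc_mult_mat[symmetric]) auto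
    then show ?thesis using QB x by simp
  qed
  have BHu: "B\<^sup>H * (H * u) = of_real f \<cdot>\<^sub>m x"
  proof -
    have "H * u = H * B * x" unfolding u_def using H B x by (intro assoc_mult_mat[symmetric]) auto
    then have "B\<^sup>H * (H * u) = B\<^sup>H * (H * B) * x"
      using H B x by (simp add: assoc_mult_mat[of "B\<^sup>H" "m - k" m "H * B" "m - k" x 1])
    then show ?thesis using Nx by (simp add: N_def)
  qed
  have QHu: "Q\<^sup>H * (H * u) = 0\<^sub>m k 1"
  proof (rule eq_matI)
    fix i j assume "i < dim_row (0\<^sub>m k 1 :: 'a mat)" "j < dim_col (0\<^sub>m k 1 :: 'a mat)"
    then have ij: "i < k" "j = 0" by auto
    have "Q\<^sup>H * (H * u) = (H * Q)\<^sup>H * u"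
      using adjoint_mult[OF H(1) Q(1)] H Q u by (simp add: assoc_mult_mat[of "Q\<^sup>H" k m H m u 1])
    also have "\<dots> $$ (i, 0) = (\<Sum>l<m. conjugate ((H * Q) $$ (l, i)) * u $$ (l, 0))"
      using ij by (intro adjoint_mult_index[OF mult_carrier_mat[OF H(1) Q(1)] u]) auto
    also have "\<dots> = of_real (e i) * (Q\<^sup>H * u) $$ (i, 0)"
      using e[OF _ ij(1)] ij
      by (simp add: adjoint_mult_index[OF Q(1) u] sum_distrib_left conjugate_dist_mul mult.assoc del: index_mult_mat(1))
    finally show "(Q\<^sup>H * (H * u)) $$ (i, j) = 0\<^sub>m k 1 $$ (i, j)" using Qu ij by simp
  qed (use H Q u in auto)
  have Hu: "H * u = of_real f \<cdot>\<^sub>m u"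
  proof -
    have split: "W\<^sup>H * y = W\<^sup>H * z" if "y \<in> carrier_mat m 1" "z \<in> carrier_mat m 1"
      "Q\<^sup>H * y = Q\<^sup>H * z" "B\<^sup>H * y = B\<^sup>H * z" for y z
    proof (rule eq_matI)
      fix i j assume "i < dim_row (W\<^sup>H * z)" "j < dim_col (W\<^sup>H * z)"
      then have ij: "i < m" "j = 0" using Wc that by auto
      show "(W\<^sup>H * y) $$ (i, j) = (W\<^sup>H * z) $$ (i, j)"
        unfolding ij(2) Wadj[OF that(1) ij(1)] Wadj[OF that(2) ij(1)] that(3,4) ..
    qed (use that in auto)
    have fu: "of_real f \<cdot>\<^sub>m u \<in> carrier_mat m 1" using u by simp
    have "W\<^sup>H * (H * u) = W\<^sup>H * (of_real f \<cdot>\<^sub>m u)"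
    proof (rule split)
      show "Q\<^sup>H * (H * u) = Q\<^sup>H * (of_real f \<cdot>\<^sub>m u)"
        using QHu Qu Q u mult_smult_distrib[of "Q\<^sup>H" k m u 1 "of_real f"] by auto
      show "B\<^sup>H * (H * u) = B\<^sup>H * (of_real f \<cdot>\<^sub>m u)"
        using BHu Bu B u mult_smult_distrib[of "B\<^sup>H" "m - k" m u 1 "of_real f"] by auto
    qed (use H u in auto)
    then have "W * (W\<^sup>H * (H * u)) = W * (W\<^sup>H * (of_real f \<cdot>\<^sub>m u))" by simp
    then show ?thesis
      using isometry_left_cancel[of "W\<^sup>H" m m "H * u" 1] isometry_left_cancel[of "W\<^sup>H" m m "of_real f \<cdot>\<^sub>m u" 1]
        Wc H u by simp
  qed
  show ?case
  proof (intro exI conjI allI impI)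
    show "append_column Q u \<in> carrier_mat m (Suc k)" using Q by simp
    show "(append_column Q u)\<^sup>H * append_column Q u = 1\<^sub>m (Suc k)"
      by (rule append_column_orthonormal[OF Q u uu Qu])
    fix i j assume ij: "i < m" "j < Suc k"
    have "(H * append_column Q u) $$ (i, j) = (if j < k then (H * Q) $$ (i, j) else (H * u) $$ (i, 0))"
      using ij mult_index_carrier[OF H(1) append_column_carrier[OF Q(1)], of i j]
        mult_index_carrier[OF H(1) Q(1), of i j] mult_index_carrier[OF H(1) u, of i 0]
      by (auto simp: append_column_index[OF Q(1)] simp del: index_mult_mat(1))
    also have "\<dots> = of_real ((e(k := f)) j) * append_column Q u $$ (i, j)"
      using ij e[OF ij(1)] u by (auto simp: append_column_index[OF Q(1)] Hu simp del: index_mult_mat(1))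
    finally show "(H * append_column Q u) $$ (i, j) = of_real ((e(k := f)) j) * append_column Q u $$ (i, j)" .
  qed
qed

lemma decreasing_rearrangement:
  fixes e :: "nat \<Rightarrow> real"
  obtains p where "p permutes {..<m}" "\<And>i j. i \<le> j \<Longrightarrow> j < m \<Longrightarrow> e (p j) \<le> e (p i)"
proof -
  let ?xs = "map e [0..<m]"
  have "mset (rev (sort ?xs)) = mset ?xs" by simp
  then obtain p where p: "p permutes {..<m}" "permute_list p ?xs = rev (sort ?xs)"
    by (metis mset_eq_permutation length_map diff_zero length_upt)
  have ep: "rev (sort ?xs) ! i = e (p i)" if "i < m" for i
  proof -
    have "p i < m" using permutes_in_image[OF p(1), of i] that by simp
    then show ?thesis using permute_list_nth[of p ?xs i] p that by simp
  qed
  have "e (p j) \<le> e (p i)" if "i \<le> j" "j < m" for i j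
  proof -
    have "sort ?xs ! (m - Suc j) \<le> sort ?xs ! (m - Suc i)"
      using that by (intro sorted_nth_mono) auto
    then show ?thesis using that ep[of i] ep[of j] by (simp add: rev_nth)
  qed
  then show ?thesis using that p(1) by blast
qed

text \<open>
  The order of the eigenvalues is the one that a singular value decomposition asks for.
\<close>

lemma hermitian_diagonalization:
  fixes H :: "'a::rc_field mat"
  assumes "H \<in> carrier_mat m m" "H\<^sup>H = H"
  obtains U and e :: "nat \<Rightarrow> real" where "unitary_mat m U"
    "\<And>i j. i < m \<Longrightarrow> j < m \<Longrightarrow> (H * U) $$ (i, j) = of_real (e j) * U $$ (i, j)"
    "\<And>i j. i \<le> j \<Longrightarrow> j < m \<Longrightarrow> e j \<le> e i"
proof -
  obtain Q and e :: "nat \<Rightarrow> real" where Q: "Q \<in> carrier_mat m m" "Q\<^sup>H * Q = 1\<^sub>m m"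
    and e: "\<And>i j. i < m \<Longrightarrow> j < m \<Longrightarrow> (H * Q) $$ (i, j) = of_real (e j) * Q $$ (i, j)"
    using orthonormal_eigenvectors[OF assms order_refl] by blast
  obtain p where p: "p permutes {..<m}" "\<And>i j. i \<le> j \<Longrightarrow> j < m \<Longrightarrow> e (p j) \<le> e (p i)"
    using decreasing_rearrangement by blast
  have pm: "p i < m" if "i < m" for i using permutes_in_image[OF p(1), of i] that by simp
  define U where "U = select_columns Q m p"
  have U: "U \<in> carrier_mat m m" using Q by (simp add: U_def)
  have "U\<^sup>H * U = 1\<^sub>m m"
    unfolding U_def using Q pm permutes_inj_on[OF p(1)] by (intro select_columns_orthonormal) auto
  then have "unitary_mat m U" using U by (simp add: unitary_mat_iff)
  moreover have "(H * U) $$ (i, j) = of_real (e (p j)) * U $$ (i, j)" if "i < m" "j < m" for i j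
    using mult_select_columns_index[of H m m Q m i j m p] assms(1) pm e[OF that(1) pm[OF that(2)]] that Q
    by (simp add: U_def select_columns_index del: index_mult_mat(1))
  ultimately show ?thesis using that[of U "e \<circ> p"] p(2) by simp
qed

section \<open>Singular value decompositions\<close>

abbreviation sv_mat :: "nat \<Rightarrow> nat \<Rightarrow> (nat \<Rightarrow> real) \<Rightarrow> 'a::rc_field mat" where
  "sv_mat m n \<sigma> \<equiv> mat m n (\<lambda>(i, j). if i = j then of_real (\<sigma> i) else 0)"

lemma mult_sv_mat_index:
  assumes "B \<in> carrier_mat p m" "i < p" "j < n"
  shows "(B * sv_mat m n \<sigma>) $$ (i, j) = (if j < m then B $$ (i, j) * of_real (\<sigma> j) else 0)"
proof -
  show ?thesis
    using assms by (subst mult_index_carrier[where k=m]) (auto simp: mult_delta_right)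
qed

lemma sv_mat_mult_index:
  assumes "B \<in> carrier_mat n p" "i < m" "j < p"
  shows "(sv_mat m n \<sigma> * B) $$ (i, j) = (if i < n then of_real (\<sigma> i) * B $$ (i, j) else 0)"
proof -
  show ?thesis
    using assms by (subst mult_index_carrier[where k=n]) (auto simp: mult_delta_left)
qed

text \<open>
  The form in which decompositions are constructed: one computes the entries of \<open>U\<^sup>H A
  V\<close>.
\<close>

lemma unitary_sandwich:
  fixes A :: "'a::rc_field mat"
  assumes "unitary_mat m U" "unitary_mat n V" "A \<in> carrier_mat m n" "S \<in> carrier_mat m n"
  shows "A = U * S * V\<^sup>H \<longleftrightarrow> U\<^sup>H * A * V = S"
proof -
  note U = unitary_matD[OF assms(1)] and V = unitary_matD[OF assms(2)]
  show ?thesis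
  proof
    assume "A = U * S * V\<^sup>H"
    then have "U\<^sup>H * A = U\<^sup>H * (U * (S * V\<^sup>H))" using U V assms by (simp add: assoc_mult_mat[of U m m S n "V\<^sup>H" n])
    also have "\<dots> = S * V\<^sup>H" using U V assms by (intro isometry_left_cancel) auto
    finally have "U\<^sup>H * A * V = S * (V\<^sup>H * V)" using V assms by (simp add: assoc_mult_mat[of S m n "V\<^sup>H" n V n])
    then show "U\<^sup>H * A * V = S" using V assms by simp
  next
    assume S: "U\<^sup>H * A * V = S"
    have "U * (U\<^sup>H * A * V) = U * (U\<^sup>H * (A * V))"
      using U V assms by (simp add: assoc_mult_mat[of "U\<^sup>H" m m A n V n])
    also have "\<dots> = A * V"
      using isometry_left_cancel[of "U\<^sup>H" m m "A * V" n] U V assms by auto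
    finally have "U * S * V\<^sup>H = A * (V * V\<^sup>H)"
      using S V assms by (simp add: assoc_mult_mat[of A m n V n "V\<^sup>H" n])
    then show "A = U * S * V\<^sup>H" using V assms by simp
  qed
qed

lemma rank_orthonormal_columns:
  fixes Q :: "'a::rc_field mat"
  assumes Q: "Q \<in> carrier_mat m k" "Q\<^sup>H * Q = 1\<^sub>m k"
  shows "vec_space.rank m Q = k"
proof -
  interpret vec_space "TYPE('a)" m .
  have gram: "(Q\<^sup>H * Q) $$ (i, j) = (\<Sum>l<m. conjugate (Q $$ (l, i)) * Q $$ (l, j))" if "i < k" "j < k" for i j
    using Q(1) that by (subst mult_index_carrier[where k=m]) auto
  have dist: "distinct (cols Q)"
  proof (rule ccontr)
    assume "\<not> distinct (cols Q)"
    then obtain i j where ij: "i < k" "j < k" "i \<noteq> j" "col Q i = col Q j"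
      using Q(1) by (auto simp: distinct_conv_nth)
    have "Q $$ (l, i) = Q $$ (l, j)" if "l < m" for l
    proof -
      have "col Q i $ l = col Q j $ l" using ij by simp
      then show ?thesis using Q(1) ij(1,2) that index_col[of l Q i] index_col[of l Q j] by auto
    qed
    then have "(Q\<^sup>H * Q) $$ (i, i) = (Q\<^sup>H * Q) $$ (i, j)" using gram ij by simp
    then show False using Q(2) ij by simp
  qed
  have "lin_indpt (set (cols Q))"
  proof
    assume "lin_dep (set (cols Q))"
    from lin_depE[OF Q(1) this dist]
    obtain v where v: "v \<in> carrier_vec k" "v \<noteq> 0\<^sub>v k" "Q *\<^sub>v v = 0\<^sub>v m" by blast
    have "v = Q\<^sup>H * Q *\<^sub>v v" using Q(2) v by simp
    also have "\<dots> = Q\<^sup>H *\<^sub>v (Q *\<^sub>v v)" using Q(1) v by (intro assoc_mult_mat_vec) auto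
    also have "\<dots> = 0\<^sub>v k" unfolding v(3) using Q(1) by (intro eq_vecI) auto
    finally show False using v(2) by simp
  qed
  then show ?thesis by (rule lin_indpt_full_rank[OF Q(1) dist])
qed

lemma rank_le_dim_row:
  fixes A :: "'a::field mat"
  assumes "A \<in> carrier_mat m n"
  shows "vec_space.rank m A \<le> m"
proof -
  interpret vec_space "TYPE('a)" m .
  obtain S where S: "maximal S (\<lambda>T. T \<subseteq> set (cols A) \<and> lin_indpt T)"
    using maximal_exists_superset[of "set (cols A)" "\<lambda>T. T \<subseteq> set (cols A) \<and> lin_indpt T" "{}"]
    by (metis List.finite_set empty_subsetI finite.emptyI finite_lin_indpt2 empty_iff lin_dep_def)
  have "S \<subseteq> carrier_vec m" "lin_indpt S" using S cols_dim[of A] assms unfolding maximal_def by auto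
  then show ?thesis
    using rank_card_indpt[OF assms S] li_le_dim(2)[OF fin_dim] dim_is_n by simp
qed

lemma rank_eq_if_same_col_space:
  fixes A :: "'a::field mat"
  assumes "A \<in> carrier_mat m n" "B \<in> carrier_mat m k" "C \<in> carrier_mat k n" "D \<in> carrier_mat n k"
    "A = B * C" "B = A * D"
  shows "vec_space.rank m A = vec_space.rank m B"
proof -
  interpret vec_space "TYPE('a)" m .
  have sub: "col_space X \<subseteq> col_space Y"
    if X: "X \<in> carrier_mat m p" and Y: "Y \<in> carrier_mat m q" and Z: "Z \<in> carrier_mat q p" and eq: "X = Y * Z" for X Y Z p q
  proof
    fix y assume "y \<in> col_space X"
    then obtain x where x: "x \<in> carrier_vec p" "y = X *\<^sub>v x" using col_space_eq[OF X] X by auto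
    then have "y = Y *\<^sub>v (Z *\<^sub>v x)" unfolding eq using Y Z by (simp add: assoc_mult_mat_vec)
    then show "y \<in> col_space Y" using col_space_eq[OF Y] X Y Z x by auto
  qed
  have "col_space A = col_space B" using sub[OF assms(1,2,3,5)] sub[OF assms(2,1,4,6)] by blast
  then show ?thesis unfolding rank_def col_space_def by simp
qed

lemma svd_mult_right:
  assumes "unitary_mat m U" "unitary_mat n V" "A = U * sv_mat m n \<sigma> * V\<^sup>H"
  shows "A * V = U * sv_mat m n \<sigma>" and "U\<^sup>H * A = sv_mat m n \<sigma> * V\<^sup>H"
proof -
  note U = unitary_matD[OF assms(1)] and V = unitary_matD[OF assms(2)]
  have "A * V = U * sv_mat m n \<sigma> * (V\<^sup>H * V)"
    unfolding assms(3) using U V by (intro assoc_mult_mat) auto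
  then show "A * V = U * sv_mat m n \<sigma>" using U V by simp
  have "A = U * (sv_mat m n \<sigma> * V\<^sup>H)"
    unfolding assms(3) using U V by (intro assoc_mult_mat) auto
  then show "U\<^sup>H * A = sv_mat m n \<sigma> * V\<^sup>H"
    using isometry_left_cancel[OF U(1,2) mult_carrier_mat[OF mat_carrier adjoint_carrier[OF V(1)]]]
    by simp
qed

text \<open>
  The first \<open>r\<close> columns \<open>Q\<close> of \<open>U\<close> and the matrix
  \<open>A\<close> are multiples of each other from the right, so they have the same column space;
  and the rank of orthonormal columns is their number.
\<close>

lemma rank_svd:
  fixes U V :: "'a::rc_field mat"
  assumes U: "unitary_mat m U" and V: "unitary_mat n V" and A: "A = U * sv_mat m n \<sigma> * V\<^sup>H"
    and r: "r \<le> m" "r \<le> n" "\<And>i. i < r \<Longrightarrow> 0 < \<sigma> i" "\<And>i. r \<le> i \<Longrightarrow> \<sigma> i = 0"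
  shows "vec_space.rank m A = r"
proof -
  note Uc = unitary_matD[OF U] and Vc = unitary_matD[OF V]
  have Ac: "A \<in> carrier_mat m n"
    unfolding A by (intro mult_carrier_mat[OF mult_carrier_mat[OF Uc(1) mat_carrier]] adjoint_carrier Vc)
  define Q where "Q = select_columns U r (\<lambda>j. j)"
  have Q: "Q \<in> carrier_mat m r" using Uc by (simp add: Q_def)
  have QQ: "Q\<^sup>H * Q = 1\<^sub>m r"
    unfolding Q_def using Uc r by (intro select_columns_orthonormal[where p=m and m=m]) auto
  have Q_index: "Q $$ (i, j) = U $$ (i, j)" if "i < m" "j < r" for i j
    using that Uc by (simp add: Q_def select_columns_index)
  define C where "C = mat r n (\<lambda>(i, j). of_real (\<sigma> i) * V\<^sup>H $$ (i, j))"
  define D where "D = mat n r (\<lambda>(i, j). V $$ (i, j) / of_real (\<sigma> j))"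
  have "vec_space.rank m A = vec_space.rank m Q"
  proof (rule rank_eq_if_same_col_space[OF Ac Q])
    show C: "C \<in> carrier_mat r n" and D: "D \<in> carrier_mat n r" by (simp_all add: C_def D_def)
    show "A = Q * C"
    proof (rule eq_matI)
      fix i j assume "i < dim_row (Q * C)" "j < dim_col (Q * C)"
      then have ij: "i < m" "j < n" using Q C by auto
      have "A = U * (sv_mat m n \<sigma> * V\<^sup>H)"
        unfolding A using Uc Vc by (intro assoc_mult_mat) auto
      then have "A $$ (i, j) = (\<Sum>l<m. U $$ (i, l) * (sv_mat m n \<sigma> * V\<^sup>H) $$ (l, j))"
        using Uc Vc ij by (simp only:) (subst mult_index_carrier[where k=m], auto)
      also have "\<dots> = (\<Sum>l<m. if l < r then U $$ (i, l) * (of_real (\<sigma> l) * V\<^sup>H $$ (l, j)) else 0)"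
        using Vc ij r by (intro sum.cong refl) (subst sv_mat_mult_index[where p=n], auto simp: not_less)
      also have "\<dots> = (\<Sum>l<r. U $$ (i, l) * (of_real (\<sigma> l) * V\<^sup>H $$ (l, j)))"
        using r by (intro sum.mono_neutral_cong_right) auto
      also have "\<dots> = (Q * C) $$ (i, j)"
        using Q C ij by (subst mult_index_carrier[where k=r]) (auto simp: Q_index C_def)
      finally show "A $$ (i, j) = (Q * C) $$ (i, j)" .
    qed (use Ac Q C in auto)
    show "Q = A * D"
    proof (rule eq_matI)
      fix i j assume "i < dim_row (A * D)" "j < dim_col (A * D)"
      then have ij: "i < m" "j < r" using Ac D by auto
      have "(A * D) $$ (i, j) = (\<Sum>l<n. A $$ (i, l) * V $$ (l, j)) / of_real (\<sigma> j)"
        using Ac D ij by (subst mult_index_carrier[where k=n]) (auto simp: D_def sum_divide_distrib)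
      also have "(\<Sum>l<n. A $$ (i, l) * V $$ (l, j)) = (A * V) $$ (i, j)"
        using Ac Vc ij r by (subst mult_index_carrier[where k=n and n=n]) auto
      also have "\<dots> = U $$ (i, j) * of_real (\<sigma> j)"
        unfolding svd_mult_right[OF U V A] using Uc ij r by (subst mult_sv_mat_index[where p=m]) auto
      also have "U $$ (i, j) * of_real (\<sigma> j) / of_real (\<sigma> j) = Q $$ (i, j)"
        using r(3)[OF ij(2)] ij by (simp add: Q_index)
      finally show "Q $$ (i, j) = (A * D) $$ (i, j)" by simp
    qed (use Ac Q D in auto)
  qed
  then show ?thesis using rank_orthonormal_columns[OF Q QQ] by simp
qed

lemma decreasing_support:
  fixes \<sigma> :: "nat \<Rightarrow> real"
  assumes "antimono \<sigma>" "\<And>i. 0 \<le> \<sigma> i" "\<And>i. k \<le> i \<Longrightarrow> \<sigma> i = 0"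
  obtains r where "r \<le> k" "\<And>i. i < r \<Longrightarrow> 0 < \<sigma> i" "\<And>i. r \<le> i \<Longrightarrow> \<sigma> i = 0"
proof -
  define r where "r = (LEAST i. \<sigma> i = 0)"
  have r: "\<sigma> r = 0" unfolding r_def by (rule LeastI[of _ k]) (simp add: assms)
  show ?thesis
  proof
    show "r \<le> k" unfolding r_def by (rule Least_le) (simp add: assms)
    show "0 < \<sigma> i" if "i < r" for i
      using not_less_Least[of i "\<lambda>i. \<sigma> i = 0"] that assms(2)[of i] by (simp add: r_def[symmetric])
    show "\<sigma> i = 0" if "r \<le> i" for i
      using antimonoD[OF assms(1) that] assms(2)[of i] r by simp
  qed
qed

text \<open>
  Monotonicity, nonnegativity and vanishing beyond the smaller dimension force the number of
  positive entries of \<open>\<sigma>\<close> in such a factorisation to be the rank. This form has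
  no rank in it, which makes decompositions easy to construct.
\<close>

lemma full_svd_iff:
  fixes A :: "'a::rc_field mat"
  assumes A: "A \<in> carrier_mat m n"
  shows "full_svd A U \<sigma> V \<longleftrightarrow> unitary_mat m U \<and> unitary_mat n V \<and> antimono \<sigma> \<and> (\<forall>i. 0 \<le> \<sigma> i) \<and>
           (\<forall>i\<ge>min m n. \<sigma> i = 0) \<and> A = U * sv_mat m n \<sigma> * V\<^sup>H"
proof
  assume "full_svd A U \<sigma> V"
  then have F: "unitary_mat m U" "unitary_mat n V" "A = U * sv_mat m n \<sigma> * V\<^sup>H"
    "\<And>i. i < vec_space.rank m A \<Longrightarrow> 0 < \<sigma> i"
    "\<And>i j. i \<le> j \<Longrightarrow> j < vec_space.rank m A \<Longrightarrow> \<sigma> j \<le> \<sigma> i"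
    "\<And>i. vec_space.rank m A \<le> i \<Longrightarrow> \<sigma> i = 0"
    using A unfolding full_svd_def by (auto simp: Let_def)
  have nn: "0 \<le> \<sigma> i" for i using F(4,6)[of i] by (cases "i < vec_space.rank m A") auto
  have "antimono \<sigma>"
  proof (rule antimonoI)
    fix i j :: nat assume "i \<le> j"
    then show "\<sigma> j \<le> \<sigma> i" using F(5)[of i j] F(6)[of j] nn[of i] by (cases "j < vec_space.rank m A") auto
  qed
  moreover have "vec_space.rank m A \<le> min m n"
    using rank_le_dim_row[OF A] vec_space.rank_le_nc[OF A] by simp
  ultimately show "unitary_mat m U \<and> unitary_mat n V \<and> antimono \<sigma> \<and> (\<forall>i. 0 \<le> \<sigma> i) \<and>
           (\<forall>i\<ge>min m n. \<sigma> i = 0) \<and> A = U * sv_mat m n \<sigma> * V\<^sup>H"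
    using F(1,2,3,6) nn by (meson le_trans)
next
  assume F: "unitary_mat m U \<and> unitary_mat n V \<and> antimono \<sigma> \<and> (\<forall>i. 0 \<le> \<sigma> i) \<and>
           (\<forall>i\<ge>min m n. \<sigma> i = 0) \<and> A = U * sv_mat m n \<sigma> * V\<^sup>H"
  then obtain r where r: "r \<le> min m n" "\<And>i. i < r \<Longrightarrow> 0 < \<sigma> i" "\<And>i. r \<le> i \<Longrightarrow> \<sigma> i = 0"
    using decreasing_support[of \<sigma> "min m n"] by blast
  then have "vec_space.rank m A = r" using F by (intro rank_svd[of m U n V A \<sigma> r]) auto
  then show "full_svd A U \<sigma> V" using F r A unfolding full_svd_def Let_def carrier_matD[OF A] antimono_def by auto
qed

lemma adjoint_sv_mat: "(sv_mat m n \<sigma>)\<^sup>H = (sv_mat n m \<sigma> :: 'a::rc_field mat)"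
  by (rule eq_matI) auto

text \<open>
  Diagonalise \<open>A A\<^sup>H\<close> by \<open>U\<close>. The columns of \<open>W = A\<^sup>H
  U\<close> are then orthogonal and their squared norms are the eigenvalues, so the normalised
  nonzero columns of \<open>W\<close>, completed to a unitary matrix, serve as right singular
  vectors.
\<close>

lemma svd_exists:
  fixes A :: "'a::rc_field mat"
  assumes A: "A \<in> carrier_mat m n"
  shows "\<exists>U \<sigma> V. full_svd A U \<sigma> V"
proof -
  have AH: "A\<^sup>H \<in> carrier_mat n m" using A by simp
  have "(A * A\<^sup>H)\<^sup>H = A * A\<^sup>H" using adjoint_mult[OF A AH] by simp
  then obtain U and e :: "nat \<Rightarrow> real" where U: "unitary_mat m U"
    and eig: "\<And>i j. i < m \<Longrightarrow> j < m \<Longrightarrow> (A * A\<^sup>H * U) $$ (i, j) = of_real (e j) * U $$ (i, j)"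
    and dec: "\<And>i j. i \<le> j \<Longrightarrow> j < m \<Longrightarrow> e j \<le> e i"
    using hermitian_diagonalization[of "A * A\<^sup>H" m] A by auto
  note Uc = unitary_matD[OF U]
  define W where "W = A\<^sup>H * U"
  have W: "W \<in> carrier_mat n m" using AH Uc by (simp add: W_def)
  have WH: "W\<^sup>H = U\<^sup>H * A" using adjoint_mult[OF AH Uc(1)] by (simp add: W_def)
  have gram: "(\<Sum>l<n. conjugate (W $$ (l, i)) * W $$ (l, j)) = (if i = j then of_real (e j) else 0)"
    if ij: "i < m" "j < m" for i j
  proof -
    have "(\<Sum>l<n. conjugate (W $$ (l, i)) * W $$ (l, j)) = (W\<^sup>H * W) $$ (i, j)"
      using adjoint_mult_index[OF W W ij] by simp
    also have "W\<^sup>H * W = U\<^sup>H * (A * W)"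
      unfolding WH using A Uc W by (intro assoc_mult_mat) auto
    also have "A * W = A * A\<^sup>H * U"
      unfolding W_def using A AH Uc by (intro assoc_mult_mat[symmetric]) auto
    also have "(U\<^sup>H * (A * A\<^sup>H * U)) $$ (i, j) = (\<Sum>l<m. conjugate (U $$ (l, i)) * (A * A\<^sup>H * U) $$ (l, j))"
      using A AH Uc ij by (intro adjoint_mult_index) auto
    also have "\<dots> = of_real (e j) * (U\<^sup>H * U) $$ (i, j)"
      using ij by (simp add: eig adjoint_mult_index[OF Uc(1,1)] sum_distrib_left mult.left_commute del: index_mult_mat(1))
    finally show ?thesis using Uc ij by simp
  qed
  have esum: "e j = (\<Sum>l<n. (norm (W $$ (l, j)))\<^sup>2)" if "j < m" for j
  proof -
    have "(of_real (e j) :: 'a) = of_real (\<Sum>l<n. (norm (W $$ (l, j)))\<^sup>2)"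
      using gram[OF that that] by (simp only: conjugate_mult_self if_True refl of_real_sum)
    then show ?thesis by (simp only: of_real_eq_iff)
  qed
  define \<sigma> where "\<sigma> i = (if i < m then sqrt (e i) else 0)" for i
  have e0: "0 \<le> e i" if "i < m" for i using esum[OF that] by (simp add: sum_nonneg)
  have \<sigma>0: "0 \<le> \<sigma> i" for i using e0 by (simp add: \<sigma>_def)
  have anti: "antimono \<sigma>"
    by (rule antimonoI) (use dec e0 in \<open>auto simp: \<sigma>_def\<close>)
  obtain r where r: "r \<le> m" "\<And>i. i < r \<Longrightarrow> 0 < \<sigma> i" "\<And>i. r \<le> i \<Longrightarrow> \<sigma> i = 0"
    using decreasing_support[OF anti \<sigma>0, of m] by (auto simp: \<sigma>_def)
  have e\<sigma>: "e i = (\<sigma> i)\<^sup>2" if "i < m" for i using e0[OF that] that by (simp add: \<sigma>_def)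
  define Q where "Q = mat n r (\<lambda>(i, j). W $$ (i, j) / of_real (\<sigma> j))"
  have Q: "Q \<in> carrier_mat n r" by (simp add: Q_def)
  have Q_index: "Q $$ (l, j) = W $$ (l, j) / of_real (\<sigma> j)" if "l < n" "j < r" for l j
    using that by (simp add: Q_def)
  have QQ: "Q\<^sup>H * Q = 1\<^sub>m r"
  proof (rule eq_matI)
    fix i j assume "i < dim_row (1\<^sub>m r :: 'a mat)" "j < dim_col (1\<^sub>m r :: 'a mat)"
    then have ij: "i < r" "j < r" by auto
    have cd: "conjugate (x / of_real s) = conjugate x / of_real s" for x :: 'a and s
    proof -
      have "conjugate (x * of_real (inverse s)) = conjugate x * of_real (inverse s)"
        by (simp only: conjugate_dist_mul conjugate_of_real)
      then show ?thesis by (simp add: divide_inverse)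
    qed
    have "(Q\<^sup>H * Q) $$ (i, j) = (\<Sum>l<n. conjugate (W $$ (l, i)) * W $$ (l, j)) / (of_real (\<sigma> i) * of_real (\<sigma> j))"
      using ij by (simp add: adjoint_mult_index[OF Q Q] Q_index cd sum_divide_distrib del: index_mult_mat(1))
    also have "\<dots> = 1\<^sub>m r $$ (i, j)"
    proof (cases "i = j")
      case True
      have "\<sigma> j \<noteq> 0" "e j = \<sigma> j * \<sigma> j" using e\<sigma>[of j] r(1) r(2)[OF ij(2)] ij by (auto simp: power2_eq_square)
      then show ?thesis using gram[of i j] ij r True by simp
    qed (use gram[of i j] ij r in simp)
    finally show "(Q\<^sup>H * Q) $$ (i, j) = 1\<^sub>m r $$ (i, j)" .
  qed (use Q in auto)
  obtain V where V: "unitary_mat n V" and VQ: "\<And>i j. i < n \<Longrightarrow> j < r \<Longrightarrow> V $$ (i, j) = Q $$ (i, j)"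
    using orthonormal_columns_extend[OF Q QQ] by blast
  note Vc = unitary_matD[OF V]
  have rn: "r \<le> n" by (rule orthonormal_columns_le[OF Q QQ])
  \<comment> \<open>Columns of \<open>W\<close> for the eigenvalue 0 vanish, as their norm is 0.\<close>
  have WV: "W $$ (l, i) = (if i < r then of_real (\<sigma> i) * V $$ (l, i) else 0)" if li: "l < n" "i < m" for l i
  proof (cases "i < r")
    case True
    then show ?thesis using r(2)[OF True] li VQ[OF li(1) True] by (simp add: Q_def)
  next
    case False
    then have "(\<Sum>l<n. (norm (W $$ (l, i)))\<^sup>2) = 0" using esum[OF li(2)] e\<sigma>[OF li(2)] r(3)[of i] by simp
    then show ?thesis using False li by (auto simp: sum_nonneg_eq_0_iff)
  qed
  have "U\<^sup>H * A * V = sv_mat m n \<sigma>"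
  proof (rule eq_matI)
    fix i j assume "i < dim_row (sv_mat m n \<sigma> :: 'a mat)" "j < dim_col (sv_mat m n \<sigma> :: 'a mat)"
    then have ij: "i < m" "j < n" by auto
    have "(U\<^sup>H * A * V) $$ (i, j) = (\<Sum>l<n. conjugate (W $$ (l, i)) * V $$ (l, j))"
      unfolding WH[symmetric] by (rule adjoint_mult_index[OF W Vc(1) ij])
    also have "\<dots> = (if i < r then of_real (\<sigma> i) * (\<Sum>l<n. conjugate (V $$ (l, i)) * V $$ (l, j)) else 0)"
      using ij by (simp add: WV sum_distrib_left conjugate_dist_mul mult.assoc)
    also have "\<dots> = (if i < r then of_real (\<sigma> i) * (V\<^sup>H * V) $$ (i, j) else 0)"
      using ij rn by (simp add: adjoint_mult_index[OF Vc(1,1)] del: index_mult_mat(1))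
    finally show "(U\<^sup>H * A * V) $$ (i, j) = sv_mat m n \<sigma> $$ (i, j)"
      using Vc ij r(3)[of i] rn by (auto simp: not_less)
  qed (use A Uc Vc in auto)
  then have "A = U * sv_mat m n \<sigma> * V\<^sup>H"
    using unitary_sandwich[OF U V A] by simp
  moreover have "\<forall>i\<ge>min m n. \<sigma> i = 0" using r(1,3) rn by auto
  ultimately show ?thesis using full_svd_iff[OF A] U V anti \<sigma>0 by blast
qed

lemma full_svdD:
  fixes A :: "'a::rc_field mat"
  assumes "A \<in> carrier_mat m n" "full_svd A U \<sigma> V"
  shows "unitary_mat m U" "unitary_mat n V" "antimono \<sigma>" "\<And>i. 0 \<le> \<sigma> i"
    "\<And>i. m \<le> i \<Longrightarrow> \<sigma> i = 0" "\<And>i. n \<le> i \<Longrightarrow> \<sigma> i = 0" "A = U * sv_mat m n \<sigma> * V\<^sup>H"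
  using assms(2) full_svd_iff[OF assms(1)] by auto

text \<open>
  In the coordinates given by \<open>U\<close> the quadratic form \<open>x \<mapsto> |A\<^sup>H
  x|\<^sup>2\<close> is diagonal with coefficients \<open>\<sigma>\<^sub>l\<^sup>2\<close>.
\<close>

lemma norm_adjoint_mult_svd:
  fixes A :: "'a::rc_field mat"
  assumes A: "A \<in> carrier_mat m n" "full_svd A U \<sigma> V" and x: "x \<in> carrier_mat m 1"
  shows "(frobenius_norm (A\<^sup>H * x))\<^sup>2 = (\<Sum>l<m. (\<sigma> l)\<^sup>2 * (norm ((U\<^sup>H * x) $$ (l, 0)))\<^sup>2)"
proof -
  note F = full_svdD[OF A]
  note Uc = unitary_matD[OF F(1)] and Vc = unitary_matD[OF F(2)]
  let ?S = "sv_mat n m \<sigma> :: 'a mat"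
  let ?z = "U\<^sup>H * x"
  have z: "?z \<in> carrier_mat m 1" using Uc x by (simp add: mult_carrier_mat[of _ m m])
  have Sz: "?S * ?z \<in> carrier_mat n 1" using z by (intro mult_carrier_mat[of _ n m]) auto
  have x_eq: "x = U * ?z"
    using isometry_left_cancel[of "U\<^sup>H" m m x 1] Uc x by simp
  have "A\<^sup>H * U = (U\<^sup>H * A)\<^sup>H" using adjoint_mult[of "U\<^sup>H" m m A n] Uc A by simp
  also have "\<dots> = V * ?S"
    using svd_mult_right(2)[OF F(1,2,7)] adjoint_mult[OF mat_carrier adjoint_carrier[OF Vc(1)]]
    by (simp add: adjoint_sv_mat)
  finally have AU: "A\<^sup>H * U = V * ?S" .
  have "A\<^sup>H * x = A\<^sup>H * U * ?z"
    using A Uc z by (subst x_eq) (intro assoc_mult_mat[symmetric], auto)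
  also have "\<dots> = V * (?S * ?z)"
    unfolding AU using Vc z by (intro assoc_mult_mat) auto
  finally have "(frobenius_norm (A\<^sup>H * x))\<^sup>2 = (frobenius_norm (?S * ?z))\<^sup>2"
    using frobenius_norm_isometry_left[OF Vc(1,2) Sz] by simp
  also have "\<dots> = (\<Sum>l<n. (norm ((?S * ?z) $$ (l, 0)))\<^sup>2)"
    using frobenius_norm_sq_carrier[OF Sz] by simp
  also have "\<dots> = (\<Sum>l<n. if l < m then (\<sigma> l)\<^sup>2 * (norm (?z $$ (l, 0)))\<^sup>2 else 0)"
    by (intro sum.cong refl, subst sv_mat_mult_index[OF z])
      (auto simp: norm_mult power_mult_distrib simp del: index_mult_mat(1))
  also have "\<dots> = (\<Sum>l<m. (\<sigma> l)\<^sup>2 * (norm (?z $$ (l, 0)))\<^sup>2)"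
    by (rule sum.mono_neutral_cong) (auto simp: F(6) not_less simp del: index_mult_mat(1))
  finally show ?thesis .
qed

text \<open>
  Completing \<open>x\<close> to a unitary matrix \<open>U\<close> makes \<open>B x\<close> a column
  of \<open>B U\<close>, which has the norm of \<open>B\<close>.
\<close>

lemma frobenius_norm_mult_unit_le:
  fixes B :: "'a::rc_field mat"
  assumes B: "B \<in> carrier_mat n m" and x: "x \<in> carrier_mat m 1" "x\<^sup>H * x = 1\<^sub>m 1"
  shows "frobenius_norm (B * x) \<le> frobenius_norm B"
proof -
  obtain U where U: "unitary_mat m U" and Ux: "\<And>i j. i < m \<Longrightarrow> j < 1 \<Longrightarrow> U $$ (i, j) = x $$ (i, j)"
    using orthonormal_columns_extend[OF x] by blast
  note Uc = unitary_matD[OF U]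
  have m: "0 < m" using orthonormal_columns_le[OF x] by simp
  have BU: "B * U \<in> carrier_mat n m" and Bx: "B * x \<in> carrier_mat n 1" using B Uc x by auto
  have "(B * x) $$ (i, 0) = (B * U) $$ (i, 0)" if "i < n" for i
    using mult_index_carrier[OF B x(1) that, of 0] mult_index_carrier[OF B Uc(1) that m] Ux
    by (simp del: index_mult_mat(1))
  then have "(frobenius_norm (B * x))\<^sup>2 = (\<Sum>i<n. (norm ((B * U) $$ (i, 0)))\<^sup>2)"
    unfolding frobenius_norm_sq_carrier[OF Bx] by (simp del: index_mult_mat(1))
  also have "\<dots> \<le> (\<Sum>i<n. \<Sum>j<m. (norm ((B * U) $$ (i, j)))\<^sup>2)"
    using m by (intro sum_mono member_le_sum) auto
  also have "\<dots> = (frobenius_norm (B * U))\<^sup>2"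
    using frobenius_norm_sq_carrier[OF BU] by simp
  also have "frobenius_norm (B * U) = frobenius_norm B"
    using frobenius_norm_isometry_right[of "U\<^sup>H" m m B n] Uc B by simp
  finally show ?thesis by (simp add: power2_le_iff_abs_le)
qed

text \<open>
  Weyl's inequality. Some unit vector \<open>x\<close> lies in the span of the first \<open>j +
  1\<close> columns of \<open>U\<close> and is orthogonal to the first \<open>j\<close> columns of
  \<open>U'\<close>. On such a vector \<open>|A\<^sup>H x|\<close> is at least
  \<open>\<sigma>\<^sub>j\<close> and \<open>|B\<^sup>H x|\<close> is at most
  \<open>\<tau>\<^sub>j\<close>, and the two differ by at most the norm of \<open>A - B\<close>.
\<close>

lemma singular_value_perturbation:
  fixes A B :: "'a::rc_field mat"
  assumes A: "A \<in> carrier_mat m n" "full_svd A U \<sigma> V" and B: "B \<in> carrier_mat m n" "full_svd B U' \<tau> V'"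
    and j: "j < m"
  shows "\<sigma> j \<le> \<tau> j + frobenius_dist A B"
proof -
  note F = full_svdD[OF A] and G = full_svdD[OF B]
  note Uc = unitary_matD[OF F(1)] and Uc' = unitary_matD[OF G(1)]
  define P where "P = select_columns U (Suc j) (\<lambda>l. l)"
  have P: "P \<in> carrier_mat m (Suc j)" using Uc by (simp add: P_def)
  have PP: "P\<^sup>H * P = 1\<^sub>m (Suc j)"
    unfolding P_def using Uc j by (intro select_columns_orthonormal[where p=m and m=m]) auto
  define R where "R = mat j (Suc j) (\<lambda>(i, l). (U'\<^sup>H * P) $$ (i, l))"
  have R: "R \<in> carrier_mat j (Suc j)" by (simp add: R_def)
  obtain y where y: "y \<in> carrier_mat (Suc j) 1" "y\<^sup>H * y = 1\<^sub>m 1" "R * y = 0\<^sub>m j 1"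
    using underdetermined_solution[OF R] by blast
  define x where "x = P * y"
  have x: "x \<in> carrier_mat m 1" using P y by (simp add: x_def)
  have UHP: "(U\<^sup>H * P) $$ (i, l) = (if i = l then 1 else 0)" if "i < m" "l < Suc j" for i l
    using mult_select_columns_index[of "U\<^sup>H" m m U m i l "Suc j" "\<lambda>l. l"] Uc that j
    by (simp add: P_def del: index_mult_mat(1))
  have UHx: "(U\<^sup>H * x) $$ (i, 0) = (if i < Suc j then y $$ (i, 0) else 0)" if "i < m" for i
  proof -
    have "U\<^sup>H * x = U\<^sup>H * P * y" unfolding x_def using Uc P y by (intro assoc_mult_mat[symmetric]) auto
    also have "\<dots> $$ (i, 0) = (\<Sum>l<Suc j. (U\<^sup>H * P) $$ (i, l) * y $$ (l, 0))"
      using Uc P y that by (subst mult_index_carrier[where k="Suc j" and m=m]) auto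
    also have "\<dots> = (\<Sum>l<Suc j. if i = l then y $$ (l, 0) else 0)"
      using that by (intro sum.cong refl) (simp add: UHP del: index_mult_mat(1))
    also have "\<dots> = (if i < Suc j then y $$ (i, 0) else 0)" by (simp del: sum.lessThan_Suc)
    finally show ?thesis .
  qed
  have UHx': "(U'\<^sup>H * x) $$ (i, 0) = 0" if "i < j" for i
  proof -
    have "U'\<^sup>H * x = U'\<^sup>H * P * y" unfolding x_def using Uc' P y by (intro assoc_mult_mat[symmetric]) auto
    also have "\<dots> $$ (i, 0) = (\<Sum>l<Suc j. (U'\<^sup>H * P) $$ (i, l) * y $$ (l, 0))"
      using Uc' P y that j by (subst mult_index_carrier[where k="Suc j" and m=m]) auto
    also have "\<dots> = (R * y) $$ (i, 0)"
      using R y that by (subst mult_index_carrier[where k="Suc j" and m=j])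
        (auto simp: R_def simp del: index_mult_mat(1) sum.lessThan_Suc)
    finally show ?thesis using y(3) that by simp
  qed
  have xx: "x\<^sup>H * x = 1\<^sub>m 1"
    unfolding x_def isometry_gram[OF P PP y(1)] by (rule y(2))
  have nsq1: "(\<Sum>l<m. (norm ((W\<^sup>H * x) $$ (l, 0)))\<^sup>2) = 1" if W: "unitary_mat m W" for W
  proof -
    have Wx: "W\<^sup>H * x \<in> carrier_mat m 1" using unitary_matD[OF W] x by auto
    have "frobenius_norm (W\<^sup>H * x) = frobenius_norm x"
      using frobenius_norm_isometry_left[of "W\<^sup>H" m m x 1] unitary_matD[OF W] x by simp
    moreover have "(of_real ((frobenius_norm x)\<^sup>2) :: 'a) = of_real 1"
      using frobenius_gram[OF x] xx by simp
    ultimately show ?thesis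
      using frobenius_norm_sq_carrier[OF Wx] by (simp only: of_real_eq_iff lessThan_Suc_eq_insert_0) simp
  qed
  have "(\<sigma> j)\<^sup>2 = (\<Sum>l<m. (\<sigma> j)\<^sup>2 * (norm ((U\<^sup>H * x) $$ (l, 0)))\<^sup>2)"
    unfolding sum_distrib_left[symmetric] nsq1[OF F(1)] by simp
  also have "\<dots> \<le> (\<Sum>l<m. (\<sigma> l)\<^sup>2 * (norm ((U\<^sup>H * x) $$ (l, 0)))\<^sup>2)"
  proof (rule sum_mono)
    fix l assume "l \<in> {..<m}"
    then show "(\<sigma> j)\<^sup>2 * (norm ((U\<^sup>H * x) $$ (l, 0)))\<^sup>2 \<le> (\<sigma> l)\<^sup>2 * (norm ((U\<^sup>H * x) $$ (l, 0)))\<^sup>2"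
      using antimonoD[OF F(3), of l j] F(4) UHx[of l]
      by (cases "l < Suc j") (auto intro!: mult_right_mono power_mono simp del: index_mult_mat(1))
  qed
  also have "\<dots> = (frobenius_norm (A\<^sup>H * x))\<^sup>2" using norm_adjoint_mult_svd[OF A x] by simp
  finally have 1: "\<sigma> j \<le> frobenius_norm (A\<^sup>H * x)" using F(4) by (simp add: power2_le_iff_abs_le)
  have "(frobenius_norm (B\<^sup>H * x))\<^sup>2 = (\<Sum>l<m. (\<tau> l)\<^sup>2 * (norm ((U'\<^sup>H * x) $$ (l, 0)))\<^sup>2)"
    by (rule norm_adjoint_mult_svd[OF B x])
  also have "\<dots> \<le> (\<Sum>l<m. (\<tau> j)\<^sup>2 * (norm ((U'\<^sup>H * x) $$ (l, 0)))\<^sup>2)"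
  proof (rule sum_mono)
    fix l assume "l \<in> {..<m}"
    then show "(\<tau> l)\<^sup>2 * (norm ((U'\<^sup>H * x) $$ (l, 0)))\<^sup>2 \<le> (\<tau> j)\<^sup>2 * (norm ((U'\<^sup>H * x) $$ (l, 0)))\<^sup>2"
      using antimonoD[OF G(3), of j l] G(4) UHx'[of l]
      by (cases "l < j") (auto intro!: mult_right_mono power_mono simp del: index_mult_mat(1))
  qed
  also have "\<dots> = (\<tau> j)\<^sup>2"
    unfolding sum_distrib_left[symmetric] nsq1[OF G(1)] by simp
  finally have 2: "frobenius_norm (B\<^sup>H * x) \<le> \<tau> j" using G(4) by (simp add: power2_le_iff_abs_le)
  have "A\<^sup>H = (A - B)\<^sup>H + B\<^sup>H"
    using A(1) B(1) by (intro eq_matI) (auto simp: adjoint_minus[OF A(1) B(1)])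
  then have "A\<^sup>H * x = (A - B)\<^sup>H * x + B\<^sup>H * x"
    using A(1) B(1) x by (metis add_mult_distrib_mat adjoint_carrier minus_carrier_mat)
  then have "frobenius_norm (A\<^sup>H * x) \<le> frobenius_norm ((A - B)\<^sup>H * x) + frobenius_norm (B\<^sup>H * x)"
    using frobenius_norm_triangle[of "(A - B)\<^sup>H * x" n 1 "B\<^sup>H * x"] A(1) B(1) x minus_carrier_mat[OF B(1), of A]
    by (metis adjoint_carrier mult_carrier_mat)
  moreover have "frobenius_norm ((A - B)\<^sup>H * x) \<le> frobenius_norm ((A - B)\<^sup>H)"
    using frobenius_norm_mult_unit_le[OF _ x xx] minus_carrier_mat[OF B(1), of A] by blast
  ultimately show ?thesis using 1 2 by (simp add: frobenius_dist_def)
qed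

lemma frobenius_dist_self [simp]: "frobenius_dist A A = 0"
  by (simp add: frobenius_dist_def frobenius_norm_def)

text \<open>
  Weyl's inequality for \<open>A\<close> against itself, in both directions.
\<close>

lemma full_svd_unique:
  fixes A :: "'a::rc_field mat"
  assumes A: "A \<in> carrier_mat m n" and F: "full_svd A U \<sigma> V" and G: "full_svd A U' \<tau> V'"
  shows "\<sigma> = \<tau>"
proof
  fix j
  show "\<sigma> j = \<tau> j"
  proof (cases "j < m")
    case True
    then show ?thesis
      using singular_value_perturbation[OF A F A G True] singular_value_perturbation[OF A G A F True] by simp
  qed (use full_svdD(5)[OF A F] full_svdD(5)[OF A G] in simp)
qed

lemma singular_value_eq:
  fixes A :: "'a::rc_field mat"
  assumes A: "A \<in> carrier_mat m n" and F: "full_svd A U \<sigma> V"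
  shows "singular_value A = \<sigma>"
  unfolding singular_value_def using F full_svd_unique[OF A F] by (blast intro: the_equality)

section \<open>Left singular subspaces\<close>

lemma unitary_mult_vec_cancel:
  fixes U :: "'a::rc_field mat"
  assumes "unitary_mat m U" "x \<in> carrier_vec m"
  shows "U *\<^sub>v (U\<^sup>H *\<^sub>v x) = x"
  using unitary_matD[OF assms(1)] assms(2) assoc_mult_mat_vec[of U m m "U\<^sup>H" m x] by simp

lemma mult_mat_vec_index:
  "A \<in> carrier_mat m n \<Longrightarrow> v \<in> carrier_vec n \<Longrightarrow> i < m \<Longrightarrow> (A *\<^sub>v v) $ i = (\<Sum>l<n. A $$ (i, l) * v $ l)"
  by (simp add: scalar_prod_def atLeast0LessThan)

lemma col_space_select_columns:
  fixes U :: "'a::field mat"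
  assumes "U \<in> carrier_mat m p" "bij_betw f {..<k} \<pi>" "\<pi> \<subseteq> {..<p}"
  shows "vec_space.col_space m (select_columns U k f) = cols_span U \<pi>"
proof -
  have f: "f ` {..<k} = \<pi>" using assms(2) by (simp add: bij_betw_def)
  have "col (select_columns U k f) j = col U (f j)" if "j < k" for j
    using assms(1,3) f that by (intro eq_vecI) (auto simp: select_columns_def)
  then have "set (cols (select_columns U k f)) = col U ` \<pi>"
    using assms(1) f by (auto simp: cols_def select_columns_def image_iff)
  then show ?thesis using assms(1) by (simp add: vec_space.col_space_def cols_span_def)
qed

text \<open>
  Membership in the span of some columns of \<open>U\<close> is the vanishing of the other
  coordinates; this replaces linear combinations in all that follows.
\<close>

lemma cols_span_unitary:
  fixes U :: "'a::rc_field mat"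
  assumes U: "unitary_mat m U" and \<pi>: "\<pi> \<subseteq> {..<m}"
  shows "cols_span U \<pi> = {x \<in> carrier_vec m. \<forall>i\<in>{..<m} - \<pi>. (U\<^sup>H *\<^sub>v x) $ i = 0}"
proof -
  note Uc = unitary_matD[OF U]
  obtain f where f: "bij_betw f {..<card \<pi>} \<pi>"
    using ex_bij_betw_nat_finite[OF finite_subset[OF \<pi> finite_lessThan]] by (auto simp: atLeast0LessThan)
  let ?k = "card \<pi>"
  let ?Q = "select_columns U ?k f"
  have Q: "?Q \<in> carrier_mat m ?k" using Uc by simp
  have f\<pi>: "f j \<in> \<pi>" if "j < ?k" for j using f that by (auto simp: bij_betw_def)
  have fm: "f j < m" if "j < ?k" for j using f\<pi>[OF that] \<pi> by auto
  have "cols_span U \<pi> = {y \<in> carrier_vec m. \<exists>x\<in>carrier_vec ?k. ?Q *\<^sub>v x = y}"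
    using col_space_select_columns[OF Uc(1) f \<pi>] vec_space.col_space_eq[OF Q] Q by (simp add: carrier_matD[OF Q])
  also have "\<dots> = {x \<in> carrier_vec m. \<forall>i\<in>{..<m} - \<pi>. (U\<^sup>H *\<^sub>v x) $ i = 0}"
  proof (intro equalityI subsetI)
    fix x assume "x \<in> {y \<in> carrier_vec m. \<exists>x\<in>carrier_vec ?k. ?Q *\<^sub>v x = y}"
    then obtain y where y: "y \<in> carrier_vec ?k" and x: "x = ?Q *\<^sub>v y" "x \<in> carrier_vec m" by auto
    show "x \<in> {x \<in> carrier_vec m. \<forall>i\<in>{..<m} - \<pi>. (U\<^sup>H *\<^sub>v x) $ i = 0}"
      unfolding mem_Collect_eq
    proof (intro conjI ballI)
      show "x \<in> carrier_vec m" by (rule x(2))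
      fix i assume i: "i \<in> {..<m} - \<pi>"
      have "U\<^sup>H *\<^sub>v (?Q *\<^sub>v y) = U\<^sup>H * ?Q *\<^sub>v y"
        using Uc Q y by (intro assoc_mult_mat_vec[symmetric, of _ m m _ ?k]) auto
      also have "\<dots> $ i = (\<Sum>l<?k. (U\<^sup>H * ?Q) $$ (i, l) * y $ l)"
        using i Uc Q y by (intro mult_mat_vec_index[of _ m]) (auto intro!: mult_carrier_mat[of _ m m])
      also have "\<dots> = 0"
      proof (rule sum.neutral, rule ballI)
        fix l assume l: "l \<in> {..<?k}"
        have "(U\<^sup>H * ?Q) $$ (i, l) = (U\<^sup>H * U) $$ (i, f l)"
          using i l Uc fm by (intro mult_select_columns_index) auto
        then show "(U\<^sup>H * ?Q) $$ (i, l) * y $ l = 0" using i l f\<pi>[of l] fm[of l] Uc by auto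
      qed
      finally show "(U\<^sup>H *\<^sub>v x) $ i = 0" unfolding x(1) .
    qed
  next
    fix x assume "x \<in> {x \<in> carrier_vec m. \<forall>i\<in>{..<m} - \<pi>. (U\<^sup>H *\<^sub>v x) $ i = 0}"
    then have x: "x \<in> carrier_vec m" and 0: "\<forall>i\<in>{..<m} - \<pi>. (U\<^sup>H *\<^sub>v x) $ i = 0" by auto
    let ?z = "U\<^sup>H *\<^sub>v x"
    have z: "?z \<in> carrier_vec m" using Uc(1) x by (intro mult_mat_vec_carrier[of _ m m]) auto
    define y where "y = vec ?k (\<lambda>j. ?z $ f j)"
    have y: "y \<in> carrier_vec ?k" by (simp add: y_def)
    have "?Q *\<^sub>v y = x"
    proof (rule eq_vecI)
      fix i assume "i < dim_vec x"
      then have i: "i < m" using x by simp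
      have "(?Q *\<^sub>v y) $ i = (\<Sum>l<?k. U $$ (i, f l) * ?z $ f l)"
        using mult_mat_vec_index[OF Q y i] i Uc by (simp add: y_def select_columns_index del: index_mult_mat_vec)
      also have "\<dots> = (\<Sum>l\<in>\<pi>. U $$ (i, l) * ?z $ l)"
        by (rule sum.reindex_bij_betw[OF f])
      also have "\<dots> = (\<Sum>l<m. U $$ (i, l) * ?z $ l)"
        using 0 \<pi> by (intro sum.mono_neutral_left) auto
      also have "\<dots> = (U *\<^sub>v ?z) $ i" by (rule mult_mat_vec_index[OF Uc(1) z i, symmetric])
      finally show "(?Q *\<^sub>v y) $ i = x $ i" using unitary_mult_vec_cancel[OF U x] by simp
    qed (use Q x in simp)
    then show "x \<in> {y \<in> carrier_vec m. \<exists>x\<in>carrier_vec ?k. ?Q *\<^sub>v x = y}" using x y by blast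
  qed
  finally show ?thesis .
qed

lemma cols_span_subsetI:
  fixes U :: "'a::rc_field mat"
  assumes U: "unitary_mat m U" and T: "T \<subseteq> cols_span U \<pi>" and \<pi>: "\<pi> \<subseteq> {..<m}"
  shows "vec_span m T \<subseteq> cols_span U \<pi>"
proof -
  interpret vec_space "TYPE('a)" m .
  have U': "U \<in> carrier_mat m m" using unitary_matD(1)[OF U] .
  have "col U ` \<pi> \<subseteq> carrier_vec m" using U' by auto
  then show ?thesis using span_subsetI[of "col U ` \<pi>" T] T U' by (simp add: cols_span_def)
qed

lemma vec_space_in_own_span:
  fixes T :: "'a::field vec set"
  assumes "T \<subseteq> carrier_vec m"
  shows "T \<subseteq> vec_span m T"
proof -
  interpret vec_space "TYPE('a)" m .
  show ?thesis using in_own_span assms by simp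
qed

lemma vec_span_mono:
  fixes T :: "'a::field vec set"
  assumes "S \<subseteq> T"
  shows "vec_span m S \<subseteq> vec_span m T"
proof -
  interpret vec_space "TYPE('a)" m .
  show ?thesis using span_is_monotone assms by simp
qed

lemma col_in_cols_span_iff:
  fixes U :: "'a::rc_field mat"
  assumes U: "unitary_mat m U" and i: "i < m" and \<pi>: "\<pi> \<subseteq> {..<m}"
  shows "col U i \<in> cols_span U \<pi> \<longleftrightarrow> i \<in> \<pi>"
proof -
  note Uc = unitary_matD[OF U]
  have "(U\<^sup>H *\<^sub>v col U i) $ j = (if j = i then 1 else 0)" if "j < m" for j
  proof -
    have "(U\<^sup>H *\<^sub>v col U i) $ j = (U\<^sup>H * U) $$ (j, i)" using Uc(1) that i by simp
    then show ?thesis using Uc(2) that i by simp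
  qed
  then show ?thesis unfolding cols_span_unitary[OF U \<pi>] using Uc i by auto
qed

text \<open>
  In the coordinates given by \<open>U\<close> the matrix \<open>A A\<^sup>H\<close> is diagonal
  with entries \<open>\<sigma>\<^sub>i\<^sup>2\<close>, and \<open>\<sigma>\<^sub>i\<^sup>2 =
  s\<^sup>2\<close> means \<open>\<sigma>\<^sub>i = s\<close> since both numbers are nonnegative.
\<close>

lemma left_singular_space_svd:
  fixes A :: "'a::rc_field mat"
  assumes A: "A \<in> carrier_mat m n" and F: "full_svd A U \<sigma> V" and s: "0 \<le> s"
  shows "left_singular_space A s = cols_span U {i. i < m \<and> \<sigma> i = s}"
proof -
  note D = full_svdD[OF A F]
  note Uc = unitary_matD[OF D(1)] and Vc = unitary_matD[OF D(2)]
  have AH: "A\<^sup>H \<in> carrier_mat n m" using A by simp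
  let ?S = "sv_mat m n \<sigma> :: 'a mat" and ?T = "sv_mat n m \<sigma> :: 'a mat"
  have TU: "?T * U\<^sup>H \<in> carrier_mat n m" using Uc by (intro mult_carrier_mat[of _ n m]) auto
  have AV: "V\<^sup>H * A\<^sup>H = ?T * U\<^sup>H"
    using svd_mult_right(1)[OF D(1,2,7)] adjoint_mult[OF A Vc(1)] adjoint_mult[OF Uc(1) mat_carrier, of n]
    by (simp add: adjoint_sv_mat)
  have "U\<^sup>H * (A * A\<^sup>H) = U\<^sup>H * A * A\<^sup>H" using A Uc by (intro assoc_mult_mat[symmetric]) auto
  also have "\<dots> = ?S * (V\<^sup>H * A\<^sup>H)"
    unfolding svd_mult_right(2)[OF D(1,2,7)] using A Vc by (intro assoc_mult_mat) auto
  finally have eq: "U\<^sup>H * (A * A\<^sup>H) = ?S * (?T * U\<^sup>H)" unfolding AV .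
  have idx: "(U\<^sup>H * (A * A\<^sup>H)) $$ (i, j) = of_real ((\<sigma> i)\<^sup>2) * U\<^sup>H $$ (i, j)" if "i < m" "j < m" for i j
  proof (cases "i < n")
    case True
    then show ?thesis
      using sv_mat_mult_index[OF TU that] sv_mat_mult_index[OF adjoint_carrier[OF Uc(1)] True that(2), of \<sigma>] that
      by (simp add: eq power2_eq_square mult.assoc del: index_mult_mat(1) adjoint_index)
  next
    case False
    then show ?thesis using sv_mat_mult_index[OF TU that] D(6)[of i] by (simp add: eq del: index_mult_mat(1))
  qed
  have key: "(U\<^sup>H *\<^sub>v (A * A\<^sup>H *\<^sub>v x)) $ i = of_real ((\<sigma> i)\<^sup>2) * (U\<^sup>H *\<^sub>v x) $ i"
    if x: "x \<in> carrier_vec m" and i: "i < m" for x i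
  proof -
    have "U\<^sup>H *\<^sub>v (A * A\<^sup>H *\<^sub>v x) = U\<^sup>H * (A * A\<^sup>H) *\<^sub>v x"
      using Uc A AH x by (intro assoc_mult_mat_vec[symmetric, of _ m m _ m]) auto
    also have "\<dots> $ i = (\<Sum>l<m. (U\<^sup>H * (A * A\<^sup>H)) $$ (i, l) * x $ l)"
      using Uc A AH x i by (intro mult_mat_vec_index[of _ m]) auto
    also have "\<dots> = of_real ((\<sigma> i)\<^sup>2) * (\<Sum>l<m. U\<^sup>H $$ (i, l) * x $ l)"
      using i by (simp add: idx sum_distrib_left mult.assoc del: index_mult_mat(1) adjoint_index)
    also have "(\<Sum>l<m. U\<^sup>H $$ (i, l) * x $ l) = (U\<^sup>H *\<^sub>v x) $ i"
      by (rule mult_mat_vec_index[OF adjoint_carrier[OF Uc(1)] x i, symmetric])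
    finally show ?thesis .
  qed
  have "(A * A\<^sup>H *\<^sub>v x = of_real (s\<^sup>2) \<cdot>\<^sub>v x) \<longleftrightarrow> (\<forall>i\<in>{..<m} - {i. i < m \<and> \<sigma> i = s}. (U\<^sup>H *\<^sub>v x) $ i = 0)"
    if x: "x \<in> carrier_vec m" for x
  proof -
    let ?y = "A * A\<^sup>H *\<^sub>v x" and ?w = "of_real (s\<^sup>2) \<cdot>\<^sub>v x"
    have y: "?y \<in> carrier_vec m" using A AH x by (intro mult_mat_vec_carrier[of _ m m]) auto
    have w: "?w \<in> carrier_vec m" using x by simp
    have sq: "(of_real ((\<sigma> i)\<^sup>2) :: 'a) = of_real (s\<^sup>2) \<longleftrightarrow> \<sigma> i = s" for i
      using s D(4)[of i] by (simp only: of_real_eq_iff power2_eq_iff_nonneg)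
    have "?y = ?w \<longleftrightarrow> U\<^sup>H *\<^sub>v ?y = U\<^sup>H *\<^sub>v ?w"
      using unitary_mult_vec_cancel[OF D(1) y] unitary_mult_vec_cancel[OF D(1) w] by metis
    also have "\<dots> \<longleftrightarrow> (\<forall>i<m. (U\<^sup>H *\<^sub>v ?y) $ i = (U\<^sup>H *\<^sub>v ?w) $ i)"
      using Uc by (auto intro!: eq_vecI simp del: index_mult_mat_vec)
    also have "\<dots> \<longleftrightarrow> (\<forall>i<m. of_real ((\<sigma> i)\<^sup>2) * (U\<^sup>H *\<^sub>v x) $ i = of_real (s\<^sup>2) * (U\<^sup>H *\<^sub>v x) $ i)"
      using key[OF x] mult_mat_vec[OF adjoint_carrier[OF Uc(1)] x, of "of_real (s\<^sup>2)"] Uc(1)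
      by (simp del: index_mult_mat_vec of_real_power)
    also have "\<dots> \<longleftrightarrow> (\<forall>i\<in>{..<m} - {i. i < m \<and> \<sigma> i = s}. (U\<^sup>H *\<^sub>v x) $ i = 0)"
      unfolding mult_cancel_right sq by auto
    finally show ?thesis .
  qed
  moreover have "{i. i < m \<and> \<sigma> i = s} \<subseteq> {..<m}" by auto
  ultimately show ?thesis
    using cols_span_unitary[OF D(1), of "{i. i < m \<and> \<sigma> i = s}"] A unfolding left_singular_space_def by auto
qed

lemma cols_span_mono:
  fixes U :: "'a::rc_field mat"
  assumes U: "unitary_mat m U" and "\<rho> \<subseteq> \<pi>" "\<pi> \<subseteq> {..<m}"
  shows "cols_span U \<rho> \<subseteq> cols_span U \<pi>"
  using cols_span_unitary[OF U, of \<rho>] cols_span_unitary[OF U, of \<pi>] assms by auto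

lemma equal_value_indices_subset:
  assumes "\<forall>i\<in>\<pi>. \<forall>j\<in>{..<m} - \<pi>. \<sigma> i \<noteq> (\<sigma> j :: real)" "i \<in> \<pi>"
  shows "{l. l < m \<and> \<sigma> l = \<sigma> i} \<subseteq> \<pi>"
proof
  fix l assume "l \<in> {l. l < m \<and> \<sigma> l = \<sigma> i}"
  then show "l \<in> \<pi>" using assms by (metis (mono_tags, lifting) DiffI lessThan_iff mem_Collect_eq)
qed

text \<open>
  A sum of spaces \<open>U\<^sub>s\<close> contains with one column of \<open>U\<close> all columns
  for the same singular value: if \<open>s\<close> is in the index set of the sum, then all of
  \<open>U\<^sub>s\<close> is contained in the sum, and if not, then the sum is orthogonal to
  \<open>U\<^sub>s\<close>. Conversely, a set \<open>\<pi>\<close> that is closed in this sense is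
  served by the singular values with index in \<open>\<pi>\<close>.
\<close>

lemma is_left_singular_subspace_iff:
  fixes A :: "'a::rc_field mat"
  assumes A: "A \<in> carrier_mat m n" and F: "full_svd A U \<sigma> V" and \<pi>: "\<pi> \<subseteq> {..<m}"
  shows "is_left_singular_subspace A (cols_span U \<pi>) \<longleftrightarrow> (\<forall>i\<in>\<pi>. \<forall>j\<in>{..<m} - \<pi>. \<sigma> i \<noteq> \<sigma> j)"
proof
  note D = full_svdD[OF A F]
  note Uc = unitary_matD[OF D(1)]
  assume "is_left_singular_subspace A (cols_span U \<pi>)"
  then obtain S where S: "S \<subseteq> insert 0 (\<sigma> ` {..<vec_space.rank m A})"
    and span: "cols_span U \<pi> = vec_span m (\<Union>s\<in>S. left_singular_space A s)"
    using A unfolding is_left_singular_subspace_def singular_value_eq[OF A F] by auto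
  have S0: "0 \<le> s" if "s \<in> S" for s using S that D(4) by auto
  show "\<forall>i\<in>\<pi>. \<forall>j\<in>{..<m} - \<pi>. \<sigma> i \<noteq> \<sigma> j"
  proof (intro ballI notI)
    fix i j assume i: "i \<in> \<pi>" and j: "j \<in> {..<m} - \<pi>" and eq: "\<sigma> i = \<sigma> j"
    have im: "i < m" using i \<pi> by auto
    show False
    proof (cases "\<sigma> i \<in> S")
      case True
      have "col U j \<in> left_singular_space A (\<sigma> i)"
        unfolding left_singular_space_svd[OF A F D(4)] using j eq by (subst col_in_cols_span_iff[OF D(1)]) auto
      moreover have "(\<Union>s\<in>S. left_singular_space A s) \<subseteq> carrier_vec m"
        using A by (auto simp: left_singular_space_def)
      then have "(\<Union>s\<in>S. left_singular_space A s) \<subseteq> cols_span U \<pi>"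
        unfolding span by (rule vec_space_in_own_span)
      ultimately have "col U j \<in> cols_span U \<pi>" using True by auto
      then show False using col_in_cols_span_iff[OF D(1) _ \<pi>, of j] j by auto
    next
      case False
      have "(\<Union>s\<in>S. left_singular_space A s) \<subseteq> cols_span U ({..<m} - {i})"
      proof (rule UN_least)
        fix s assume s: "s \<in> S"
        have "{l. l < m \<and> \<sigma> l = s} \<subseteq> {..<m} - {i}" using s False by auto
        then show "left_singular_space A s \<subseteq> cols_span U ({..<m} - {i})"
          unfolding left_singular_space_svd[OF A F S0[OF s]] by (intro cols_span_mono[OF D(1)]) auto
      qed
      then have "cols_span U \<pi> \<subseteq> cols_span U ({..<m} - {i})"
        unfolding span by (intro cols_span_subsetI[OF D(1)]) auto
      then show False
        using col_in_cols_span_iff[OF D(1) im \<pi>] col_in_cols_span_iff[OF D(1) im, of "{..<m} - {i}"] i by auto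
    qed
  qed
next
  note D = full_svdD[OF A F]
  note Uc = unitary_matD[OF D(1)]
  assume gap: "\<forall>i\<in>\<pi>. \<forall>j\<in>{..<m} - \<pi>. \<sigma> i \<noteq> \<sigma> j"
  let ?T = "\<Union>s\<in>\<sigma> ` \<pi>. left_singular_space A s"
  have "cols_span U \<pi> = vec_span m ?T"
  proof
    have "?T \<subseteq> cols_span U \<pi>"
    proof safe
      fix x i assume i: "i \<in> \<pi>" and x: "x \<in> left_singular_space A (\<sigma> i)"
      have "{l. l < m \<and> \<sigma> l = \<sigma> i} \<subseteq> \<pi>" by (rule equal_value_indices_subset[OF gap i])
      then show "x \<in> cols_span U \<pi>"
        using x cols_span_mono[OF D(1) _ \<pi>] by (auto simp: left_singular_space_svd[OF A F D(4)])
    qed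
    then show "vec_span m ?T \<subseteq> cols_span U \<pi>" by (intro cols_span_subsetI[OF D(1)] \<pi>)
    have "col U ` \<pi> \<subseteq> ?T"
    proof safe
      fix i assume i: "i \<in> \<pi>"
      then have "col U i \<in> left_singular_space A (\<sigma> i)"
        unfolding left_singular_space_svd[OF A F D(4)] using \<pi> by (subst col_in_cols_span_iff[OF D(1)]) auto
      then show "col U i \<in> ?T" using i by auto
    qed
    then show "cols_span U \<pi> \<subseteq> vec_span m ?T"
      unfolding cols_span_def carrier_matD(1)[OF Uc(1)] by (rule vec_span_mono)
  qed
  moreover have "\<sigma> ` \<pi> \<subseteq> insert 0 (\<sigma> ` {..<vec_space.rank m A})"
    using F A unfolding full_svd_def by (auto simp: Let_def not_less) (metis image_eqI lessThan_iff linorder_not_less)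
  ultimately show "is_left_singular_subspace A (cols_span U \<pi>)"
    using A unfolding is_left_singular_subspace_def singular_value_eq[OF A F] by auto
qed

lemma cols_span_svd_subset:
  fixes A :: "'a::rc_field mat"
  assumes A: "A \<in> carrier_mat m n" and F: "full_svd A U \<sigma> V" and G: "full_svd A U' \<sigma> V'" and \<pi>: "\<pi> \<subseteq> {..<m}"
    and gap: "\<forall>i\<in>\<pi>. \<forall>j\<in>{..<m} - \<pi>. \<sigma> i \<noteq> \<sigma> j"
  shows "cols_span U \<pi> \<subseteq> cols_span U' \<pi>"
proof -
  note D = full_svdD[OF A F] and D' = full_svdD[OF A G]
  have "col U ` \<pi> \<subseteq> cols_span U' \<pi>"
  proof safe
    fix i assume i: "i \<in> \<pi>"
    then have "col U i \<in> left_singular_space A (\<sigma> i)"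
      unfolding left_singular_space_svd[OF A F D(4)] using \<pi> by (subst col_in_cols_span_iff[OF D(1)]) auto
    moreover have "{l. l < m \<and> \<sigma> l = \<sigma> i} \<subseteq> \<pi>" by (rule equal_value_indices_subset[OF gap i])
    ultimately show "col U i \<in> cols_span U' \<pi>"
      using cols_span_mono[OF D'(1) _ \<pi>] by (auto simp: left_singular_space_svd[OF A G D(4)])
  qed
  then have "vec_span m (col U ` \<pi>) \<subseteq> cols_span U' \<pi>" by (intro cols_span_subsetI[OF D'(1)] \<pi>)
  then show ?thesis using unitary_matD(1)[OF D(1)] by (simp add: cols_span_def)
qed

lemma left_singular_domain_iff:
  fixes A :: "'a::rc_field mat"
  assumes A: "A \<in> carrier_mat m n" and F: "full_svd A U \<sigma> V" and \<pi>: "\<pi> \<subseteq> {..<m}"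
  shows "A \<in> left_singular_domain m n \<pi> \<longleftrightarrow> (\<forall>i\<in>\<pi>. \<forall>j\<in>{..<m} - \<pi>. \<sigma> i \<noteq> \<sigma> j)"
  unfolding left_singular_domain_def
  using A F is_left_singular_subspace_iff[OF A _ \<pi>] full_svd_unique[OF A F] by blast

text \<open>
  Under the gap condition the columns of one decomposition with index in \<open>\<pi>\<close> are
  eigenvectors of \<open>A A\<^sup>H\<close> for eigenvalues that the other decomposition attaches
  to \<open>\<pi>\<close> as well; hence any decomposition computes the map.
\<close>

lemma left_singular_map_eq:
  fixes A :: "'a::rc_field mat"
  assumes A: "A \<in> carrier_mat m n" and F: "full_svd A U \<sigma> V" and \<pi>: "\<pi> \<subseteq> {..<m}"
    and gap: "\<forall>i\<in>\<pi>. \<forall>j\<in>{..<m} - \<pi>. \<sigma> i \<noteq> \<sigma> j"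
  shows "left_singular_map \<pi> A = cols_span U \<pi>"
  unfolding left_singular_map_def
proof (rule the_equality)
  show "\<exists>U' \<sigma>' V'. full_svd A U' \<sigma>' V' \<and> cols_span U \<pi> = cols_span U' \<pi>" using F by blast
  fix W assume "\<exists>U' \<sigma>' V'. full_svd A U' \<sigma>' V' \<and> W = cols_span U' \<pi>"
  then obtain U' \<tau> V' where G: "full_svd A U' \<tau> V'" "W = cols_span U' \<pi>" by blast
  have "\<tau> = \<sigma>" using full_svd_unique[OF A F G(1)] by simp
  then show "W = cols_span U \<pi>"
    using cols_span_svd_subset[OF A F _ \<pi> gap, of U' V'] cols_span_svd_subset[OF A _ F \<pi> gap, of U' V'] G by auto
qed

section \<open>Principal angles and the three distances\<close>

lemma orthonormal_frame_select_columns: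
  fixes U :: "'a::rc_field mat"
  assumes U: "unitary_mat m U" and f: "bij_betw f {..<k} \<pi>" and \<pi>: "\<pi> \<subseteq> {..<m}"
  shows "orthonormal_frame m k (cols_span U \<pi>) (select_columns U k f)"
proof -
  note Uc = unitary_matD[OF U]
  have fm: "f j < m" if "j < k" for j using f that \<pi> by (auto simp: bij_betw_def)
  have "(select_columns U k f)\<^sup>H * select_columns U k f = 1\<^sub>m k"
    using f by (intro select_columns_orthonormal[OF Uc(1,2) _ fm]) (auto simp: bij_betw_def)
  then show ?thesis
    unfolding orthonormal_frame_def using Uc col_space_select_columns[OF Uc(1) f \<pi>] by simp
qed

text \<open>
  The transition matrix \<open>Q'\<^sup>H Q\<close> is unitary. It lets the frames that the
  definition of the principal angles picks arbitrarily be replaced by columns of \<open>U\<close>.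
\<close>

lemma orthonormal_frames_related:
  fixes Q Q' :: "'a::rc_field mat"
  assumes Q: "orthonormal_frame m k W Q" and Q': "orthonormal_frame m k W Q'"
  obtains T where "unitary_mat k T" "Q = Q' * T"
proof -
  have Qc: "Q \<in> carrier_mat m k" "Q\<^sup>H * Q = 1\<^sub>m k" and Qc': "Q' \<in> carrier_mat m k" "Q'\<^sup>H * Q' = 1\<^sub>m k"
    and W: "vec_space.col_space m Q = vec_space.col_space m Q'"
    using Q Q' by (auto simp: orthonormal_frame_def)
  define T where "T = Q'\<^sup>H * Q"
  have T: "T \<in> carrier_mat k k" using Qc Qc' by (auto simp: T_def)
  have "Q = Q' * T"
  proof (rule eq_matI)
    fix i j assume "i < dim_row (Q' * T)" "j < dim_col (Q' * T)"
    then have ij: "i < m" "j < k" using Qc' T by auto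
    have "col Q j = Q *\<^sub>v unit_vec k j" using Qc(1) ij(2) by (intro eq_vecI) auto
    then have "col Q j \<in> vec_space.col_space m Q"
      using vec_space.col_space_eq[OF Qc(1)] Qc ij by auto
    then obtain y where y: "y \<in> carrier_vec k" "Q' *\<^sub>v y = col Q j"
      unfolding W using vec_space.col_space_eq[OF Qc'(1)] Qc' by auto
    have "col T j = Q'\<^sup>H *\<^sub>v col Q j" unfolding T_def using Qc Qc' ij by (intro col_mult2) auto
    also have "\<dots> = Q'\<^sup>H * Q' *\<^sub>v y" unfolding y(2)[symmetric] using Qc' y by (intro assoc_mult_mat_vec[symmetric]) auto
    also have "\<dots> = y" using Qc' y by simp
    finally have "col (Q' * T) j = col Q j" using y col_mult2[OF Qc'(1) T ij(2)] by simp
    then have "col (Q' * T) j $ i = col Q j $ i" by simp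
    then show "Q $$ (i, j) = (Q' * T) $$ (i, j)"
      using ij Qc Qc' T index_col[of i Q j] index_col[of i "Q' * T" j] by (simp del: index_mult_mat(1))
  qed (use Qc Qc' T in auto)
  moreover have "unitary_mat k T"
    using isometry_gram[OF Qc' T] Qc T \<open>Q = Q' * T\<close> by (simp add: unitary_mat_iff)
  ultimately show ?thesis using that by blast
qed

text \<open>
  Bessel's inequality: the left-hand side collects some of the coordinates of \<open>x\<close> in an
  orthonormal basis.
\<close>

lemma frobenius_norm_adjoint_mult_le:
  fixes Q :: "'a::rc_field mat"
  assumes Q: "Q \<in> carrier_mat m k" "Q\<^sup>H * Q = 1\<^sub>m k" and x: "x \<in> carrier_mat m 1"
  shows "frobenius_norm (Q\<^sup>H * x) \<le> frobenius_norm x"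
proof -
  obtain W where W: "unitary_mat m W" and WQ: "\<And>i j. i < m \<Longrightarrow> j < k \<Longrightarrow> W $$ (i, j) = Q $$ (i, j)"
    using orthonormal_columns_extend[OF Q] by blast
  note Wc = unitary_matD[OF W]
  have km: "k \<le> m" by (rule orthonormal_columns_le[OF Q])
  have Qx: "Q\<^sup>H * x \<in> carrier_mat k 1" and Wx: "W\<^sup>H * x \<in> carrier_mat m 1" using Q Wc x by auto
  have eq: "(Q\<^sup>H * x) $$ (i, 0) = (W\<^sup>H * x) $$ (i, 0)" if "i < k" for i
    using that km adjoint_mult_index[OF Q(1) x that, of 0] adjoint_mult_index[OF Wc(1) x, of i 0] WQ
    by (simp del: index_mult_mat(1))
  have "(frobenius_norm (Q\<^sup>H * x))\<^sup>2 = (\<Sum>i<k. (norm ((W\<^sup>H * x) $$ (i, 0)))\<^sup>2)"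
    unfolding frobenius_norm_sq_carrier[OF Qx] by (simp add: eq del: index_mult_mat(1))
  also have "\<dots> \<le> (\<Sum>i<m. (norm ((W\<^sup>H * x) $$ (i, 0)))\<^sup>2)"
    using km by (intro sum_mono2) auto
  also have "\<dots> = (frobenius_norm (W\<^sup>H * x))\<^sup>2"
    unfolding frobenius_norm_sq_carrier[OF Wx] by simp
  also have "frobenius_norm (W\<^sup>H * x) = frobenius_norm x"
    using Wc x by (intro frobenius_norm_isometry_left[of _ m m]) auto
  finally show ?thesis by (simp add: power2_le_iff_abs_le)
qed

lemma frobenius_norm_sv_mat:
  "(frobenius_norm (sv_mat k k s :: 'a::rc_field mat))\<^sup>2 = (\<Sum>i<k. (s i)\<^sup>2)"
proof -
  have "(frobenius_norm (sv_mat k k s :: 'a mat))\<^sup>2 = (\<Sum>i<k. \<Sum>j<k. if i = j then (s i)\<^sup>2 else 0)"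
    by (subst frobenius_norm_sq_carrier[OF mat_carrier], intro sum.cong refl) auto
  then show ?thesis by simp
qed

lemma frobenius_norm_svd:
  fixes A :: "'a::rc_field mat"
  assumes A: "A \<in> carrier_mat k k" "full_svd A U s V"
  shows "(frobenius_norm A)\<^sup>2 = (\<Sum>i<k. (s i)\<^sup>2)"
proof -
  note F = full_svdD[OF A]
  note Uc = unitary_matD[OF F(1)] and Vc = unitary_matD[OF F(2)]
  have "frobenius_norm A = frobenius_norm (sv_mat k k s :: 'a mat)"
    unfolding F(7) using frobenius_norm_isometry_right[OF Vc(1,2) mult_carrier_mat[OF Uc(1) mat_carrier]]
      frobenius_norm_isometry_left[OF Uc(1,2) mat_carrier] by simp
  then show ?thesis by (simp add: frobenius_norm_sv_mat)
qed

text \<open>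
  The cosines of the principal angles are in the range where the arc cosine inverts the cosine:
  \<open>s\<^sub>i\<close> is the norm of \<open>Q'\<^sup>H Q x\<close> for a unit vector
  \<open>x\<close>.
\<close>

lemma singular_value_frames_le_one:
  fixes Q Q' :: "'a::rc_field mat"
  assumes Q: "Q \<in> carrier_mat m k" "Q\<^sup>H * Q = 1\<^sub>m k" and Q': "Q' \<in> carrier_mat m k" "Q'\<^sup>H * Q' = 1\<^sub>m k"
    and F: "full_svd (Q\<^sup>H * Q') U s V" and i: "i < k"
  shows "s i \<le> 1"
proof -
  let ?M = "Q\<^sup>H * Q'"
  have M: "?M \<in> carrier_mat k k" using Q Q' by auto
  note D = full_svdD[OF M F]
  note Uc = unitary_matD[OF D(1)]
  define x where "x = select_columns U 1 (\<lambda>_. i)"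
  have x: "x \<in> carrier_mat k 1" using Uc by (simp add: x_def)
  have xx: "x\<^sup>H * x = 1\<^sub>m 1"
    unfolding x_def using i by (intro select_columns_orthonormal[OF Uc(1,2)]) (auto simp: inj_on_def)
  have Ux: "(U\<^sup>H * x) $$ (l, 0) = (if l = i then 1 else 0)" if "l < k" for l
    using mult_select_columns_index[of "U\<^sup>H" k k U k l 0 1 "\<lambda>_. i"] Uc that i
    by (simp add: x_def del: index_mult_mat(1))
  have "(\<Sum>l<k. (s l)\<^sup>2 * (norm ((U\<^sup>H * x) $$ (l, 0)))\<^sup>2) = (\<Sum>l<k. if l = i then (s l)\<^sup>2 else 0)"
    by (intro sum.cong refl) (simp add: Ux del: index_mult_mat(1))
  then have "(s i)\<^sup>2 = (\<Sum>l<k. (s l)\<^sup>2 * (norm ((U\<^sup>H * x) $$ (l, 0)))\<^sup>2)"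
    using i by simp
  also have "\<dots> = (frobenius_norm (?M\<^sup>H * x))\<^sup>2"
    using norm_adjoint_mult_svd[OF M F x] by simp
  also have "?M\<^sup>H * x = Q'\<^sup>H * (Q * x)"
    using adjoint_mult[of "Q\<^sup>H" k m Q' k] Q Q' x by (simp add: assoc_mult_mat[of "Q'\<^sup>H" k m Q k x 1])
  finally have "(s i)\<^sup>2 = (frobenius_norm (Q'\<^sup>H * (Q * x)))\<^sup>2" .
  also have "\<dots> \<le> 1"
  proof (rule power_le_one[OF frobenius_norm_nonneg])
    have "frobenius_norm (Q'\<^sup>H * (Q * x)) \<le> frobenius_norm (Q * x)"
      using Q(1) x by (intro frobenius_norm_adjoint_mult_le[OF Q']) auto
    also have "\<dots> = frobenius_norm x"
      by (rule frobenius_norm_isometry_left[OF Q x])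
    also have "(of_real ((frobenius_norm x)\<^sup>2) :: 'a) = of_real 1"
      using frobenius_gram[OF x] xx by simp
    then have "(frobenius_norm x)\<^sup>2 = 1" by (simp only: of_real_eq_iff)
    then have "frobenius_norm x = 1" using power2_eq_iff_nonneg[of "frobenius_norm x" 1] by simp
    finally show "frobenius_norm (Q'\<^sup>H * (Q * x)) \<le> 1" .
  qed
  finally show ?thesis using abs_le_square_iff[of "s i" 1] by simp
qed

text \<open>
  Only the sum of the squared cosines is computed, since it is the squared norm of \<open>Q\<^sup>H
  Q'\<close> and hence independent of the frames. That is enough for the chordal distance, and the
  other two distances are compared with it angle by angle.
\<close>

lemma principal_angles:
  fixes U U' :: "'a::rc_field mat"
  assumes U: "unitary_mat m U" and U': "unitary_mat m U'" and \<pi>: "\<pi> \<subseteq> {..<m}"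
  shows "\<exists>s :: nat \<Rightarrow> real. (\<forall>i. 0 \<le> s i) \<and> (\<forall>i<card \<pi>. s i \<le> 1) \<and>
    (\<forall>i. principal_angle m (card \<pi>) (cols_span U \<pi>) (cols_span U' \<pi>) i = arccos (s i)) \<and>
    (\<Sum>i<card \<pi>. (s i)\<^sup>2) = (\<Sum>i\<in>\<pi>. \<Sum>j\<in>\<pi>. (norm ((U\<^sup>H * U') $$ (i, j)))\<^sup>2)"
proof -
  let ?k = "card \<pi>"
  note Uc = unitary_matD[OF U] and Uc' = unitary_matD[OF U']
  obtain f where f: "bij_betw f {..<?k} \<pi>"
    using ex_bij_betw_nat_finite[OF finite_subset[OF \<pi> finite_lessThan]] by (auto simp: atLeast0LessThan)
  have fm: "f j < m" if "j < ?k" for j using f that \<pi> by (auto simp: bij_betw_def)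
  define P where "P = select_columns U ?k f"
  define P' where "P' = select_columns U' ?k f"
  have P: "orthonormal_frame m ?k (cols_span U \<pi>) P" and P': "orthonormal_frame m ?k (cols_span U' \<pi>) P'"
    unfolding P_def P'_def using orthonormal_frame_select_columns[OF _ f \<pi>] U U' by auto
  define Q where "Q = (SOME Q. orthonormal_frame m ?k (cols_span U \<pi>) Q)"
  define Q' where "Q' = (SOME Q. orthonormal_frame m ?k (cols_span U' \<pi>) Q)"
  have Q: "orthonormal_frame m ?k (cols_span U \<pi>) Q" and Q': "orthonormal_frame m ?k (cols_span U' \<pi>) Q'"
    unfolding Q_def Q'_def using P P' by (auto intro: someI)
  have c: "P \<in> carrier_mat m ?k" "P' \<in> carrier_mat m ?k" "Q \<in> carrier_mat m ?k" "Q' \<in> carrier_mat m ?k"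
    "Q\<^sup>H * Q = 1\<^sub>m ?k" "Q'\<^sup>H * Q' = 1\<^sub>m ?k"
    using P P' Q Q' by (auto simp: orthonormal_frame_def)
  obtain T where T: "unitary_mat ?k T" "Q = P * T" by (rule orthonormal_frames_related[OF Q P])
  obtain T' where T': "unitary_mat ?k T'" "Q' = P' * T'" by (rule orthonormal_frames_related[OF Q' P'])
  note Tc = unitary_matD[OF T(1)] and Tc' = unitary_matD[OF T'(1)]
  let ?M = "Q\<^sup>H * Q'" and ?N = "P\<^sup>H * P'"
  have M: "?M \<in> carrier_mat ?k ?k" and N: "?N \<in> carrier_mat ?k ?k" using c by auto
  have "Q\<^sup>H = T\<^sup>H * P\<^sup>H" unfolding T(2) by (rule adjoint_mult[OF c(1) Tc(1)])
  then have "?M = T\<^sup>H * (P\<^sup>H * (P' * T'))"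
    using c Tc Tc' by (simp add: T'(2) assoc_mult_mat[of "T\<^sup>H" ?k ?k "P\<^sup>H" m "P' * T'" ?k])
  also have "P\<^sup>H * (P' * T') = ?N * T'"
    using c Tc' by (intro assoc_mult_mat[symmetric]) auto
  finally have "?M = T\<^sup>H * (?N * T')" .
  then have "frobenius_norm ?M = frobenius_norm (?N * T')"
    using Tc Tc' N by (simp add: frobenius_norm_isometry_left[of "T\<^sup>H" ?k ?k "?N * T'" ?k])
  also have "\<dots> = frobenius_norm ?N"
    using frobenius_norm_isometry_right[of "T'\<^sup>H" ?k ?k ?N ?k] Tc' N by simp
  finally have MN: "(frobenius_norm ?M)\<^sup>2 = (frobenius_norm ?N)\<^sup>2" by simp
  have N_index: "?N $$ (i, j) = (U\<^sup>H * U') $$ (f i, f j)" if "i < ?k" "j < ?k" for i j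
    using adjoint_select_columns_mult_index[of U m m P' ?k i ?k f j]
      mult_select_columns_index[of "U\<^sup>H" m m U' m "f i" j ?k f] that Uc Uc' fm c
    by (simp add: P_def P'_def del: index_mult_mat(1))
  have "(frobenius_norm ?N)\<^sup>2 = (\<Sum>i<?k. \<Sum>j<?k. (norm ((U\<^sup>H * U') $$ (f i, f j)))\<^sup>2)"
    unfolding frobenius_norm_sq_carrier[OF N] by (simp add: N_index del: index_mult_mat(1))
  also have "\<dots> = (\<Sum>i<?k. \<Sum>j\<in>\<pi>. (norm ((U\<^sup>H * U') $$ (f i, j)))\<^sup>2)"
    by (intro sum.cong refl sum.reindex_bij_betw[OF f])
  also have "\<dots> = (\<Sum>i\<in>\<pi>. \<Sum>j\<in>\<pi>. (norm ((U\<^sup>H * U') $$ (i, j)))\<^sup>2)"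
    by (rule sum.reindex_bij_betw[OF f])
  finally have N_sum: "(frobenius_norm ?N)\<^sup>2 = \<dots>" .
  obtain X s Y where F: "full_svd ?M X s Y" using svd_exists[OF M] by blast
  show ?thesis
  proof (intro exI conjI allI impI)
    show "0 \<le> s i" for i by (rule full_svdD(4)[OF M F])
    show "s i \<le> 1" if "i < ?k" for i by (rule singular_value_frames_le_one[OF c(3,5,4,6) F that])
    show "principal_angle m ?k (cols_span U \<pi>) (cols_span U' \<pi>) i = arccos (s i)" for i
      unfolding principal_angle_def Let_def Q_def[symmetric] Q'_def[symmetric] singular_value_eq[OF M F] ..
    show "(\<Sum>i<?k. (s i)\<^sup>2) = (\<Sum>i\<in>\<pi>. \<Sum>j\<in>\<pi>. (norm ((U\<^sup>H * U') $$ (i, j)))\<^sup>2)"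
      using frobenius_norm_svd[OF M F] MN N_sum by simp
  qed
qed

lemma unitary_column_norm:
  fixes X :: "'a::rc_field mat"
  assumes X: "unitary_mat m X" and j: "j < m"
  shows "(\<Sum>i<m. (norm (X $$ (i, j)))\<^sup>2) = 1"
proof -
  note Xc = unitary_matD[OF X]
  have "(of_real (\<Sum>i<m. (norm (X $$ (i, j)))\<^sup>2) :: 'a) = (X\<^sup>H * X) $$ (j, j)"
    using adjoint_mult_index[OF Xc(1,1) j j] by (simp only: conjugate_mult_self of_real_sum)
  also have "\<dots> = of_real 1" using Xc j by simp
  finally show ?thesis by (simp only: of_real_eq_iff)
qed

lemma unitary_adjoint_mult:
  fixes U U' :: "'a::rc_field mat"
  assumes U: "unitary_mat m U" and U': "unitary_mat m U'"
  shows "unitary_mat m (U\<^sup>H * U')"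
proof -
  note Uc = unitary_matD[OF U] and Uc' = unitary_matD[OF U']
  have "(U\<^sup>H * U')\<^sup>H * (U\<^sup>H * U') = 1\<^sub>m m"
    using isometry_gram[of "U\<^sup>H" m m U' m] Uc Uc' by simp
  then show ?thesis using Uc Uc' by (auto simp: unitary_mat_iff)
qed

text \<open>
  The squared sines add up to \<open>k\<close> minus the squared norm of the block of
  \<open>U\<^sup>H U'\<close> with rows and columns in \<open>\<pi>\<close>. The \<open>k\<close>
  columns with index in \<open>\<pi>\<close> have norm 1, so what remains is the block below.
\<close>

lemma chordal_dist_eq:
  fixes U U' :: "'a::rc_field mat"
  assumes U: "unitary_mat m U" and U': "unitary_mat m U'" and \<pi>: "\<pi> \<subseteq> {..<m}"
  shows "(chordal_dist m (card \<pi>) (cols_span U \<pi>) (cols_span U' \<pi>))\<^sup>2 =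
           (\<Sum>i\<in>{..<m} - \<pi>. \<Sum>j\<in>\<pi>. (norm ((U\<^sup>H * U') $$ (i, j)))\<^sup>2)"
proof -
  let ?n = "\<lambda>i j. (norm ((U\<^sup>H * U') $$ (i, j)))\<^sup>2"
  obtain s where s: "\<And>i. 0 \<le> s i" "\<And>i. i < card \<pi> \<Longrightarrow> s i \<le> 1"
    "\<And>i. principal_angle m (card \<pi>) (cols_span U \<pi>) (cols_span U' \<pi>) i = arccos (s i)"
    "(\<Sum>i<card \<pi>. (s i)\<^sup>2) = (\<Sum>i\<in>\<pi>. \<Sum>j\<in>\<pi>. ?n i j)"
    using principal_angles[OF assms] by metis
  have "(chordal_dist m (card \<pi>) (cols_span U \<pi>) (cols_span U' \<pi>))\<^sup>2 = (\<Sum>i<card \<pi>. (sin (arccos (s i)))\<^sup>2)"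
    unfolding chordal_dist_def s(3) by (intro real_sqrt_pow2 sum_nonneg) auto
  also have "\<dots> = (\<Sum>i<card \<pi>. 1 - (s i)\<^sup>2)"
  proof (rule sum.cong)
    fix i assume i: "i \<in> {..<card \<pi>}"
    then have "-1 \<le> s i" "s i \<le> 1" using s(1,2)[of i] by auto
    then show "(sin (arccos (s i)))\<^sup>2 = 1 - (s i)\<^sup>2" by (simp add: sin_squared_eq)
  qed simp
  also have "\<dots> = (\<Sum>j\<in>\<pi>. 1) - (\<Sum>i\<in>\<pi>. \<Sum>j\<in>\<pi>. ?n i j)" by (simp add: sum_subtractf s(4) del: index_mult_mat(1))
  also have "(\<Sum>j\<in>\<pi>. 1) = (\<Sum>j\<in>\<pi>. \<Sum>i<m. ?n i j)"
    using unitary_column_norm[OF unitary_adjoint_mult[OF U U']] \<pi> by (intro sum.cong) auto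
  also have "\<dots> = (\<Sum>i<m. \<Sum>j\<in>\<pi>. ?n i j)" by (rule sum.swap)
  also have "\<dots> = (\<Sum>i\<in>{..<m} - \<pi>. \<Sum>j\<in>\<pi>. ?n i j) + (\<Sum>i\<in>\<pi>. \<Sum>j\<in>\<pi>. ?n i j)"
    by (rule sum.subset_diff[OF \<pi> finite_lessThan])
  finally show ?thesis by (simp del: index_mult_mat(1))
qed

text \<open>
  Angle by angle, \<open>sin \<theta> \<le> 2 sin (\<theta> / 2) \<le> \<theta>\<close> on the
  interval from 0 to \<open>pi / 2\<close>.
\<close>

lemma chordal_le_procrustes_le_grassmann:
  fixes U U' :: "'a::rc_field mat"
  assumes "unitary_mat m U" "unitary_mat m U'" "\<pi> \<subseteq> {..<m}"
  defines "W \<equiv> cols_span U \<pi>" and "W' \<equiv> cols_span U' \<pi>" and "k \<equiv> card \<pi>"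
  shows "chordal_dist m k W W' \<le> procrustes_dist m k W W'"
    "procrustes_dist m k W W' \<le> grassmann_dist m k W W'"
proof -
  obtain s where s: "\<And>i. 0 \<le> s i" "\<And>i. i < k \<Longrightarrow> s i \<le> 1"
    "\<And>i. principal_angle m k W W' i = arccos (s i)"
    unfolding W_def W'_def k_def using principal_angles[OF assms(1-3)] by metis
  have \<theta>: "0 \<le> arccos (s i)" "arccos (s i) \<le> pi / 2" if "i < k" for i
    using s(1,2)[of i] that arccos_lbound[of "s i"] arccos_le_pi2[of "s i"] by auto
  have half: "0 \<le> sin (t / 2)" "sin (t / 2) \<le> t / 2" "0 \<le> sin t" "sin t \<le> 2 * sin (t / 2)" if "0 \<le> t" "t \<le> pi / 2" for t
  proof -
    show 0: "0 \<le> sin (t / 2)" "0 \<le> sin t" using that by (auto intro!: sin_ge_zero)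
    show "sin (t / 2) \<le> t / 2" using that by (intro sin_x_le_x) auto
    have "sin t = 2 * sin (t / 2) * cos (t / 2)" using sin_double[of "t / 2"] by simp
    also have "\<dots> \<le> 2 * sin (t / 2) * 1" using 0 by (intro mult_left_mono) auto
    finally show "sin t \<le> 2 * sin (t / 2)" by simp
  qed
  show "chordal_dist m k W W' \<le> procrustes_dist m k W W'"
    unfolding chordal_dist_def procrustes_dist_def s(3)
    using \<theta> half by (intro real_sqrt_le_mono sum_mono power_mono) auto
  have "2 * sin (arccos (s i) / 2) \<le> arccos (s i)" if "i < k" for i
    using half(2)[OF \<theta>[OF that]] by simp
  then show "procrustes_dist m k W W' \<le> grassmann_dist m k W W'"
    unfolding grassmann_dist_def procrustes_dist_def s(3)
    using \<theta> half(1) by (intro real_sqrt_le_mono sum_mono power_mono) auto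
qed

text \<open>
  The derivative of the arc sine at 0 is 1.
\<close>

lemma arcsin_le_near_zero:
  assumes "0 < (\<delta>::real)"
  obtains \<eta> where "0 < \<eta>" "\<eta> \<le> 1" "\<And>x. 0 \<le> x \<Longrightarrow> x \<le> \<eta> \<Longrightarrow> arcsin x \<le> (1 + \<delta>) * x"
proof -
  have "(arcsin has_real_derivative inverse (sqrt (1 - 0\<^sup>2))) (at 0)" by (rule DERIV_arcsin) auto
  then have "((\<lambda>x. arcsin x / x) \<longlongrightarrow> 1) (at 0)" by (simp add: has_field_derivative_iff)
  then have "\<forall>\<^sub>F x in at 0. dist (arcsin x / x) 1 < \<delta>" using assms by (rule tendstoD)
  then obtain d where d: "0 < d" "\<And>x. x \<noteq> 0 \<Longrightarrow> \<bar>x\<bar> < d \<Longrightarrow> \<bar>arcsin x / x - 1\<bar> < \<delta>"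
    by (auto simp: eventually_at dist_real_def)
  show ?thesis
  proof
    show "0 < min 1 (d / 2)" "min 1 (d / 2) \<le> 1" using d by auto
    fix x :: real assume x: "0 \<le> x" "x \<le> min 1 (d / 2)"
    show "arcsin x \<le> (1 + \<delta>) * x"
    proof (cases "x = 0")
      case False
      then have "arcsin x / x < 1 + \<delta>" using d(2)[of x] x d(1) by auto
      then show ?thesis using x False by (simp add: field_simps)
    qed simp
  qed
qed

text \<open>
  A small chordal distance bounds the sine of every principal angle. The radius
  \<open>\<eta>\<close> depends on \<open>\<delta>\<close> alone, so that the estimate can be used
  for all matrices near a given one.
\<close>

lemma grassmann_le_chordal:
  assumes "0 < (\<delta>::real)"
  obtains \<eta> where "0 < \<eta>"
    "\<And>m U U' \<pi>. unitary_mat m (U :: 'a::rc_field mat) \<Longrightarrow> unitary_mat m U' \<Longrightarrow> \<pi> \<subseteq> {..<m} \<Longrightarrow>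
        chordal_dist m (card \<pi>) (cols_span U \<pi>) (cols_span U' \<pi>) \<le> \<eta> \<Longrightarrow>
        grassmann_dist m (card \<pi>) (cols_span U \<pi>) (cols_span U' \<pi>)
          \<le> (1 + \<delta>) * chordal_dist m (card \<pi>) (cols_span U \<pi>) (cols_span U' \<pi>)"
proof -
  obtain \<eta> where \<eta>: "0 < \<eta>" "\<eta> \<le> 1" "\<And>x. 0 \<le> x \<Longrightarrow> x \<le> \<eta> \<Longrightarrow> arcsin x \<le> (1 + \<delta>) * x"
    using arcsin_le_near_zero[OF assms] by blast
  show ?thesis
  proof (rule that[OF \<eta>(1)])
    fix m \<pi> and U U' :: "'a mat"
    let ?W = "cols_span U \<pi>" and ?W' = "cols_span U' \<pi>" and ?k = "card \<pi>"
    assume U: "unitary_mat m U" "unitary_mat m U'" "\<pi> \<subseteq> {..<m}" and c: "chordal_dist m ?k ?W ?W' \<le> \<eta>"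
    obtain s where s: "\<And>i. 0 \<le> s i" "\<And>i. i < ?k \<Longrightarrow> s i \<le> 1" "\<And>i. principal_angle m ?k ?W ?W' i = arccos (s i)"
      using principal_angles[OF U] by metis
    have "grassmann_dist m ?k ?W ?W' \<le> sqrt (\<Sum>i<?k. ((1 + \<delta>) * sin (principal_angle m ?k ?W ?W' i))\<^sup>2)"
      unfolding grassmann_dist_def
    proof (intro real_sqrt_le_mono sum_mono)
      fix i assume i: "i \<in> {..<?k}"
      let ?t = "principal_angle m ?k ?W ?W' i"
      have t: "0 \<le> ?t" "?t \<le> pi / 2"
        using s(1,2)[of i] i arccos_lbound[of "s i"] arccos_le_pi2[of "s i"] by (auto simp: s(3))
      have "(sin ?t)\<^sup>2 \<le> (\<Sum>i<?k. (sin (principal_angle m ?k ?W ?W' i))\<^sup>2)"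
        using i by (intro member_le_sum) auto
      then have "sqrt ((sin ?t)\<^sup>2) \<le> chordal_dist m ?k ?W ?W'"
        unfolding chordal_dist_def by (rule real_sqrt_le_mono)
      then have "\<bar>sin ?t\<bar> \<le> \<eta>" using c by simp
      moreover have "0 \<le> sin ?t" using t by (intro sin_ge_zero) auto
      ultimately have "arcsin (sin ?t) \<le> (1 + \<delta>) * sin ?t" by (intro \<eta>(3)) auto
      then have "?t \<le> (1 + \<delta>) * sin ?t" using t by (simp add: arcsin_sin)
      then show "?t\<^sup>2 \<le> ((1 + \<delta>) * sin ?t)\<^sup>2" using t by (intro power_mono) auto
    qed
    also have "\<dots> = (1 + \<delta>) * chordal_dist m ?k ?W ?W'"
      unfolding chordal_dist_def using assms
      by (simp add: power_mult_distrib sum_distrib_left[symmetric] real_sqrt_mult)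
    finally show "grassmann_dist m ?k ?W ?W' \<le> (1 + \<delta>) * chordal_dist m ?k ?W ?W'" .
  qed
qed

section \<open>The upper bound\<close>

lemma svd_adjoint:
  fixes U V :: "'a::rc_field mat"
  assumes "unitary_mat m U" "unitary_mat n V" "A = U * sv_mat m n \<sigma> * V\<^sup>H"
  shows "A\<^sup>H = V * sv_mat n m \<sigma> * U\<^sup>H"
proof -
  note U = unitary_matD[OF assms(1)] and V = unitary_matD[OF assms(2)]
  have "A\<^sup>H = V * (sv_mat n m \<sigma> * U\<^sup>H)"
    unfolding assms(3) using adjoint_mult[OF mult_carrier_mat[OF U(1) mat_carrier] adjoint_carrier[OF V(1)]]
      adjoint_mult[OF U(1) mat_carrier] by (simp add: adjoint_sv_mat)
  then show ?thesis using U V by (simp add: assoc_mult_mat[of V n n "sv_mat n m \<sigma>" m "U\<^sup>H" m])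
qed

text \<open>
  The conditions \<open>i < n\<close> and \<open>j < m\<close> record that the matrix of singular
  values is rectangular. The statement covers \<open>F\<close>, and, applied to the adjoint
  matrices, also \<open>G\<close>.
\<close>

lemma svd_difference_index:
  fixes U V U' V' :: "'a::rc_field mat"
  assumes U: "unitary_mat m U" and V: "unitary_mat n V" and U': "unitary_mat m U'" and V': "unitary_mat n V'"
    and A: "A = U * sv_mat m n \<sigma> * V\<^sup>H" and B: "B = U' * sv_mat m n \<tau> * V'\<^sup>H"
    and ij: "i < m" "j < n"
  shows "(U\<^sup>H * (A - B) * V') $$ (i, j) =
           (if i < n then of_real (\<sigma> i) * (V\<^sup>H * V') $$ (i, j) else 0)
           - (if j < m then (U\<^sup>H * U') $$ (i, j) * of_real (\<tau> j) else 0)"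
proof -
  note Uc = unitary_matD[OF U] and Vc = unitary_matD[OF V] and Uc' = unitary_matD[OF U'] and Vc' = unitary_matD[OF V']
  let ?S = "sv_mat m n \<sigma> :: 'a mat" and ?T = "sv_mat m n \<tau> :: 'a mat"
  have Ac: "A \<in> carrier_mat m n"
    unfolding A by (intro mult_carrier_mat[OF mult_carrier_mat[OF Uc(1) mat_carrier]] adjoint_carrier Vc)
  have Bc: "B \<in> carrier_mat m n"
    unfolding B by (intro mult_carrier_mat[OF mult_carrier_mat[OF Uc'(1) mat_carrier]] adjoint_carrier Vc')
  have UH: "U\<^sup>H \<in> carrier_mat m m" and VV: "V\<^sup>H * V' \<in> carrier_mat n n" and UU: "U\<^sup>H * U' \<in> carrier_mat m m"
    using Uc Vc Uc' Vc' by auto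
  have UA: "U\<^sup>H * A \<in> carrier_mat m n" and UB: "U\<^sup>H * B \<in> carrier_mat m n" using UH Ac Bc by auto
  have "U\<^sup>H * A * V' = ?S * V\<^sup>H * V'" unfolding svd_mult_right(2)[OF U V A] ..
  also have "\<dots> = ?S * (V\<^sup>H * V')" using Vc Vc' by (intro assoc_mult_mat) auto
  finally have 1: "U\<^sup>H * A * V' = ?S * (V\<^sup>H * V')" .
  have "U\<^sup>H * B * V' = U\<^sup>H * (B * V')" using UH Bc Vc' by (intro assoc_mult_mat) auto
  also have "\<dots> = U\<^sup>H * U' * ?T"
    unfolding svd_mult_right(1)[OF U' V' B] using UH Uc' by (intro assoc_mult_mat[symmetric]) auto
  finally have 2: "U\<^sup>H * B * V' = U\<^sup>H * U' * ?T" .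
  have "U\<^sup>H * (A - B) * V' = ?S * (V\<^sup>H * V') - U\<^sup>H * U' * ?T"
    unfolding mult_minus_distrib_mat[OF UH Ac Bc] minus_mult_distrib_mat[OF UA UB Vc'(1)] 1 2 ..
  also have "\<dots> $$ (i, j) = (?S * (V\<^sup>H * V')) $$ (i, j) - (U\<^sup>H * U' * ?T) $$ (i, j)"
    using ij VV UU by (intro index_minus_mat) auto
  finally show ?thesis
    unfolding sv_mat_mult_index[OF VV ij] mult_sv_mat_index[OF UU ij] .
qed

text \<open>
  The combination is chosen so that the entry of \<open>V\<^sup>H V'\<close> cancels. For indices
  beyond \<open>n\<close>, entries of \<open>F\<close> and \<open>G\<close> are read as 0; the
  corresponding singular values vanish, so the identity persists.
\<close>

lemma svd_coupling:
  fixes A B :: "'a::rc_field mat"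
  assumes A: "A \<in> carrier_mat m n" "full_svd A U \<sigma> V" and B: "B \<in> carrier_mat m n" "full_svd B U' \<tau> V'"
    and ij: "i < m" "j < m"
  defines "F \<equiv> U\<^sup>H * (A - B) * V'" and "G \<equiv> V\<^sup>H * (A - B)\<^sup>H * U'"
  shows "of_real (\<tau> j) * (if j < n then F $$ (i, j) else 0) + of_real (\<sigma> i) * (if i < n then G $$ (i, j) else 0)
           = of_real ((\<sigma> i)\<^sup>2 - (\<tau> j)\<^sup>2) * (U\<^sup>H * U') $$ (i, j)"
proof -
  note D = full_svdD[OF A] and D' = full_svdD[OF B]
  have F: "F $$ (i, j) = (if i < n then of_real (\<sigma> i) * (V\<^sup>H * V') $$ (i, j) else 0) - (U\<^sup>H * U') $$ (i, j) * of_real (\<tau> j)"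
    if "j < n"
    unfolding F_def svd_difference_index[OF D(1,2) D'(1,2) D(7) D'(7) ij(1) that] using ij by simp
  have G: "G $$ (i, j) = of_real (\<sigma> i) * (U\<^sup>H * U') $$ (i, j) - (if j < n then (V\<^sup>H * V') $$ (i, j) * of_real (\<tau> j) else 0)"
    if "i < n"
    unfolding G_def adjoint_minus[OF A(1) B(1)]
      svd_difference_index[OF D(2,1) D'(2,1) svd_adjoint[OF D(1,2,7)] svd_adjoint[OF D'(1,2,7)] that ij(2)]
    using ij by simp
  show ?thesis
    by (cases "i < n"; cases "j < n")
      (simp_all only: F G if_True if_False,
       simp_all add: D(6) D'(6) power2_eq_square algebra_simps del: index_mult_mat(1))
qed

text \<open>
  All rows and all columns of \<open>X\<close> have norm 1, so the rows and the columns with index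
  in \<open>\<pi>\<close> have the same total; subtract the block that they share.
\<close>

lemma off_diagonal_blocks_norm:
  fixes X :: "'a::rc_field mat"
  assumes X: "unitary_mat m X" and \<pi>: "\<pi> \<subseteq> {..<m}"
  shows "(\<Sum>i\<in>{..<m} - \<pi>. \<Sum>j\<in>\<pi>. (norm (X $$ (i, j)))\<^sup>2) = (\<Sum>i\<in>\<pi>. \<Sum>j\<in>{..<m} - \<pi>. (norm (X $$ (i, j)))\<^sup>2)"
proof -
  let ?n = "\<lambda>i j. (norm (X $$ (i, j)))\<^sup>2"
  note Xc = unitary_matD[OF X]
  have XH: "unitary_mat m X\<^sup>H" using Xc by (simp add: unitary_mat_iff)
  have row: "(\<Sum>j<m. ?n i j) = 1" if "i < m" for i
    using unitary_column_norm[OF XH that] Xc that by simp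
  have col: "(\<Sum>i<m. ?n i j) = 1" if "j < m" for j by (rule unitary_column_norm[OF X that])
  have "(\<Sum>i\<in>\<pi>. \<Sum>j<m. ?n i j) = (\<Sum>j\<in>\<pi>. \<Sum>i<m. ?n i j)"
    using row col \<pi> by (simp add: subset_eq)
  also have "\<dots> = (\<Sum>i<m. \<Sum>j\<in>\<pi>. ?n i j)" by (rule sum.swap)
  also have "\<dots> = (\<Sum>i\<in>{..<m} - \<pi>. \<Sum>j\<in>\<pi>. ?n i j) + (\<Sum>i\<in>\<pi>. \<Sum>j\<in>\<pi>. ?n i j)"
    by (rule sum.subset_diff[OF \<pi> finite_lessThan])
  also have "(\<Sum>i\<in>\<pi>. \<Sum>j<m. ?n i j) = (\<Sum>i\<in>\<pi>. (\<Sum>j\<in>{..<m} - \<pi>. ?n i j) + (\<Sum>j\<in>\<pi>. ?n i j))"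
    by (intro sum.cong refl sum.subset_diff[OF \<pi> finite_lessThan])
  finally show ?thesis by (simp add: sum.distrib)
qed

lemma two_term_cauchy_schwarz: "(t * a + s * b)\<^sup>2 \<le> (s\<^sup>2 + t\<^sup>2) * (a\<^sup>2 + b\<^sup>2)" for a b s t :: real
proof -
  have "(s\<^sup>2 + t\<^sup>2) * (a\<^sup>2 + b\<^sup>2) - (t * a + s * b)\<^sup>2 = (s * a - t * b)\<^sup>2"
    by (simp add: power2_eq_square algebra_simps)
  then show ?thesis using zero_le_power2[of "s * a - t * b"] by linarith
qed

text \<open>
  The sharp constant comes from adding the estimates over both off-diagonal blocks. Together they
  are disjoint parts of \<open>F\<close> and of \<open>G\<close>, each of which has the norm of
  \<open>A - B\<close>, and twice the squared distance stands on the other side. The gap is assumed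
  for both blocks, and strictly, which rules out \<open>\<sigma>\<^sub>i = \<tau>\<^sub>j\<close>.
\<close>

lemma chordal_dist_svd_le:
  fixes A B :: "'a::rc_field mat"
  assumes A: "A \<in> carrier_mat m n" "full_svd A U \<sigma> V" and B: "B \<in> carrier_mat m n" "full_svd B U' \<tau> V'"
    and \<pi>: "\<pi> \<subseteq> {..<m}" and K: "0 \<le> K"
    and gap: "\<And>i j. i < m \<Longrightarrow> j < m \<Longrightarrow> (i \<in> \<pi> \<longleftrightarrow> j \<notin> \<pi>) \<Longrightarrow> (\<sigma> i)\<^sup>2 + (\<tau> j)\<^sup>2 < K\<^sup>2 * ((\<sigma> i)\<^sup>2 - (\<tau> j)\<^sup>2)\<^sup>2"
  shows "chordal_dist m (card \<pi>) (cols_span U \<pi>) (cols_span U' \<pi>) \<le> K * frobenius_dist A B"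
proof -
  note D = full_svdD[OF A] and D' = full_svdD[OF B]
  note Uc = unitary_matD[OF D(1)] and Vc = unitary_matD[OF D(2)]
  note Uc' = unitary_matD[OF D'(1)] and Vc' = unitary_matD[OF D'(2)]
  define X where "X = U\<^sup>H * U'"
  have X: "unitary_mat m X" unfolding X_def by (rule unitary_adjoint_mult[OF D(1) D'(1)])
  let ?E = "A - B"
  have E: "?E \<in> carrier_mat m n" using B by auto
  define F where "F = U\<^sup>H * ?E * V'"
  define G where "G = V\<^sup>H * ?E\<^sup>H * U'"
  have UE: "U\<^sup>H * ?E \<in> carrier_mat m n" and VE: "V\<^sup>H * ?E\<^sup>H \<in> carrier_mat n m"
    using mult_carrier_mat[OF adjoint_carrier[OF Uc(1)] E]
      mult_carrier_mat[OF adjoint_carrier[OF Vc(1)] adjoint_carrier[OF E]] .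
  have F: "F \<in> carrier_mat m n" and G: "G \<in> carrier_mat n m"
    unfolding F_def G_def using mult_carrier_mat[OF UE Vc'(1)] mult_carrier_mat[OF VE Uc'(1)] .
  have "frobenius_norm F = frobenius_norm (U\<^sup>H * ?E)"
    unfolding F_def using frobenius_norm_isometry_right[OF _ _ UE, of "V'\<^sup>H" n] Vc' by simp
  also have "\<dots> = frobenius_norm ?E"
    using Uc E by (intro frobenius_norm_isometry_left[of _ m m]) auto
  finally have F_norm: "frobenius_norm F = frobenius_norm ?E" .
  have "frobenius_norm G = frobenius_norm (V\<^sup>H * ?E\<^sup>H)"
    unfolding G_def using frobenius_norm_isometry_right[OF _ _ VE, of "U'\<^sup>H" m] Uc' by simp
  also have "\<dots> = frobenius_norm ?E\<^sup>H"
    using Vc E by (intro frobenius_norm_isometry_left[of _ n n]) auto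
  finally have G_norm: "frobenius_norm G = frobenius_norm ?E" by simp
  define f where "f i j = (if j < n then (norm (F $$ (i, j)))\<^sup>2 else 0)" for i j
  define g where "g i j = (if i < n then (norm (G $$ (i, j)))\<^sup>2 else 0)" for i j
  have fg0: "0 \<le> f i j" "0 \<le> g i j" for i j by (auto simp: f_def g_def)
  have entry: "(norm (X $$ (i, j)))\<^sup>2 \<le> K\<^sup>2 * (f i j + g i j)"
    if ij: "i < m" "j < m" "i \<in> \<pi> \<longleftrightarrow> j \<notin> \<pi>" for i j
  proof -
    let ?a = "if j < n then norm (F $$ (i, j)) else 0" and ?b = "if i < n then norm (G $$ (i, j)) else 0"
    let ?d = "((\<sigma> i)\<^sup>2 - (\<tau> j)\<^sup>2)\<^sup>2"
    have fa: "f i j = ?a\<^sup>2" "g i j = ?b\<^sup>2" by (auto simp: f_def g_def)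
    have d: "0 < ?d"
    proof (rule ccontr)
      assume "\<not> 0 < ?d"
      then have "?d = 0" by simp
      then have "K\<^sup>2 * ?d = 0" by (simp only: mult_zero_right)
      then show False using gap[OF ij] zero_le_power2[of "\<sigma> i"] zero_le_power2[of "\<tau> j"] by linarith
    qed
    have "norm (of_real ((\<sigma> i)\<^sup>2 - (\<tau> j)\<^sup>2) * X $$ (i, j))
        \<le> norm (of_real (\<tau> j) * (if j < n then F $$ (i, j) else 0)) + norm (of_real (\<sigma> i) * (if i < n then G $$ (i, j) else 0))"
      unfolding X_def svd_coupling[OF A B ij(1,2), symmetric] F_def G_def by (rule norm_triangle_ineq)
    also have "\<dots> = \<tau> j * ?a + \<sigma> i * ?b"
      using D(4)[of i] D'(4)[of j] by (simp add: norm_mult)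
    finally have "\<bar>(\<sigma> i)\<^sup>2 - (\<tau> j)\<^sup>2\<bar> * norm (X $$ (i, j)) \<le> \<tau> j * ?a + \<sigma> i * ?b"
      by (simp only: norm_mult norm_of_real)
    then have "(\<bar>(\<sigma> i)\<^sup>2 - (\<tau> j)\<^sup>2\<bar> * norm (X $$ (i, j)))\<^sup>2 \<le> (\<tau> j * ?a + \<sigma> i * ?b)\<^sup>2"
      by (intro power_mono) auto
    then have "?d * (norm (X $$ (i, j)))\<^sup>2 \<le> (\<tau> j * ?a + \<sigma> i * ?b)\<^sup>2"
      by (simp only: power_mult_distrib power2_abs)
    also have "\<dots> \<le> ((\<sigma> i)\<^sup>2 + (\<tau> j)\<^sup>2) * (?a\<^sup>2 + ?b\<^sup>2)"
      by (rule two_term_cauchy_schwarz)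
    also have "\<dots> \<le> (K\<^sup>2 * ?d) * (?a\<^sup>2 + ?b\<^sup>2)"
      using gap[OF ij] by (intro mult_right_mono) auto
    also have "\<dots> = ?d * (K\<^sup>2 * (f i j + g i j))" unfolding fa by (simp only: mult_ac)
    finally show ?thesis using d by (simp only: mult_le_cancel_left_pos)
  qed
  let ?S1 = "({..<m} - \<pi>) \<times> \<pi>" and ?S2 = "\<pi> \<times> ({..<m} - \<pi>)"
  let ?c = "chordal_dist m (card \<pi>) (cols_span U \<pi>) (cols_span U' \<pi>)"
  have fin: "finite \<pi>" using \<pi> finite_subset by blast
  have fsum: "(\<Sum>(i, j)\<in>{..<m} \<times> {..<m}. f i j) \<le> (frobenius_norm ?E)\<^sup>2"
  proof -
    have "(\<Sum>(i, j)\<in>{..<m} \<times> {..<m}. f i j) = (\<Sum>i<m. \<Sum>j<m. f i j)" by (simp add: sum.cartesian_product)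
    also have "\<dots> \<le> (\<Sum>i<m. \<Sum>j<n. (norm (F $$ (i, j)))\<^sup>2)"
    proof (rule sum_mono)
      fix i
      have "(\<Sum>j<m. f i j) = (\<Sum>j\<in>{..<m} \<inter> {..<n}. (norm (F $$ (i, j)))\<^sup>2)"
        by (rule sum.mono_neutral_cong_right) (auto simp: f_def)
      also have "\<dots> \<le> (\<Sum>j<n. (norm (F $$ (i, j)))\<^sup>2)" by (rule sum_mono2) auto
      finally show "(\<Sum>j<m. f i j) \<le> \<dots>" .
    qed
    finally show ?thesis by (simp add: frobenius_norm_sq_carrier[OF F, symmetric] F_norm)
  qed
  have gsum: "(\<Sum>(i, j)\<in>{..<m} \<times> {..<m}. g i j) \<le> (frobenius_norm ?E)\<^sup>2"
  proof -
    have "(\<Sum>(i, j)\<in>{..<m} \<times> {..<m}. g i j) = (\<Sum>i<m. \<Sum>j<m. g i j)" by (simp add: sum.cartesian_product)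
    also have "\<dots> = (\<Sum>i\<in>{..<m} \<inter> {..<n}. \<Sum>j<m. (norm (G $$ (i, j)))\<^sup>2)"
      by (rule sum.mono_neutral_cong_right) (auto simp: g_def)
    also have "\<dots> \<le> (\<Sum>i<n. \<Sum>j<m. (norm (G $$ (i, j)))\<^sup>2)" by (rule sum_mono2) (auto intro: sum_nonneg)
    finally show ?thesis by (simp add: frobenius_norm_sq_carrier[OF G, symmetric] G_norm)
  qed
  \<comment> \<open>The two blocks have equal norms and the chordal distance is the norm of the first.\<close>
  have "2 * ?c\<^sup>2 = (\<Sum>(i, j)\<in>?S1. (norm (X $$ (i, j)))\<^sup>2) + (\<Sum>(i, j)\<in>?S2. (norm (X $$ (i, j)))\<^sup>2)"
    unfolding chordal_dist_eq[OF D(1) D'(1) \<pi>] X_def[symmetric] sum.cartesian_product[symmetric]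
      off_diagonal_blocks_norm[OF X \<pi>, symmetric] by (rule mult_2)
  also have "\<dots> = (\<Sum>(i, j)\<in>?S1 \<union> ?S2. (norm (X $$ (i, j)))\<^sup>2)"
    using fin by (intro sum.union_disjoint[symmetric]) auto
  also have "\<dots> \<le> (\<Sum>(i, j)\<in>?S1 \<union> ?S2. K\<^sup>2 * (f i j + g i j))"
  proof (rule sum_mono)
    fix p assume "p \<in> ?S1 \<union> ?S2"
    then obtain i j where p: "p = (i, j)" "i < m" "j < m" "i \<in> \<pi> \<longleftrightarrow> j \<notin> \<pi>"
      using \<pi> by (cases p) (auto simp: subset_eq)
    show "(case p of (i, j) \<Rightarrow> (norm (X $$ (i, j)))\<^sup>2) \<le> (case p of (i, j) \<Rightarrow> K\<^sup>2 * (f i j + g i j))"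
      unfolding p(1) prod.case by (rule entry[OF p(2-4)])
  qed
  also have "\<dots> \<le> (\<Sum>(i, j)\<in>{..<m} \<times> {..<m}. K\<^sup>2 * (f i j + g i j))"
  proof (rule sum_mono2)
    show "?S1 \<union> ?S2 \<subseteq> {..<m} \<times> {..<m}" using \<pi> by auto
    show "0 \<le> (case p of (i, j) \<Rightarrow> K\<^sup>2 * (f i j + g i j))" for p
      using fg0 by (cases p) simp
  qed simp
  also have "\<dots> = K\<^sup>2 * ((\<Sum>(i, j)\<in>{..<m} \<times> {..<m}. f i j) + (\<Sum>(i, j)\<in>{..<m} \<times> {..<m}. g i j))"
    unfolding case_prod_unfold sum_distrib_left[symmetric] sum.distrib ..
  also have "\<dots> \<le> K\<^sup>2 * ((frobenius_norm ?E)\<^sup>2 + (frobenius_norm ?E)\<^sup>2)"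
    using fsum gsum by (intro mult_left_mono add_mono) auto
  finally have "?c\<^sup>2 \<le> (K * frobenius_dist A B)\<^sup>2"
    by (simp add: frobenius_dist_def power_mult_distrib)
  moreover have "0 \<le> K * frobenius_dist A B" using K by (simp add: frobenius_dist_def)
  ultimately show ?thesis by (rule power2_le_imp_le)
qed

section \<open>Rotating a pair of singular vectors\<close>

definition plane_rotation :: "nat \<Rightarrow> nat \<Rightarrow> nat \<Rightarrow> real \<Rightarrow> 'a::rc_field mat" where
  "plane_rotation d i j t = mat d d (\<lambda>(a, b).
     if a = b then if a = i \<or> a = j then of_real (cos t) else 1
     else if a = i \<and> b = j then - of_real (sin t)
     else if a = j \<and> b = i then of_real (sin t) else 0)"

lemma plane_rotation_carrier [simp]: "plane_rotation d i j t \<in> carrier_mat d d"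
  by (simp add: plane_rotation_def)

lemma plane_rotation_zero: "plane_rotation d i j 0 = (1\<^sub>m d :: 'a::rc_field mat)"
  by (rule eq_matI) (auto simp: plane_rotation_def)

lemma conjugate_uminus_of_real [simp]: "conjugate (- of_real r) = (- of_real r :: 'a::rc_field)"
  by (simp add: conjugate_neg)

lemma plane_rotation_adjoint:
  assumes "i \<noteq> j"
  shows "(plane_rotation d i j t)\<^sup>H = (plane_rotation d i j (- t) :: 'a::rc_field mat)"
  using assms by (intro eq_matI) (auto simp: plane_rotation_def)

text \<open>
  A rotation combines the rows \<open>i\<close> and \<open>j\<close> and leaves the others alone.
\<close>

lemma plane_rotation_mult_index:
  fixes B :: "'a::rc_field mat"
  assumes ij: "i < d" "j < d" "i \<noteq> j" and B: "B \<in> carrier_mat d p" and ab: "a < d" "b < p"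
  shows "(plane_rotation d i j t * B) $$ (a, b) =
    (if a = i then of_real (cos t) * B $$ (i, b) - of_real (sin t) * B $$ (j, b)
     else if a = j then of_real (sin t) * B $$ (i, b) + of_real (cos t) * B $$ (j, b) else B $$ (a, b))"
proof -
  let ?r = "\<lambda>l. (plane_rotation d i j t :: 'a mat) $$ (a, l) * B $$ (l, b)"
  have "(plane_rotation d i j t * B) $$ (a, b) = sum ?r {..<d}"
    by (rule mult_index_carrier[OF plane_rotation_carrier B ab])
  also have "\<dots> = sum ?r (if a = i \<or> a = j then {i, j} else {a})"
    using ij ab by (intro sum.mono_neutral_right) (auto simp: plane_rotation_def)
  also have "\<dots> = (if a = i then of_real (cos t) * B $$ (i, b) - of_real (sin t) * B $$ (j, b)
     else if a = j then of_real (sin t) * B $$ (i, b) + of_real (cos t) * B $$ (j, b) else B $$ (a, b))"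
    using ij ab by (auto simp: plane_rotation_def)
  finally show ?thesis .
qed

lemma plane_rotation_unitary:
  assumes "i < d" "j < d" "i \<noteq> j"
  shows "unitary_mat d (plane_rotation d i j t :: 'a::rc_field mat)"
proof -
  have cs: "of_real (cos t) * of_real (cos t) + of_real (sin t) * of_real (sin t) = (1::'a)"
    "of_real (sin t) * of_real (sin t) + of_real (cos t) * of_real (cos t) = (1::'a)"
    using sin_cos_squared_add[of t]
    by (simp_all add: power2_eq_square add.commute del: of_real_mult of_real_add flip: of_real_mult of_real_add)
  have "(plane_rotation d i j t)\<^sup>H * plane_rotation d i j t = (1\<^sub>m d :: 'a mat)"
  proof (rule eq_matI)
    fix a b assume "a < dim_row (1\<^sub>m d :: 'a mat)" "b < dim_col (1\<^sub>m d :: 'a mat)"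
    then have ab: "a < d" "b < d" by auto
    show "((plane_rotation d i j t)\<^sup>H * plane_rotation d i j t) $$ (a, b) = (1\<^sub>m d :: 'a mat) $$ (a, b)"
      unfolding plane_rotation_adjoint[OF assms(3)] plane_rotation_mult_index[OF assms plane_rotation_carrier ab]
      using assms ab cs by (auto simp: plane_rotation_def)
  qed (auto simp: carrier_matD[OF plane_rotation_carrier])
  then show ?thesis by (simp add: unitary_mat_iff)
qed

lemma unitary_mult:
  fixes U R :: "'a::rc_field mat"
  assumes "unitary_mat m U" "unitary_mat m R"
  shows "unitary_mat m (U * R)"
  using isometry_gram[of U m m R m] assms by (auto simp: unitary_mat_iff)

lemma unitary_one: "unitary_mat m (1\<^sub>m m :: 'a::rc_field mat)"
  by (simp add: unitary_mat_iff)

text \<open>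
  The sum of the squared entries of \<open>D S - R D\<close> for \<open>D = diag (x, y)\<close> and
  the rotations \<open>R\<close> and \<open>S\<close> of the plane by the angles \<open>t\<close>
  and \<open>u\<close>.
\<close>

definition rotation_cost :: "real \<Rightarrow> real \<Rightarrow> real \<Rightarrow> real \<Rightarrow> real" where
  "rotation_cost x y t u =
     (x\<^sup>2 + y\<^sup>2) * (cos u - cos t)\<^sup>2 + (y * sin t - x * sin u)\<^sup>2 + (y * sin u - x * sin t)\<^sup>2"

text \<open>
  The left singular vectors are rotated by \<open>t\<close>, the right ones by \<open>u\<close>, and
  the singular values are kept. If \<open>i\<close> or \<open>j\<close> is at least
  \<open>n\<close>, there is nothing to rotate on the right; the angle \<open>u = 0\<close> makes
  the right rotation the identity, and one singular value is 0, so the same formula bounds the cost.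
\<close>

lemma rotated_svd:
  fixes A :: "'a::rc_field mat"
  assumes A: "A \<in> carrier_mat m n" "full_svd A U \<sigma> V" and ij: "i < m" "j < m" "i \<noteq> j"
    and u: "i < n \<and> j < n \<or> u = 0"
  obtains B V' where "B \<in> carrier_mat m n" "full_svd B (U * plane_rotation m i j t) \<sigma> V'"
    "(frobenius_dist A B)\<^sup>2 \<le> rotation_cost (\<sigma> i) (\<sigma> j) t u"
proof -
  note D = full_svdD[OF A]
  note Uc = unitary_matD[OF D(1)] and Vc = unitary_matD[OF D(2)]
  let ?R = "plane_rotation m i j t :: 'a mat" and ?S = "plane_rotation n i j u :: 'a mat"
  have R: "unitary_mat m ?R" by (rule plane_rotation_unitary[OF ij])
  have S: "unitary_mat n ?S"
    using u plane_rotation_unitary[of i n j u] ij by (auto simp: plane_rotation_zero unitary_one)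
  define U' where "U' = U * ?R"
  define V' where "V' = V * ?S"
  have U': "unitary_mat m U'" and V': "unitary_mat n V'"
    unfolding U'_def V'_def using unitary_mult D(1,2) R S by auto
  note Uc' = unitary_matD[OF U'] and Vc' = unitary_matD[OF V']
  define B where "B = U' * sv_mat m n \<sigma> * V'\<^sup>H"
  have B: "B \<in> carrier_mat m n"
    unfolding B_def by (intro mult_carrier_mat[OF mult_carrier_mat[OF Uc'(1) mat_carrier]] adjoint_carrier Vc')
  have svd: "full_svd B U' \<sigma> V'"
    unfolding full_svd_iff[OF B] using U' V' B_def full_svd_iff[OF A(1), of U \<sigma> V] A(2) by blast
  have UU: "U\<^sup>H * U' = ?R"
    unfolding U'_def by (rule isometry_left_cancel[OF Uc(1,2) plane_rotation_carrier])
  have VV: "V\<^sup>H * V' = ?S"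
    unfolding V'_def by (rule isometry_left_cancel[OF Vc(1,2) plane_rotation_carrier])
  let ?E = "A - B"
  have E: "?E \<in> carrier_mat m n" using B by auto
  have UE: "U\<^sup>H * ?E \<in> carrier_mat m n" by (rule mult_carrier_mat[OF adjoint_carrier[OF Uc(1)] E])
  define F where "F = U\<^sup>H * ?E * V'"
  have F: "F \<in> carrier_mat m n" unfolding F_def by (rule mult_carrier_mat[OF UE Vc'(1)])
  have "frobenius_norm F = frobenius_norm (U\<^sup>H * ?E)"
    unfolding F_def using frobenius_norm_isometry_right[OF _ _ UE, of "V'\<^sup>H" n] Vc' by simp
  also have "\<dots> = frobenius_norm ?E"
    using Uc E by (intro frobenius_norm_isometry_left[of _ m m]) auto
  finally have F_norm: "frobenius_norm F = frobenius_norm ?E" .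
  define x where "x = \<sigma> i" define y where "y = \<sigma> j"
  define h where "h a b = (if a = i \<and> b = i then x * (cos u - cos t) else if a = j \<and> b = j then y * (cos u - cos t)
     else if a = i \<and> b = j then y * sin t - x * sin u
     else if a = j \<and> b = i then y * sin u - x * sin t else 0)" for a b
  \<comment> \<open>By \<open>svd_difference_index\<close>, \<open>F\<close> is \<open>\<Sigma> S - R \<Sigma>\<close>, which lives on the rows and columns \<open>i\<close> and \<open>j\<close>.\<close>
  have entry: "F $$ (a, b) = of_real (h a b)" if ab: "a < m" "b < n" for a b
  proof -
    have F_ab: "F $$ (a, b) = (if a < n then of_real (\<sigma> a) * ?S $$ (a, b) else 0) - (if b < m then ?R $$ (a, b) * of_real (\<sigma> b) else 0)"
      unfolding F_def svd_difference_index[OF D(1,2) U' V' D(7) B_def ab] UU VV ..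
    consider "a = i" "b = i" | "a = j" "b = j" | "a = i" "b = j" | "a = j" "b = i" | "a = b" "a \<noteq> i" "a \<noteq> j"
      | "a \<noteq> b" "\<not> (a = i \<and> b = j)" "\<not> (a = j \<and> b = i)" by blast
    then show ?thesis
    proof cases
      case 1
      then have "F $$ (a, b) = of_real (x * (cos u - cos t))"
        unfolding F_ab using ab by (simp add: plane_rotation_def x_def algebra_simps)
      moreover have "h a b = x * (cos u - cos t)" using 1 ij by (simp add: h_def)
      ultimately show ?thesis by simp
    next
      case 2
      then have "F $$ (a, b) = of_real (y * (cos u - cos t))"
        unfolding F_ab using ab by (simp add: plane_rotation_def y_def algebra_simps)
      moreover have "h a b = y * (cos u - cos t)" using 2 ij by (simp add: h_def)
      ultimately show ?thesis by simp
    next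
      case 3
      then have "F $$ (a, b) = of_real (y * sin t - x * sin u)"
        unfolding F_ab using ab ij D(6)[of i]
        by (cases "i < n") (simp_all add: plane_rotation_def x_def y_def algebra_simps)
      moreover have "h a b = y * sin t - x * sin u" using 3 ij by (simp add: h_def)
      ultimately show ?thesis by simp
    next
      case 4
      then have "F $$ (a, b) = of_real (y * sin u - x * sin t)"
        unfolding F_ab using ab ij D(6)[of j]
        by (cases "j < n") (simp_all add: plane_rotation_def x_def y_def algebra_simps)
      moreover have "h a b = y * sin u - x * sin t" using 4 ij by (simp add: h_def)
      ultimately show ?thesis by simp
    next
      case 5
      then have "F $$ (a, b) = 0" unfolding F_ab using ab by (simp add: plane_rotation_def)
      then show ?thesis using 5 by (simp add: h_def)
    next
      case 6
      then have "a < n \<Longrightarrow> ?S $$ (a, b) = 0" "b < m \<Longrightarrow> ?R $$ (a, b) = 0"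
        using ab by (auto simp: plane_rotation_def)
      then have "F $$ (a, b) = 0" unfolding F_ab by simp
      then show ?thesis using 6 by (auto simp: h_def)
    qed
  qed
  let ?T = "{(i, i), (j, j), (i, j), (j, i)}"
  have h_outside: "h a b = 0" if "(a, b) \<notin> ?T" for a b
  proof -
    have "\<not> (a = i \<and> b = i)" "\<not> (a = j \<and> b = j)" "\<not> (a = i \<and> b = j)" "\<not> (a = j \<and> b = i)"
      using that by blast+
    then show ?thesis unfolding h_def by (simp only: if_False)
  qed
  have "(frobenius_norm ?E)\<^sup>2 = (\<Sum>a<m. \<Sum>b<n. (h a b)\<^sup>2)"
    unfolding F_norm[symmetric] frobenius_norm_sq_carrier[OF F] by (intro sum.cong refl) (simp add: entry)
  also have "\<dots> = (\<Sum>(a, b)\<in>{..<m} \<times> {..<n}. (h a b)\<^sup>2)"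
    by (rule sum.cartesian_product)
  also have "\<dots> = (\<Sum>(a, b)\<in>({..<m} \<times> {..<n}) \<inter> ?T. (h a b)\<^sup>2)"
  proof (rule sum.mono_neutral_right)
    show "\<forall>p\<in>{..<m} \<times> {..<n} - ({..<m} \<times> {..<n}) \<inter> ?T. (case p of (a, b) \<Rightarrow> (h a b)\<^sup>2) = 0"
      using h_outside by fastforce
  qed (rule finite_cartesian_product[OF finite_lessThan finite_lessThan], rule Int_lower1)
  also have "\<dots> \<le> (\<Sum>(a, b)\<in>?T. (h a b)\<^sup>2)"
    by (rule sum_mono2[OF _ Int_lower2]) auto
  also have "\<dots> = (h i i)\<^sup>2 + ((h j j)\<^sup>2 + ((h i j)\<^sup>2 + (h j i)\<^sup>2))" using ij(3) by simp
  also have "\<dots> = rotation_cost x y t u"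
  proof -
    have "h i i = x * (cos u - cos t)" "h j j = y * (cos u - cos t)"
      "h i j = y * sin t - x * sin u" "h j i = y * sin u - x * sin t"
      using ij(3) unfolding h_def by simp_all
    then show ?thesis by (simp only: rotation_cost_def power_mult_distrib distrib_right add.assoc)
  qed
  finally have "(frobenius_dist A B)\<^sup>2 \<le> rotation_cost (\<sigma> i) (\<sigma> j) t u"
    unfolding x_def y_def frobenius_dist_def .
  then show ?thesis by (rule that[OF B svd[unfolded U'_def]])
qed

text \<open>
  Here \<open>U\<^sup>H U'\<close> is the rotation itself, and \<open>(j, i)\<close> is its only
  nonzero position with row outside and column inside \<open>\<pi>\<close>.
\<close>

lemma rotated_chordal_dist:
  fixes U :: "'a::rc_field mat"
  assumes U: "unitary_mat m U" and \<pi>: "\<pi> \<subseteq> {..<m}" and i: "i \<in> \<pi>" and j: "j \<in> {..<m} - \<pi>"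
  shows "chordal_dist m (card \<pi>) (cols_span U \<pi>) (cols_span (U * plane_rotation m i j t) \<pi>) = \<bar>sin t\<bar>"
proof -
  have ij: "i < m" "j < m" "i \<noteq> j" using i j \<pi> by auto
  let ?R = "plane_rotation m i j t :: 'a mat"
  note Uc = unitary_matD[OF U]
  have UR: "U\<^sup>H * (U * ?R) = ?R" by (rule isometry_left_cancel[OF Uc(1,2) plane_rotation_carrier])
  have fin: "finite \<pi>" using \<pi> finite_subset by blast
  have "(chordal_dist m (card \<pi>) (cols_span U \<pi>) (cols_span (U * ?R) \<pi>))\<^sup>2
      = (\<Sum>a\<in>{..<m} - \<pi>. \<Sum>b\<in>\<pi>. (norm (?R $$ (a, b)))\<^sup>2)"
    unfolding chordal_dist_eq[OF U unitary_mult[OF U plane_rotation_unitary[OF ij]] \<pi>] UR ..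
  also have "\<dots> = (\<Sum>a\<in>{..<m} - \<pi>. \<Sum>b\<in>\<pi>. if b = i then (if a = j then (sin t)\<^sup>2 else 0) else 0)"
    using i j \<pi> by (intro sum.cong refl) (auto simp: plane_rotation_def subset_eq)
  also have "\<dots> = (sin t)\<^sup>2" using i j fin by simp
  finally have "\<bar>chordal_dist m (card \<pi>) (cols_span U \<pi>) (cols_span (U * ?R) \<pi>)\<bar> = \<bar>sin t\<bar>"
    by (simp only: power2_eq_iff) auto
  then show ?thesis by (simp add: chordal_dist_def sum_nonneg)
qed

text \<open>
  The finite value of \<^const>\<open>gap_term\<close>, with \<open>x - y\<close> and \<open>x +
  y\<close> multiplied out.
\<close>

definition gap_ratio :: "real \<Rightarrow> real \<Rightarrow> real" where
  "gap_ratio x y = sqrt (x\<^sup>2 + y\<^sup>2) / \<bar>x\<^sup>2 - y\<^sup>2\<bar>"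

text \<open>
  Divided by \<open>t\<^sup>2\<close>, the cost of the angles \<open>t\<close> and \<open>b
  t\<close> tends to \<open>(y - x b)\<^sup>2 + (y b - x)\<^sup>2\<close>. The given
  \<open>b\<close> is the minimiser of this quadratic polynomial, and the minimum is
  \<open>(x\<^sup>2 - y\<^sup>2)\<^sup>2 / (x\<^sup>2 + y\<^sup>2)\<close>.
\<close>

lemma rotation_cost_limit:
  assumes xy: "x\<^sup>2 \<noteq> y\<^sup>2" and b: "b = 2 * x * y / (x\<^sup>2 + y\<^sup>2)"
  shows "((\<lambda>t. sin t / sqrt (rotation_cost x y t (b * t))) \<longlongrightarrow> gap_ratio x y) (at_right 0)"
    and "((\<lambda>t. sqrt (rotation_cost x y t (b * t))) \<longlongrightarrow> 0) (at_right 0)"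
proof -
  have s: "0 < x\<^sup>2 + y\<^sup>2" using xy by (auto simp: sum_power2_gt_zero_iff)
  have sin_lim: "((\<lambda>t. sin (c * t) / t) \<longlongrightarrow> c) (at_right 0)" for c :: real
  proof -
    have "((\<lambda>t. sin (c * t)) has_real_derivative cos (c * 0) * c) (at 0)"
      by (auto intro!: derivative_eq_intros)
    then show ?thesis by (simp add: has_field_derivative_iff filterlim_at_split)
  qed
  have cos_lim: "((\<lambda>t. (cos (b * t) - cos t) / t) \<longlongrightarrow> 0) (at_right 0)"
  proof -
    have "((\<lambda>t. cos (b * t) - cos t) has_real_derivative 0) (at 0)"
      by (auto intro!: derivative_eq_intros)
    then show ?thesis by (simp add: has_field_derivative_iff filterlim_at_split)
  qed
  let ?L = "(y - x * b)\<^sup>2 + (y * b - x)\<^sup>2"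
  have L: "?L = (x\<^sup>2 - y\<^sup>2)\<^sup>2 / (x\<^sup>2 + y\<^sup>2)"
  proof -
    have "?L * (x\<^sup>2 + y\<^sup>2) = (x\<^sup>2 - y\<^sup>2)\<^sup>2"
    proof -
      have bs: "b * (x\<^sup>2 + y\<^sup>2) = 2 * x * y" using s b by simp
      have "?L * (x\<^sup>2 + y\<^sup>2) = (x\<^sup>2 + y\<^sup>2)\<^sup>2 + (b * (x\<^sup>2 + y\<^sup>2))\<^sup>2 - 4 * x * y * (b * (x\<^sup>2 + y\<^sup>2))"
        by (simp add: power2_eq_square algebra_simps)
      also have "\<dots> = (x\<^sup>2 - y\<^sup>2)\<^sup>2" unfolding bs by (simp add: power2_eq_square algebra_simps)
      finally show ?thesis .
    qed
    moreover have "x\<^sup>2 + y\<^sup>2 \<noteq> 0" using s by linarith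
    ultimately show ?thesis by (simp only: nonzero_eq_divide_eq not_False_eq_True)
  qed
  define L where "L = ?L"
  have cost: "rotation_cost x y t (b * t) / t\<^sup>2 =
     (x\<^sup>2 + y\<^sup>2) * ((cos (b * t) - cos t) / t)\<^sup>2 + (y * (sin (1 * t) / t) - x * (sin (b * t) / t))\<^sup>2
       + (y * (sin (b * t) / t) - x * (sin (1 * t) / t))\<^sup>2" if "t \<noteq> 0" for t
    using that by (simp add: rotation_cost_def power_divide add_divide_distrib diff_divide_distrib[symmetric])
  have "((\<lambda>t. (x\<^sup>2 + y\<^sup>2) * ((cos (b * t) - cos t) / t)\<^sup>2 + (y * (sin (1 * t) / t) - x * (sin (b * t) / t))\<^sup>2
       + (y * (sin (b * t) / t) - x * (sin (1 * t) / t))\<^sup>2) \<longlongrightarrow>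
       (x\<^sup>2 + y\<^sup>2) * 0\<^sup>2 + (y * 1 - x * b)\<^sup>2 + (y * b - x * 1)\<^sup>2) (at_right 0)"
    by (intro tendsto_intros sin_lim cos_lim)
  then have "((\<lambda>t. (x\<^sup>2 + y\<^sup>2) * ((cos (b * t) - cos t) / t)\<^sup>2 + (y * (sin (1 * t) / t) - x * (sin (b * t) / t))\<^sup>2
       + (y * (sin (b * t) / t) - x * (sin (1 * t) / t))\<^sup>2) \<longlongrightarrow> L) (at_right 0)"
    by (simp add: L_def)
  moreover have nz: "\<forall>\<^sub>F t in at_right 0. (0::real) < t" by (rule eventually_at_right_less)
  then have "\<forall>\<^sub>F t in at_right 0. (x\<^sup>2 + y\<^sup>2) * ((cos (b * t) - cos t) / t)\<^sup>2
      + (y * (sin (1 * t) / t) - x * (sin (b * t) / t))\<^sup>2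
      + (y * (sin (b * t) / t) - x * (sin (1 * t) / t))\<^sup>2 = rotation_cost x y t (b * t) / t\<^sup>2"
    by (rule eventually_mono) (simp only: cost less_imp_neq[symmetric] not_False_eq_True)
  ultimately have lim: "((\<lambda>t. rotation_cost x y t (b * t) / t\<^sup>2) \<longlongrightarrow> L) (at_right 0)"
    by (rule Lim_transform_eventually)
  have L0: "0 < L" unfolding L_def L using s xy by simp
  have ratio: "((\<lambda>t. (sin (1 * t) / t) / sqrt (rotation_cost x y t (b * t) / t\<^sup>2)) \<longlongrightarrow> 1 / sqrt L) (at_right 0)"
    using L0 by (intro tendsto_divide tendsto_real_sqrt sin_lim lim) simp
  have eq: "\<forall>\<^sub>F t in at_right 0. (sin (1 * t) / t) / sqrt (rotation_cost x y t (b * t) / t\<^sup>2) = sin t / sqrt (rotation_cost x y t (b * t))"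
    using nz by (rule eventually_mono) (simp add: real_sqrt_divide)
  have "1 / sqrt L = gap_ratio x y"
    unfolding L_def L gap_ratio_def by (simp add: real_sqrt_divide)
  then show "((\<lambda>t. sin t / sqrt (rotation_cost x y t (b * t))) \<longlongrightarrow> gap_ratio x y) (at_right 0)"
    using Lim_transform_eventually[OF ratio eq] by (simp only:)
  have "((\<lambda>t. sqrt (rotation_cost x y t (b * t))) \<longlongrightarrow> sqrt (rotation_cost x y 0 (b * 0))) (at_right 0)"
    unfolding rotation_cost_def by (intro tendsto_intros)
  then show "((\<lambda>t. sqrt (rotation_cost x y t (b * t))) \<longlongrightarrow> 0) (at_right 0)"
    by (simp add: rotation_cost_def)
qed

section \<open>The condition number\<close>

text \<open>
  The lower estimate is demanded for positive \<open>K\<close> only, because for \<open>K =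
  0\<close> the point \<open>x\<close> may be isolated or \<open>f\<close> may be constant near
  \<open>x\<close>.
\<close>

lemma condition_number_eqI:
  fixes K :: real
  assumes K: "0 \<le> K"
    and upper: "\<And>\<delta>. 0 < \<delta> \<Longrightarrow> \<forall>\<^sub>F \<epsilon> in at_right 0. \<forall>x'\<in>X. 0 < dX x x' \<longrightarrow> dX x x' \<le> \<epsilon> \<longrightarrow>
                  dY (f x) (f x') \<le> (K + \<delta>) * dX x x'"
    and lower: "\<And>\<delta> \<epsilon>. 0 < K \<Longrightarrow> 0 < \<delta> \<Longrightarrow> 0 < \<epsilon> \<Longrightarrow>
                  \<exists>x'\<in>X. 0 < dX x x' \<and> dX x x' \<le> \<epsilon> \<and> (K - \<delta>) * dX x x' \<le> dY (f x) (f x')"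
  shows "condition_number X dX dY f x = ennreal K"
proof -
  define g where "g \<epsilon> = (SUP x' \<in> {x' \<in> X. 0 < dX x x' \<and> dX x x' \<le> \<epsilon>}. ennreal (dY (f x) (f x') / dX x x'))" for \<epsilon> :: real
  have ge: "ennreal K \<le> g \<epsilon>" if "0 < \<epsilon>" for \<epsilon>
  proof (cases "K = 0")
    case False
    show ?thesis
    proof (rule ennreal_le_epsilon)
      fix \<delta> :: real assume "0 < \<delta>"
      then obtain x' where x': "x' \<in> X" "0 < dX x x'" "dX x x' \<le> \<epsilon>" "(K - \<delta>) * dX x x' \<le> dY (f x) (f x')"
        using lower[of \<delta> \<epsilon>] K False \<open>0 < \<epsilon>\<close> by auto
      let ?r = "dY (f x) (f x') / dX x x'"
      have r: "K - \<delta> \<le> ?r" using x' by (simp add: field_simps)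
      have "ennreal K \<le> ennreal (max 0 ?r + \<delta>)" using r by (intro ennreal_leI) auto
      also have "\<dots> = ennreal ?r + ennreal \<delta>" using \<open>0 < \<delta>\<close> by (simp add: ennreal_plus max_def ennreal_neg)
      also have "ennreal ?r \<le> g \<epsilon>" unfolding g_def using x' by (intro SUP_upper) auto
      finally show "ennreal K \<le> g \<epsilon> + ennreal \<delta>" by simp
    qed
  qed simp
  have "(g \<longlongrightarrow> ennreal K) (at_right 0)"
  proof (rule order_tendstoI)
    fix a assume "a < ennreal K"
    then show "\<forall>\<^sub>F \<epsilon> in at_right 0. a < g \<epsilon>"
      using ge by (intro eventually_mono[OF eventually_at_right_less[of "0::real"]]) (rule less_le_trans)
  next
    fix a assume "ennreal K < a"
    then obtain c where c: "ennreal K < c" "c < a" using dense by blast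
    then obtain r where r: "0 \<le> r" "c = ennreal r" by (metis ennreal_cases not_top_less top.not_eq_extremum)
    have Kr: "K < r" using c(1) r K by (simp add: ennreal_less_iff)
    have "\<forall>\<^sub>F \<epsilon> in at_right 0. \<forall>x'\<in>X. 0 < dX x x' \<longrightarrow> dX x x' \<le> \<epsilon> \<longrightarrow> dY (f x) (f x') \<le> (K + (r - K)) * dX x x'"
      using Kr by (intro upper) simp
    then show "\<forall>\<^sub>F \<epsilon> in at_right 0. g \<epsilon> < a"
    proof (rule eventually_mono)
      fix \<epsilon> assume *: "\<forall>x'\<in>X. 0 < dX x x' \<longrightarrow> dX x x' \<le> \<epsilon> \<longrightarrow> dY (f x) (f x') \<le> (K + (r - K)) * dX x x'"
      have "g \<epsilon> \<le> ennreal r"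
        unfolding g_def using * by (intro SUP_least ennreal_leI) (auto simp: field_simps)
      then show "g \<epsilon> < a" using c(2) r(2) by simp
    qed
  qed
  then have "Lim (at_right 0) g = ennreal K" by (intro tendsto_Lim) simp
  then show ?thesis by (simp add: condition_number_def g_def[abs_def])
qed

lemma gap_ratio_commute: "gap_ratio x y = gap_ratio y x"
  by (simp add: gap_ratio_def add.commute abs_minus_commute)

lemma gap_term_eq:
  assumes "0 \<le> x" "0 \<le> y" "x \<noteq> y"
  shows "gap_term x y = ennreal (gap_ratio x y)"
proof -
  have "x\<^sup>2 - y\<^sup>2 = (x - y) * (x + y)" by (simp add: power2_eq_square algebra_simps)
  then have "\<bar>x\<^sup>2 - y\<^sup>2\<bar> = \<bar>x - y\<bar> * (x + y)" using assms by (simp add: abs_mult)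
  then show ?thesis using assms by (simp add: gap_term_def gap_ratio_def real_sqrt_divide)
qed

text \<open>
  The inequality \<open>gap_ratio x y < K + \<delta>\<close>, with denominators cleared and squared,
  is a strict inequality between polynomials in \<open>y\<close> and hence survives small changes of
  \<open>y\<close>.
\<close>

lemma gap_ratio_stable:
  assumes xy: "0 \<le> x" "0 \<le> y" "x \<noteq> y" and K: "gap_ratio x y \<le> K" and \<delta>: "0 < \<delta>"
  shows "\<forall>\<^sub>F \<epsilon> in at_right 0. \<forall>t. \<bar>t - y\<bar> \<le> \<epsilon> \<longrightarrow> x\<^sup>2 + t\<^sup>2 < (K + \<delta>)\<^sup>2 * (x\<^sup>2 - t\<^sup>2)\<^sup>2"
proof -
  have ne: "0 < \<bar>x\<^sup>2 - y\<^sup>2\<bar>" using xy by (simp add: power2_eq_iff_nonneg)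
  have "sqrt (x\<^sup>2 + y\<^sup>2) \<le> K * \<bar>x\<^sup>2 - y\<^sup>2\<bar>" using K ne by (simp add: gap_ratio_def field_simps)
  also have "\<dots> < (K + \<delta>) * \<bar>x\<^sup>2 - y\<^sup>2\<bar>" using \<delta> ne by (intro mult_strict_right_mono) auto
  finally have "(sqrt (x\<^sup>2 + y\<^sup>2))\<^sup>2 < ((K + \<delta>) * \<bar>x\<^sup>2 - y\<^sup>2\<bar>)\<^sup>2"
    by (intro power_strict_mono) auto
  then have pos: "0 < (K + \<delta>)\<^sup>2 * (x\<^sup>2 - y\<^sup>2)\<^sup>2 - (x\<^sup>2 + y\<^sup>2)" by (simp add: power_mult_distrib)
  have "((\<lambda>t. (K + \<delta>)\<^sup>2 * (x\<^sup>2 - t\<^sup>2)\<^sup>2 - (x\<^sup>2 + t\<^sup>2)) \<longlongrightarrow> (K + \<delta>)\<^sup>2 * (x\<^sup>2 - y\<^sup>2)\<^sup>2 - (x\<^sup>2 + y\<^sup>2)) (nhds y)"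
    by (intro tendsto_intros filterlim_ident)
  from order_tendstoD(1)[OF this pos]
  obtain d where d: "0 < d" "\<And>t. \<bar>t - y\<bar> < d \<Longrightarrow> 0 < (K + \<delta>)\<^sup>2 * (x\<^sup>2 - t\<^sup>2)\<^sup>2 - (x\<^sup>2 + t\<^sup>2)"
    unfolding eventually_nhds_metric dist_real_def by blast
  show ?thesis
    unfolding eventually_at_right_field
  proof (intro exI[of _ d] conjI allI impI)
    fix \<epsilon> t assume "\<epsilon> < d" "\<bar>t - y\<bar> \<le> \<epsilon>"
    then show "x\<^sup>2 + t\<^sup>2 < (K + \<delta>)\<^sup>2 * (x\<^sup>2 - t\<^sup>2)\<^sup>2" using d(2)[of t] by simp
  qed (rule d(1))
qed

lemma frobenius_dist_commute:
  fixes A B :: "'a::real_normed_vector mat"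
  assumes "A \<in> carrier_mat m n" "B \<in> carrier_mat m n"
  shows "frobenius_dist A B = frobenius_dist B A"
  using assms by (auto simp: frobenius_dist_def frobenius_norm_def norm_minus_commute)

lemma frobenius_dist_nonneg: "0 \<le> frobenius_dist A B"
  by (simp add: frobenius_dist_def)

lemma frobenius_dist_eq_0:
  fixes A B :: "'a::real_normed_vector mat"
  assumes A: "A \<in> carrier_mat m n" and B: "B \<in> carrier_mat m n" and 0: "frobenius_dist A B = 0"
  shows "A = B"
proof (rule eq_matI)
  have AB: "A - B \<in> carrier_mat m n" using B by auto
  have "(\<Sum>i<m. \<Sum>j<n. (norm ((A - B) $$ (i, j)))\<^sup>2) = 0"
    using 0 frobenius_norm_sq_carrier[OF AB] by (simp add: frobenius_dist_def)
  then have "(norm ((A - B) $$ (i, j)))\<^sup>2 = 0" if "i < m" "j < n" for i j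
    using that by (simp add: sum_nonneg_eq_0_iff sum_nonneg)
  then show "A $$ (i, j) = B $$ (i, j)" if "i < dim_row B" "j < dim_col B" for i j
    using that A B by simp
qed (use A B in auto)

text \<open>
  The allowance \<open>\<delta>\<close> is split into two halves: one pays for replacing the
  singular values of \<open>B\<close> by those of \<open>A\<close>, the other one for passing from
  the chordal to the Grassmann distance.
\<close>

lemma singular_subspace_distance_upper:
  fixes A :: "'a::rc_field mat"
  assumes A: "A \<in> carrier_mat m n" and F: "full_svd A U \<sigma> V" and \<pi>: "\<pi> \<subseteq> {..<m}"
    and gap: "\<forall>i\<in>\<pi>. \<forall>j\<in>{..<m} - \<pi>. \<sigma> i \<noteq> \<sigma> j"
    and K: "0 \<le> K" "\<forall>i\<in>\<pi>. \<forall>j\<in>{..<m} - \<pi>. gap_ratio (\<sigma> i) (\<sigma> j) \<le> K" and \<delta>: "0 < \<delta>"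
  shows "\<forall>\<^sub>F \<epsilon> in at_right 0. \<forall>B\<in>left_singular_domain m n \<pi>. frobenius_dist A B \<le> \<epsilon> \<longrightarrow>
           grassmann_dist m (card \<pi>) (left_singular_map \<pi> A) (left_singular_map \<pi> B)
             \<le> (K + \<delta>) * frobenius_dist A B"
proof -
  note D = full_svdD[OF A F]
  define c where "c = K + \<delta> / 2"
  have c: "0 < c" using K \<delta> by (simp add: c_def)
  have \<delta>c: "0 < \<delta> / (2 * c)" using \<delta> c by simp
  obtain \<eta> where \<eta>: "0 < \<eta>"
    "\<And>m U U' \<pi>. unitary_mat m (U :: 'a mat) \<Longrightarrow> unitary_mat m U' \<Longrightarrow> \<pi> \<subseteq> {..<m} \<Longrightarrow>
        chordal_dist m (card \<pi>) (cols_span U \<pi>) (cols_span U' \<pi>) \<le> \<eta> \<Longrightarrow>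
        grassmann_dist m (card \<pi>) (cols_span U \<pi>) (cols_span U' \<pi>)
          \<le> (1 + \<delta> / (2 * c)) * chordal_dist m (card \<pi>) (cols_span U \<pi>) (cols_span U' \<pi>)"
    using grassmann_le_chordal[OF \<delta>c, where ?'a = 'a] by metis
  let ?S = "{(i, j). i < m \<and> j < m \<and> (i \<in> \<pi> \<longleftrightarrow> j \<notin> \<pi>)}"
  \<comment> \<open>Both off-diagonal blocks are needed; for the second one the roles in \<open>gap_ratio\<close> are swapped.\<close>
  have fin: "finite ?S" by (rule finite_subset[of _ "{..<m} \<times> {..<m}"]) auto
  have "\<forall>p\<in>?S. \<forall>\<^sub>F \<epsilon> in at_right 0. \<forall>t. \<bar>t - \<sigma> (snd p)\<bar> \<le> \<epsilon> \<longrightarrow>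
      (\<sigma> (fst p))\<^sup>2 + t\<^sup>2 < (K + \<delta> / 2)\<^sup>2 * ((\<sigma> (fst p))\<^sup>2 - t\<^sup>2)\<^sup>2"
  proof
    fix p assume "p \<in> ?S"
    then obtain i j where p: "p = (i, j)" "i < m" "j < m" "i \<in> \<pi> \<longleftrightarrow> j \<notin> \<pi>" by auto
    have "\<sigma> i \<noteq> \<sigma> j \<and> gap_ratio (\<sigma> i) (\<sigma> j) \<le> K"
    proof (cases "i \<in> \<pi>")
      case True
      then show ?thesis using p gap K(2) by auto
    next
      case False
      then have "j \<in> \<pi>" "i \<in> {..<m} - \<pi>" using p by auto
      then show ?thesis using gap K(2) gap_ratio_commute[of "\<sigma> i" "\<sigma> j"] by metis
    qed
    then show "\<forall>\<^sub>F \<epsilon> in at_right 0. \<forall>t. \<bar>t - \<sigma> (snd p)\<bar> \<le> \<epsilon> \<longrightarrow>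
      (\<sigma> (fst p))\<^sup>2 + t\<^sup>2 < (K + \<delta> / 2)\<^sup>2 * ((\<sigma> (fst p))\<^sup>2 - t\<^sup>2)\<^sup>2"
      unfolding p(1) fst_conv snd_conv using \<delta> by (intro gap_ratio_stable D(4)) auto
  qed
  from eventually_ball_finite[OF fin this]
  have stable: "\<forall>\<^sub>F \<epsilon> in at_right 0. \<forall>p\<in>?S. \<forall>t. \<bar>t - \<sigma> (snd p)\<bar> \<le> \<epsilon> \<longrightarrow>
      (\<sigma> (fst p))\<^sup>2 + t\<^sup>2 < c\<^sup>2 * ((\<sigma> (fst p))\<^sup>2 - t\<^sup>2)\<^sup>2" unfolding c_def .
  have "\<forall>\<^sub>F \<epsilon> in at_right 0. \<epsilon> < \<eta> / c"
    using \<eta>(1) c by (auto simp: eventually_at_right_field intro!: exI[of _ "\<eta> / c"])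
  with stable show ?thesis
  proof eventually_elim
    case (elim \<epsilon>)
    show ?case
    proof (intro ballI impI)
      fix B :: "'a mat" assume Bd: "B \<in> left_singular_domain m n \<pi>" and dist: "frobenius_dist A B \<le> \<epsilon>"
      have B: "B \<in> carrier_mat m n" using Bd by (simp add: left_singular_domain_def)
      obtain U' \<tau> V' where G: "full_svd B U' \<tau> V'" using svd_exists[OF B] by blast
      note D' = full_svdD[OF B G]
      have gap': "\<forall>i\<in>\<pi>. \<forall>j\<in>{..<m} - \<pi>. \<tau> i \<noteq> \<tau> j" using Bd left_singular_domain_iff[OF B G \<pi>] by blast
      have maps: "left_singular_map \<pi> A = cols_span U \<pi>" "left_singular_map \<pi> B = cols_span U' \<pi>"
        by (rule left_singular_map_eq[OF A F \<pi> gap], rule left_singular_map_eq[OF B G \<pi> gap'])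
      let ?ch = "chordal_dist m (card \<pi>) (cols_span U \<pi>) (cols_span U' \<pi>)"
      have ch: "?ch \<le> c * frobenius_dist A B"
      proof (rule chordal_dist_svd_le[OF A F B G \<pi>])
        fix i j assume ij: "i < m" "j < m" "i \<in> \<pi> \<longleftrightarrow> j \<notin> \<pi>"
        have "\<bar>\<tau> j - \<sigma> j\<bar> \<le> \<epsilon>"
          using singular_value_perturbation[OF A F B G ij(2)] singular_value_perturbation[OF B G A F ij(2)]
            frobenius_dist_commute[OF A B] dist by linarith
        moreover have "(i, j) \<in> ?S" using ij by simp
        ultimately show "(\<sigma> i)\<^sup>2 + (\<tau> j)\<^sup>2 < c\<^sup>2 * ((\<sigma> i)\<^sup>2 - (\<tau> j)\<^sup>2)\<^sup>2"
          using bspec[OF elim(1), of "(i, j)"] by simp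
      qed (use c in simp)
      also have "\<dots> \<le> c * \<epsilon>" using dist c by simp
      also have "\<dots> \<le> \<eta>" using elim(2) c by (simp add: field_simps)
      finally have "grassmann_dist m (card \<pi>) (cols_span U \<pi>) (cols_span U' \<pi>) \<le> (1 + \<delta> / (2 * c)) * ?ch"
        by (rule \<eta>(2)[OF D(1) D'(1) \<pi>])
      also have "\<dots> \<le> (1 + \<delta> / (2 * c)) * (c * frobenius_dist A B)"
        using ch \<delta>c by (intro mult_left_mono) auto
      also have "\<dots> = (K + \<delta>) * frobenius_dist A B"
      proof -
        have "(1 + \<delta> / (2 * c)) * c = c + \<delta> / 2" using c by (simp add: distrib_right)
        then have "(1 + \<delta> / (2 * c)) * c = K + \<delta>" unfolding c_def by simp
        then show ?thesis by (simp only: mult.assoc[symmetric])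
      qed
      finally show "grassmann_dist m (card \<pi>) (left_singular_map \<pi> A) (left_singular_map \<pi> B)
             \<le> (K + \<delta>) * frobenius_dist A B" unfolding maps .
    qed
  qed
qed

text \<open>
  Take the rotated matrix for a small angle. It has the singular values of \<open>A\<close> and so
  belongs to the domain.
\<close>

lemma singular_subspace_distance_lower:
  fixes A :: "'a::rc_field mat"
  assumes A: "A \<in> carrier_mat m n" and F: "full_svd A U \<sigma> V" and \<pi>: "\<pi> \<subseteq> {..<m}"
    and gap: "\<forall>i\<in>\<pi>. \<forall>j\<in>{..<m} - \<pi>. \<sigma> i \<noteq> \<sigma> j"
    and i: "i \<in> \<pi>" and j: "j \<in> {..<m} - \<pi>" and \<delta>: "0 < \<delta>" and \<epsilon>: "0 < \<epsilon>"
  shows "\<exists>B\<in>left_singular_domain m n \<pi>. 0 < frobenius_dist A B \<and> frobenius_dist A B \<le> \<epsilon> \<and>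
           (gap_ratio (\<sigma> i) (\<sigma> j) - \<delta>) * frobenius_dist A B
             \<le> chordal_dist m (card \<pi>) (left_singular_map \<pi> A) (left_singular_map \<pi> B)"
proof -
  note D = full_svdD[OF A F]
  let ?x = "\<sigma> i" and ?y = "\<sigma> j"
  have ij: "i < m" "j < m" "i \<noteq> j" using i j \<pi> by auto
  have "?x \<noteq> ?y" using gap i j by blast
  then have xy: "?x\<^sup>2 \<noteq> ?y\<^sup>2" using D(4) by (simp add: power2_eq_iff_nonneg)
  define b where "b = 2 * ?x * ?y / (?x\<^sup>2 + ?y\<^sup>2)"
  let ?q = "\<lambda>t. sqrt (rotation_cost ?x ?y t (b * t))"
  have e1: "\<forall>\<^sub>F t in at_right 0. gap_ratio ?x ?y - \<delta> < sin t / ?q t"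
    using order_tendstoD(1)[OF rotation_cost_limit(1)[OF xy b_def]] \<delta> by simp
  have e2: "\<forall>\<^sub>F t in at_right 0. ?q t < \<epsilon>"
    using order_tendstoD(2)[OF rotation_cost_limit(2)[OF xy b_def] \<epsilon>] .
  have e3: "\<forall>\<^sub>F t in at_right 0. (0::real) < t \<and> t < 1"
    by (auto simp: eventually_at_right_field intro!: exI[of _ 1])
  have "\<forall>\<^sub>F t in at_right 0. gap_ratio ?x ?y - \<delta> < sin t / ?q t \<and> ?q t < \<epsilon> \<and> 0 < t \<and> t < 1"
    using e1 e2 e3 by eventually_elim simp
  then obtain t where t: "gap_ratio ?x ?y - \<delta> < sin t / ?q t" "?q t < \<epsilon>" "0 < t" "t < 1"
    using eventually_happens'[OF trivial_limit_at_right_real] by blast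
  have st: "0 < sin t" using t pi_gt3 by (intro sin_gt_zero) auto
  \<comment> \<open>If \<open>i\<close> or \<open>j\<close> is at least \<open>n\<close>, then \<open>\<sigma>\<^sub>i \<sigma>\<^sub>j = 0\<close> and the right angle is 0.\<close>
  have u: "i < n \<and> j < n \<or> b * t = 0"
    using D(6)[of i] D(6)[of j] by (auto simp: b_def not_less)
  obtain B V' where B: "B \<in> carrier_mat m n" and G: "full_svd B (U * plane_rotation m i j t) \<sigma> V'"
    and cost: "(frobenius_dist A B)\<^sup>2 \<le> rotation_cost ?x ?y t (b * t)"
    using rotated_svd[OF A F ij u] by blast
  let ?U' = "U * plane_rotation m i j t"
  have Bd: "B \<in> left_singular_domain m n \<pi>" using left_singular_domain_iff[OF B G \<pi>] gap by blast
  have maps: "left_singular_map \<pi> A = cols_span U \<pi>" "left_singular_map \<pi> B = cols_span ?U' \<pi>"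
    by (rule left_singular_map_eq[OF A F \<pi> gap], rule left_singular_map_eq[OF B G \<pi> gap])
  have ch: "chordal_dist m (card \<pi>) (left_singular_map \<pi> A) (left_singular_map \<pi> B) = sin t"
    unfolding maps rotated_chordal_dist[OF D(1) \<pi> i j] using st by simp
  have dist: "frobenius_dist A B \<le> ?q t" using cost by (rule real_le_rsqrt)
  have pos: "0 < frobenius_dist A B"
  proof (rule ccontr)
    assume "\<not> 0 < frobenius_dist A B"
    then have "A = B" using frobenius_dist_eq_0[OF A B] frobenius_dist_nonneg[of A B] by simp
    then have "chordal_dist m (card \<pi>) (cols_span U \<pi>) (cols_span U \<pi>) = sin t"
      using ch maps(1) by (simp only:)
    then show False
      using rotated_chordal_dist[OF D(1) \<pi> i j, of 0] st unitary_matD(1)[OF D(1)]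
      by (simp add: plane_rotation_zero)
  qed
  have "(gap_ratio ?x ?y - \<delta>) * frobenius_dist A B \<le> sin t"
  proof (cases "0 \<le> gap_ratio ?x ?y - \<delta>")
    case True
    then have "(gap_ratio ?x ?y - \<delta>) * frobenius_dist A B \<le> (gap_ratio ?x ?y - \<delta>) * ?q t"
      using dist by (intro mult_left_mono)
    also have "\<dots> \<le> sin t"
    proof -
      have "0 < ?q t" using pos dist by linarith
      from iffD1[OF pos_less_divide_eq[OF this] t(1)] show ?thesis by simp
    qed
    finally show ?thesis .
  next
    case False
    then have "(gap_ratio ?x ?y - \<delta>) * frobenius_dist A B \<le> 0"
      using pos by (simp add: mult_le_0_iff)
    then show ?thesis using st by linarith
  qed
  then show ?thesis using Bd pos dist t(2) ch by (intro bexI[of _ B]) auto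
qed

text \<open>
  Every admissible distance lies between the chordal and the Grassmann distance, so the lower
  estimate for the former and the upper estimate for the latter apply to it.
\<close>

lemma kappa_left_eq_gap_ratio:
  fixes A :: "'a::rc_field mat"
  assumes A: "A \<in> carrier_mat m n" and F: "full_svd A U \<sigma> V" and \<pi>: "\<pi> \<subseteq> {..<m}"
    and gap: "\<forall>i\<in>\<pi>. \<forall>j\<in>{..<m} - \<pi>. \<sigma> i \<noteq> \<sigma> j"
    and dGr: "dGr \<in> {chordal_dist, grassmann_dist, procrustes_dist}"
    and K: "0 \<le> K" "\<forall>i\<in>\<pi>. \<forall>j\<in>{..<m} - \<pi>. gap_ratio (\<sigma> i) (\<sigma> j) \<le> K"
    and attained: "K = 0 \<or> (\<exists>i\<in>\<pi>. \<exists>j\<in>{..<m} - \<pi>. gap_ratio (\<sigma> i) (\<sigma> j) = K)"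
  shows "kappa_left dGr m n \<pi> A = ennreal K"
proof -
  have Ad: "A \<in> left_singular_domain m n \<pi>" using left_singular_domain_iff[OF A F \<pi>] gap by blast
  have between: "chordal_dist m (card \<pi>) (left_singular_map \<pi> A) (left_singular_map \<pi> B)
        \<le> dGr m (card \<pi>) (left_singular_map \<pi> A) (left_singular_map \<pi> B)
      \<and> dGr m (card \<pi>) (left_singular_map \<pi> A) (left_singular_map \<pi> B)
        \<le> grassmann_dist m (card \<pi>) (left_singular_map \<pi> A) (left_singular_map \<pi> B)"
    if Bd: "B \<in> left_singular_domain m n \<pi>" for B
  proof -
    have B: "B \<in> carrier_mat m n" using Bd by (simp add: left_singular_domain_def)
    obtain U' \<tau> V' where G: "full_svd B U' \<tau> V'" using svd_exists[OF B] by blast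
    have gap': "\<forall>i\<in>\<pi>. \<forall>j\<in>{..<m} - \<pi>. \<tau> i \<noteq> \<tau> j" using Bd left_singular_domain_iff[OF B G \<pi>] by blast
    show ?thesis
      unfolding left_singular_map_eq[OF A F \<pi> gap] left_singular_map_eq[OF B G \<pi> gap']
      using dGr chordal_le_procrustes_le_grassmann[OF full_svdD(1)[OF A F] full_svdD(1)[OF B G] \<pi>] by auto
  qed
  have "condition_number (left_singular_domain m n \<pi>) frobenius_dist (dGr m (card \<pi>)) (left_singular_map \<pi>) A = ennreal K"
  proof (rule condition_number_eqI[OF K(1)])
    fix \<delta> :: real assume "0 < \<delta>"
    from singular_subspace_distance_upper[OF A F \<pi> gap K this]
    show "\<forall>\<^sub>F \<epsilon> in at_right 0. \<forall>B\<in>left_singular_domain m n \<pi>. 0 < frobenius_dist A B \<longrightarrow> frobenius_dist A B \<le> \<epsilon> \<longrightarrow>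
        dGr m (card \<pi>) (left_singular_map \<pi> A) (left_singular_map \<pi> B) \<le> (K + \<delta>) * frobenius_dist A B"
      by (rule eventually_mono) (use between order_trans in blast)
  next
    fix \<delta> \<epsilon> :: real assume "0 < K" "0 < \<delta>" "0 < \<epsilon>"
    then obtain i j where "i \<in> \<pi>" "j \<in> {..<m} - \<pi>" "gap_ratio (\<sigma> i) (\<sigma> j) = K" using attained by auto
    then show "\<exists>B\<in>left_singular_domain m n \<pi>. 0 < frobenius_dist A B \<and> frobenius_dist A B \<le> \<epsilon> \<and>
        (K - \<delta>) * frobenius_dist A B \<le> dGr m (card \<pi>) (left_singular_map \<pi> A) (left_singular_map \<pi> B)"
      using singular_subspace_distance_lower[OF A F \<pi> gap _ _ \<open>0 < \<delta>\<close> \<open>0 < \<epsilon>\<close>, of i j] between order_trans by blast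
  qed
  then show ?thesis using Ad by (simp add: kappa_left_def)
qed

lemma kappa_left_eq_max_gap_term:
  fixes A :: "'a::rc_field mat"
  assumes A: "A \<in> carrier_mat m n" and \<pi>: "\<pi> \<subseteq> {..<m}"
    and dGr: "dGr \<in> {chordal_dist, grassmann_dist, procrustes_dist}"
  shows "kappa_left dGr m n \<pi> A = max_gap_term m \<pi> (singular_value A)"
proof -
  obtain U \<sigma> V where F: "full_svd A U \<sigma> V" using svd_exists[OF A] by blast
  note D = full_svdD[OF A F]
  have fin: "finite \<pi>" using \<pi> finite_subset by blast
  let ?I = "(\<lambda>(i, j). gap_term (\<sigma> i) (\<sigma> j)) ` (\<pi> \<times> ({..<m} - \<pi>))"
  have finI: "finite ?I" using fin by auto
  show ?thesis
  proof (cases "\<forall>i\<in>\<pi>. \<forall>j\<in>{..<m} - \<pi>. \<sigma> i \<noteq> \<sigma> j")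
    case False
    then obtain i j where ij: "i \<in> \<pi>" "j \<in> {..<m} - \<pi>" "\<sigma> i = \<sigma> j" by blast
    have "A \<notin> left_singular_domain m n \<pi>" using left_singular_domain_iff[OF A F \<pi>] False by blast
    then have 1: "kappa_left dGr m n \<pi> A = \<infinity>" by (simp add: kappa_left_def)
    have "gap_term (\<sigma> i) (\<sigma> j) \<in> ?I" using ij by (intro image_eqI[of _ _ "(i, j)"]) auto
    then have "\<infinity> \<le> Max ?I" using Max_ge[OF finI, of "gap_term (\<sigma> i) (\<sigma> j)"] ij by (simp add: gap_term_def)
    then have "Max ?I = \<infinity>" by (simp add: top_unique)
    moreover have "\<pi> \<noteq> {}" "{..<m} - \<pi> \<noteq> {}" using ij by auto
    ultimately show ?thesis unfolding singular_value_eq[OF A F] max_gap_term_def 1 by simp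
  next
    case gap: True
    have term_eq: "gap_term (\<sigma> i) (\<sigma> j) = ennreal (gap_ratio (\<sigma> i) (\<sigma> j))" if "i \<in> \<pi>" "j \<in> {..<m} - \<pi>" for i j
      using gap that D(4) by (intro gap_term_eq) auto
    show ?thesis
    proof (cases "\<pi> = {} \<or> {..<m} - \<pi> = {}")
      case True
      then have "kappa_left dGr m n \<pi> A = ennreal 0"
        by (intro kappa_left_eq_gap_ratio[OF A F \<pi> gap dGr]) auto
      then show ?thesis using True unfolding max_gap_term_def by simp
    next
      case False
      then have "Max ?I \<in> ?I" using finI by (intro Max_in) auto
      then obtain i j where ij: "i \<in> \<pi>" "j \<in> {..<m} - \<pi>" and max: "Max ?I = gap_term (\<sigma> i) (\<sigma> j)" by auto
      let ?K = "gap_ratio (\<sigma> i) (\<sigma> j)"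
      have K0: "0 \<le> ?K" by (simp add: gap_ratio_def)
      have "gap_ratio (\<sigma> k) (\<sigma> l) \<le> ?K" if kl: "k \<in> \<pi>" "l \<in> {..<m} - \<pi>" for k l
      proof -
        have "gap_term (\<sigma> k) (\<sigma> l) \<in> ?I" using kl by (intro image_eqI[of _ _ "(k, l)"]) auto
        then have "gap_term (\<sigma> k) (\<sigma> l) \<le> gap_term (\<sigma> i) (\<sigma> j)" using Max_ge[OF finI] max by metis
        then show ?thesis unfolding term_eq[OF ij] term_eq[OF kl] using K0 by (simp add: ennreal_le_iff)
      qed
      then have "kappa_left dGr m n \<pi> A = ennreal ?K"
        using ij K0 by (intro kappa_left_eq_gap_ratio[OF A F \<pi> gap dGr]) auto
      then show ?thesis
        unfolding singular_value_eq[OF A F] max_gap_term_def using False max term_eq[OF ij] by simp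
    qed
  qed
qed

theorem theorem1:
  fixes m n :: nat and \<pi> :: "nat set"
  assumes "\<pi> \<subseteq> {..<m}"
  shows
    "(\<forall>A \<in> carrier_mat m n :: real mat set.
        \<forall>dGr \<in> {chordal_dist, grassmann_dist, procrustes_dist}.
          kappa_left dGr m n \<pi> A = max_gap_term m \<pi> (singular_value A)) \<and>
     (\<forall>A \<in> carrier_mat m n :: complex mat set.
        \<forall>dGr \<in> {chordal_dist, grassmann_dist, procrustes_dist}.
          kappa_left dGr m n \<pi> A = max_gap_term m \<pi> (singular_value A))"
  by (intro conjI ballI kappa_left_eq_max_gap_term[OF _ assms])

end
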